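(* (Spaltenstein's fibration.) Let $K$ be an algebraically closed field, $Q$ the oriented cycle with $n$ vertices, $A=KQ$, and let $\underline{\mathbf d}=(0=\underline d^0,\underline d^1,\dots,\underline d^r=\underline d)$ be a complete dimension filtration. Let $M$ be a nilpotent $A$-module of dimension vector $\underline d$. Set $s_i:=\dim_K \operatorname{soc}(M)_i$ and fix a complete $Q_0$-graded flag in $\operatorname{soc}(M)$ refining the filtration $\operatorname{soc}(M)\cap\operatorname{rad}^{\bullet}(M)$. For $w\in\prod_{i\in Q_0}\operatorname{Mat}(1\times(s_i+1),\mathbb{N}_0)$ let $\mathrm{Gr}\binom{M}{\underline d^1}_w\subset \mathrm{Gr}\binom{M}{\underline d^1}$ be the stratum of submodules of dimension vector $\underline d^1$ having relative position $w$ with respect to the fixed flag. Let $p\colon \mathrm{Fl}\binom{M}{\underline{\mathbf d}}\to\mathrm{Gr}\binom{M}{\underline d^1}$, $U^\bullet\mapsto U^1$, be the map forgetting all but the first subspace. Let $U_0\in \mathrm{Gr}\binom{M}{\underline d^1}_w$ be arbitrary, $N:=M/U_0$ and $\underline{\mathbf e}:=(\underline d^1-\underline d^1,\underline d^2-\underline d^1,\dots,\underline d^r-\underline d^1)$. Then there is an isomorphism of algebraic varieties $$f\colon p^{-1}\Bigl(\mathrm{Gr}\binom{M}{\underline d^1}_w\Bigr)\longrightarrow \mathrm{Gr}\binom{M}{\underline d^1}_w\times\mathrm{Fl}\binom{N}{\underline{\mathbf e}}$$ such that $pr_1\circ f=p$ and $([N],sp)\circ pr_2\circ f=sp$ on $p^{-1}\bigl(\mathrm{Gr}\binom{M}{\underline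 d^1}_w\bigr)$. Here $pr_1,pr_2$ are the projections of the product, $sp(U^\bullet)=([M/U^k])_{1\le k\le r}$ on the left-hand variety, and for $V^\bullet=(0=V^0\subset V^1\subset\cdots\subset V^{r-1}=N)\in\mathrm{Fl}\binom{N}{\underline{\mathbf e}}$ one has $([N],sp)(V^\bullet)=([N],[N/V^1],\dots,[N/V^{r-1}])$, where $[X]$ denotes the isomorphism class of an $A$-module $X$.
   Context: The oriented cycle $Q$ has vertices $Q_0=\{1,\dots,n\}$ identified with $\mathbb{Z}/n\mathbb{Z}$ and arrows $a_i\colon i\to i+1$. An $A$-module is given by vector spaces $V_1,\dots,V_n$ and linear maps $f_i\colon V_i\to V_{i+1}$, with dimension vector $\underline{\dim}\,M=(\dim V_1,\dots,\dim V_n)\in\mathbb{N}_0^{Q_0}$; it is nilpotent if all $V_i$ are finite-dimensional and every composition $f_{i+n-1}\circ\cdots\circ f_i\colon V_i\to V_i$ is nilpotent. A complete dimension filtration $\underline{\mathbf d}=(0=\underline d^0,\underline d^1,\dots,\underline d^r=\underline d)$ is a sequence in $\mathbb{N}_0^{Q_0}$ with $|\underline d^{t+1}|-|\underline d^t|=1$ for $0\le t\le r-1$, where $|v|=\sum_i v_i$. The quiver flag variety is the projective $K$-variety $$\mathrm{Fl}\binom{M}{\underline{\mathbf d}}=\{U=(0=U^0\subset U^1\subset\cdots\subset U^r=M)\mid U^k\text{ an }A\text{-submodule},\ \underline{\dim}\,U^k=\underline d^k\}.$$ $\mathrm{Gr}\binom{M}{\underline e}$ is the variety of $A$-submodules of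 $M$ of dimension vector $\underline e$. Every submodule in $\mathrm{Gr}\binom{M}{\underline d^1}$ is a line contained in $\operatorname{soc}(M)$, since $\underline d^1$ is a unit vector. Relative position: if $W=(W_i^\bullet)_{i\in Q_0}$ is the fixed complete graded flag in $\operatorname{soc}(M)$, with $0=W_i^0\subset W_i^1\subset\cdots\subset W_i^{s_i}=\operatorname{soc}(M)_i$ and $\dim W_i^\ell=\ell$, then a line $L\in\mathrm{Gr}\binom{M}{\underline d^1}$ has relative position $w$ if $w_i=(\dim (L_i\cap W_i^\ell))_{0\le \ell\le s_i}$ for all $i\in Q_0$. "Refining $\operatorname{soc}(M)\cap\operatorname{rad}^\bullet(M)$" means that for every $i$ and $m\geq 0$ the vertex-$i$ component of $\operatorname{soc}(M)\cap\operatorname{rad}^m(M)$ is one of the $W_i^\ell$. *)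

theory Defs
  imports "HOL-Analysis.Abstract_Topology" "HOL-Algebra.AbelCoset" "Jordan_Normal_Form.VS_Connect"
begin

section \<open>Vector spaces\<close>

text \<open>The field \<open>K\<close> is the type \<open>'k\<close>, viewed as the record \<open>class_ring\<close> whose carrier is the whole
  type.  Vector spaces are carrier-based, so that subspaces and quotients are again vector spaces.\<close>

definition vdim :: "('k::field, 'v) module \<Rightarrow> 'v set \<Rightarrow> nat" where
  "vdim V S = vectorspace.dim class_ring (V\<lparr>carrier := S\<rparr>)"

text \<open>The elements of \<open>V/S\<close> are the cosets of \<open>S\<close>.  The fields \<open>mult\<close> and \<open>one\<close> are never used; they
  are only there because the record \<open>module\<close> extends \<open>ring\<close>.\<close>

definition quot_space :: "('k::field, 'v) module \<Rightarrow> 'v set \<Rightarrow> ('k, 'v set) module" where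
  "quot_space V S =
     \<lparr>carrier = a_rcosets\<^bsub>V\<^esub> S, mult = undefined, one = undefined,
      zero = S, add = set_add V,
      smult = (\<lambda>c X. \<Union>x\<in>X. S +>\<^bsub>V\<^esub> (c \<odot>\<^bsub>V\<^esub> x))\<rparr>"

definition linear_form :: "('k::field, 'v) module \<Rightarrow> ('v \<Rightarrow> 'k) \<Rightarrow> bool" where
  "linear_form V l \<longleftrightarrow>
     (\<forall>x\<in>carrier V. \<forall>y\<in>carrier V. l (x \<oplus>\<^bsub>V\<^esub> y) = l x + l y) \<and>
     (\<forall>c. \<forall>x\<in>carrier V. l (c \<odot>\<^bsub>V\<^esub> x) = c * l x)"


section \<open>Modules over the path algebra of the oriented cycle\<close>

text \<open>The vertices are the residues \<open>0, \<dots>, n - 1\<close> and \<open>a\<^sub>i\<close> runs from \<open>i\<close> to \<open>Suc i mod n\<close>.  Values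
  of the record fields at indices \<open>\<ge> n\<close> are irrelevant.\<close>

record ('k, 'v) cyc_rep =
  vsp :: "nat \<Rightarrow> ('k, 'v) module"
  arr :: "nat \<Rightarrow> 'v \<Rightarrow> 'v"

definition is_rep :: "nat \<Rightarrow> ('k::field, 'v) cyc_rep \<Rightarrow> bool" where
  "is_rep n M \<longleftrightarrow>
     (\<forall>i<n. vectorspace class_ring (vsp M i)) \<and>
     (\<forall>i<n. linear_map class_ring (vsp M i) (vsp M (Suc i mod n)) (arr M i))"

text \<open>\<open>path_map n M i m\<close> is the composition of the \<open>m\<close> consecutive arrows starting at vertex \<open>i\<close>.\<close>

primrec path_map :: "nat \<Rightarrow> ('k, 'v) cyc_rep \<Rightarrow> nat \<Rightarrow> nat \<Rightarrow> 'v \<Rightarrow> 'v" where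
  "path_map n M i 0 = id"
| "path_map n M i (Suc m) = arr M ((i + m) mod n) \<circ> path_map n M i m"

definition nilpotent_rep :: "nat \<Rightarrow> ('k::field, 'v) cyc_rep \<Rightarrow> bool" where
  "nilpotent_rep n M \<longleftrightarrow> is_rep n M \<and>
     (\<forall>i<n. vectorspace.fin_dim class_ring (vsp M i)) \<and>
     (\<forall>i<n. \<exists>m. \<forall>x\<in>carrier (vsp M i). (path_map n M i n ^^ m) x = \<zero>\<^bsub>vsp M i\<^esub>)"

text \<open>A submodule is the family of its components, made unique by extensionality.\<close>

definition submodules :: "nat \<Rightarrow> ('k::field, 'v) cyc_rep \<Rightarrow> (nat \<Rightarrow> 'v set) set" where
  "submodules n M = {U \<in> extensional {..<n}.
     (\<forall>i<n. VectorSpace.subspace class_ring (U i) (vsp M i)) \<and>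
     (\<forall>i<n. arr M i ` U i \<subseteq> U (Suc i mod n))}"

definition zero_sub :: "nat \<Rightarrow> ('k, 'v) cyc_rep \<Rightarrow> nat \<Rightarrow> 'v set" where
  "zero_sub n M = (\<lambda>i\<in>{..<n}. {\<zero>\<^bsub>vsp M i\<^esub>})"

definition whole_sub :: "nat \<Rightarrow> ('k, 'v) cyc_rep \<Rightarrow> nat \<Rightarrow> 'v set" where
  "whole_sub n M = (\<lambda>i\<in>{..<n}. carrier (vsp M i))"

definition sub_le :: "nat \<Rightarrow> (nat \<Rightarrow> 'v set) \<Rightarrow> (nat \<Rightarrow> 'v set) \<Rightarrow> bool" where
  "sub_le n U U' \<longleftrightarrow> (\<forall>i<n. U i \<subseteq> U' i)"

definition sub_rep :: "('k, 'v) cyc_rep \<Rightarrow> (nat \<Rightarrow> 'v set) \<Rightarrow> ('k, 'v) cyc_rep" where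
  "sub_rep M U = \<lparr>vsp = (\<lambda>i. (vsp M i)\<lparr>carrier := U i\<rparr>), arr = arr M\<rparr>"

definition quot_rep ::
  "nat \<Rightarrow> ('k::field, 'v) cyc_rep \<Rightarrow> (nat \<Rightarrow> 'v set) \<Rightarrow> ('k, 'v set) cyc_rep" where
  "quot_rep n M U =
     \<lparr>vsp = (\<lambda>i. quot_space (vsp M i) (U i)),
      arr = (\<lambda>i X. \<Union>x\<in>X. U (Suc i mod n) +>\<^bsub>vsp M (Suc i mod n)\<^esub> arr M i x)\<rparr>"

text \<open>\<open>rep_iso n M N\<close> states the equality \<open>[M] = [N]\<close> of isomorphism classes; the elements of the two
  modules may have different types.\<close>

definition rep_iso :: "nat \<Rightarrow> ('k::field, 'v) cyc_rep \<Rightarrow> ('k, 'w) cyc_rep \<Rightarrow> bool" where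
  "rep_iso n M N \<longleftrightarrow> (\<exists>h :: nat \<Rightarrow> 'v \<Rightarrow> 'w.
     (\<forall>i<n. linear_map class_ring (vsp M i) (vsp N i) (h i) \<and>
            bij_betw (h i) (carrier (vsp M i)) (carrier (vsp N i))) \<and>
     (\<forall>i<n. \<forall>x\<in>carrier (vsp M i). h (Suc i mod n) (arr M i x) = arr N i (h i x)))"

definition simple_submodules :: "nat \<Rightarrow> ('k::field, 'v) cyc_rep \<Rightarrow> (nat \<Rightarrow> 'v set) set" where
  "simple_submodules n M = {S \<in> submodules n M. S \<noteq> zero_sub n M \<and>
     (\<forall>T\<in>submodules n M. sub_le n T S \<longrightarrow> T = zero_sub n M \<or> T = S)}"

definition maximal_submodules :: "nat \<Rightarrow> ('k::field, 'v) cyc_rep \<Rightarrow> (nat \<Rightarrow> 'v set) set" where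
  "maximal_submodules n M = {S \<in> submodules n M. S \<noteq> whole_sub n M \<and>
     (\<forall>T\<in>submodules n M. sub_le n S T \<longrightarrow> T = S \<or> T = whole_sub n M)}"

definition soc :: "nat \<Rightarrow> ('k::field, 'v) cyc_rep \<Rightarrow> nat \<Rightarrow> 'v set" where
  "soc n M = (\<lambda>i\<in>{..<n}.
     LinearCombinations.module.span class_ring (vsp M i) (\<Union>S\<in>simple_submodules n M. S i))"

definition rad :: "nat \<Rightarrow> ('k::field, 'v) cyc_rep \<Rightarrow> nat \<Rightarrow> 'v set" where
  "rad n M = (\<lambda>i\<in>{..<n}. carrier (vsp M i) \<inter> (\<Inter>S\<in>maximal_submodules n M. S i))"

text \<open>\<open>rad\<^sup>m(M)\<close> is the iterated radical.  It is not \<open>rad(A)\<^sup>m M\<close>: the Jacobson radical of \<open>A = KQ\<close>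
  is zero.\<close>

primrec radpow :: "nat \<Rightarrow> ('k::field, 'v) cyc_rep \<Rightarrow> nat \<Rightarrow> nat \<Rightarrow> 'v set" where
  "radpow n M 0 = whole_sub n M"
| "radpow n M (Suc m) = rad n (sub_rep M (radpow n M m))"


section \<open>Quasi-projective varieties\<close>

text \<open>A set of points with multihomogeneous coordinates: the block \<open>j\<close> of \<open>hcoord X x\<close> is a system of
  homogeneous coordinates, well defined up to a nonzero scalar depending on \<open>j\<close>, of the \<open>j\<close>-th
  component of \<open>x\<close> in a product of projective spaces.  The Zariski topology, the regular functions
  and the morphisms below do not depend on the choice of these scalars, and are the induced ones
  for every subset; on locally closed subsets they give the usual notion of morphism of
  (quasi-projective) varieties.\<close>

record ('a, 'j, 'c, 'k) variety =
  pts :: "'a set"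
  hcoord :: "'a \<Rightarrow> 'j \<Rightarrow> 'c \<Rightarrow> 'k"

inductive mhpoly :: "('j \<Rightarrow> nat) \<Rightarrow> (('j \<Rightarrow> 'c \<Rightarrow> 'k::field) \<Rightarrow> 'k) \<Rightarrow> bool" where
  const: "mhpoly (\<lambda>_. 0) (\<lambda>z. a)"
| coord: "mhpoly ((\<lambda>_. 0)(j := 1)) (\<lambda>z. z j c)"
| add: "mhpoly D P \<Longrightarrow> mhpoly D Q \<Longrightarrow> mhpoly D (\<lambda>z. P z + Q z)"
| mult: "mhpoly D P \<Longrightarrow> mhpoly E Q \<Longrightarrow> mhpoly (\<lambda>j. D j + E j) (\<lambda>z. P z * Q z)"

definition zopen :: "('a, 'j, 'c, 'k::field) variety \<Rightarrow> 'a set \<Rightarrow> bool" where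
  "zopen X S \<longleftrightarrow> (\<exists>F. (\<forall>P\<in>F. \<exists>D. mhpoly D P) \<and>
     S = {x \<in> pts X. \<exists>P\<in>F. P (hcoord X x) \<noteq> 0})"

definition zariski :: "('a, 'j, 'c, 'k::field) variety \<Rightarrow> 'a topology" where
  "zariski X = topology (zopen X)"

lemma istopology_zopen: "istopology (zopen X)"
  unfolding istopology_def
proof (intro conjI allI impI)
  fix S T assume "zopen X S" "zopen X T"
  then obtain F G where F: "\<forall>P\<in>F. \<exists>D. mhpoly D P" "S = {x \<in> pts X. \<exists>P\<in>F. P (hcoord X x) \<noteq> 0}"
    and G: "\<forall>P\<in>G. \<exists>D. mhpoly D P" "T = {x \<in> pts X. \<exists>P\<in>G. P (hcoord X x) \<noteq> 0}"
    unfolding zopen_def by blast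
  let ?H = "{\<lambda>z. P z * Q z | P Q. P \<in> F \<and> Q \<in> G}"
  have "\<forall>R\<in>?H. \<exists>D. mhpoly D R"
  proof
    fix R assume "R \<in> ?H"
    then obtain P Q where R: "R = (\<lambda>z. P z * Q z)" "P \<in> F" "Q \<in> G" by auto
    with F(1) G(1) obtain D E where "mhpoly D P" "mhpoly E Q" by blast
    then have "mhpoly (\<lambda>j. D j + E j) R" unfolding R(1) by (rule mhpoly.mult)
    then show "\<exists>D. mhpoly D R" by (rule exI[where P = "\<lambda>D. mhpoly D R"])
  qed
  moreover have "S \<inter> T = {x \<in> pts X. \<exists>R\<in>?H. R (hcoord X x) \<noteq> 0}"
  proof (intro equalityI subsetI)
    fix x assume "x \<in> S \<inter> T"
    then obtain P Q where PQ: "x \<in> pts X" "P \<in> F" "Q \<in> G" "P (hcoord X x) \<noteq> 0" "Q (hcoord X x) \<noteq> 0"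
      unfolding F(2) G(2) by auto
    define R where "R = (\<lambda>z. P z * Q z)"
    have "R (hcoord X x) \<noteq> 0" using PQ(4,5) by (simp add: R_def)
    moreover have "R \<in> ?H" using PQ(2,3) R_def by blast
    ultimately have "\<exists>R\<in>?H. R (hcoord X x) \<noteq> 0" by (rule bexI)
    with PQ(1) show "x \<in> {x \<in> pts X. \<exists>R\<in>?H. R (hcoord X x) \<noteq> 0}" by blast
  next
    fix x assume "x \<in> {x \<in> pts X. \<exists>R\<in>?H. R (hcoord X x) \<noteq> 0}"
    then obtain P Q where "x \<in> pts X" "P \<in> F" "Q \<in> G" "P (hcoord X x) * Q (hcoord X x) \<noteq> 0"
      by auto
    then show "x \<in> S \<inter> T" unfolding F(2) G(2) by auto
  qed
  ultimately show "zopen X (S \<inter> T)"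
    unfolding zopen_def by blast
next
  fix \<S> assume "\<forall>S\<in>\<S>. zopen X S"
  let ?F = "{P. (\<exists>D. mhpoly D P) \<and> (\<forall>x\<in>pts X. P (hcoord X x) \<noteq> 0 \<longrightarrow> x \<in> \<Union>\<S>)}"
  have "\<Union>\<S> = {x \<in> pts X. \<exists>P\<in>?F. P (hcoord X x) \<noteq> 0}"
  proof (intro equalityI subsetI)
    fix x assume "x \<in> \<Union>\<S>"
    then obtain S where S: "S \<in> \<S>" "x \<in> S" by auto
    with \<open>\<forall>S\<in>\<S>. zopen X S\<close> obtain F where F: "\<forall>P\<in>F. \<exists>D. mhpoly D P"
      "S = {x \<in> pts X. \<exists>P\<in>F. P (hcoord X x) \<noteq> 0}"
      unfolding zopen_def by blast
    from S(2) F(2) obtain P where P: "x \<in> pts X" "P \<in> F" "P (hcoord X x) \<noteq> 0" by auto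
    have "y \<in> \<Union>\<S>" if "y \<in> pts X" "P (hcoord X y) \<noteq> 0" for y
    proof -
      from that P(2) have "y \<in> S" unfolding F(2) by blast
      with S(1) show ?thesis by blast
    qed
    then have "P \<in> ?F" using F(1) P(2) by simp
    from P(3) this have "\<exists>P\<in>?F. P (hcoord X x) \<noteq> 0" by (rule bexI)
    with P(1) show "x \<in> {x \<in> pts X. \<exists>P\<in>?F. P (hcoord X x) \<noteq> 0}" by blast
  next
    fix x assume "x \<in> {x \<in> pts X. \<exists>P\<in>?F. P (hcoord X x) \<noteq> 0}"
    then show "x \<in> \<Union>\<S>" by blast
  qed
  moreover have "\<forall>P\<in>?F. \<exists>D. mhpoly D P"
    by simp
  ultimately show "zopen X (\<Union>\<S>)"
    unfolding zopen_def by blast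
qed

lemma openin_zariski: "openin (zariski X) = zopen X"
  unfolding zariski_def by (rule topology_inverse'[OF istopology_zopen])

definition regular :: "('a, 'j, 'c, 'k::field) variety \<Rightarrow> 'a set \<Rightarrow> ('a \<Rightarrow> 'k) \<Rightarrow> bool" where
  "regular X S \<phi> \<longleftrightarrow> (\<forall>x\<in>S. \<exists>T D P Q. openin (zariski X) T \<and> x \<in> T \<and> T \<subseteq> S \<and>
     mhpoly D P \<and> mhpoly D Q \<and>
     (\<forall>y\<in>T. Q (hcoord X y) \<noteq> 0 \<and> \<phi> y = P (hcoord X y) / Q (hcoord X y)))"

definition morphism :: "('a, 'j, 'c, 'k::field) variety \<Rightarrow> ('b, 'l, 'd, 'k) variety \<Rightarrow>
    ('a \<Rightarrow> 'b) \<Rightarrow> bool" where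
  "morphism X Y f \<longleftrightarrow> continuous_map (zariski X) (zariski Y) f \<and>
     (\<forall>S \<phi>. openin (zariski Y) S \<and> regular Y S \<phi> \<longrightarrow>
        regular X {x \<in> pts X. f x \<in> S} (\<phi> \<circ> f))"

definition variety_iso :: "('a, 'j, 'c, 'k::field) variety \<Rightarrow> ('b, 'l, 'd, 'k) variety \<Rightarrow>
    ('a \<Rightarrow> 'b) \<Rightarrow> bool" where
  "variety_iso X Y f \<longleftrightarrow> morphism X Y f \<and>
     (\<exists>g. morphism Y X g \<and> (\<forall>x\<in>pts X. g (f x) = x) \<and> (\<forall>y\<in>pts Y. f (g y) = y))"

text \<open>In the product the coordinate blocks of both factors are juxtaposed; the coordinates with
  mismatched indices are set to zero.\<close>

definition prod_variety :: "('a, 'j, 'c, 'k::field) variety \<Rightarrow> ('b, 'l, 'd, 'k) variety \<Rightarrow>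
    ('a \<times> 'b, 'j + 'l, 'c + 'd, 'k) variety" where
  "prod_variety X Y = \<lparr>pts = pts X \<times> pts Y,
     hcoord = (\<lambda>(x, y). case_sum
        (\<lambda>j. case_sum (hcoord X x j) (\<lambda>_. 0))
        (\<lambda>l. case_sum (\<lambda>_. 0) (hcoord Y y l)))\<rparr>"

definition restrict_variety :: "('a, 'j, 'c, 'k) variety \<Rightarrow> 'a set \<Rightarrow> ('a, 'j, 'c, 'k) variety" where
  "restrict_variety X S = X\<lparr>pts := pts X \<inter> S\<rparr>"


section \<open>Quiver Grassmannians and quiver flag varieties\<close>

text \<open>Pluecker coordinates without a choice of basis of \<open>V\<close>: for linear forms \<open>l\<^sub>1, \<dots>, l\<^sub>e\<close> on \<open>V\<close> and a
  basis \<open>u\<^sub>1, \<dots>, u\<^sub>e\<close> of \<open>U\<close>, the coordinate with index \<open>[l\<^sub>1, \<dots>, l\<^sub>e]\<close> is \<open>det (l\<^sub>a(u\<^sub>b))\<close>.  The usual Pluecker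
  coordinates are those with \<open>l\<^sub>1, \<dots>, l\<^sub>e\<close> in a fixed basis of the dual of \<open>V\<close>; the others are fixed
  linear combinations of them.  A different basis of \<open>U\<close> rescales all coordinates simultaneously.\<close>

definition plucker :: "('k::field, 'v) module \<Rightarrow> 'v set \<Rightarrow> ('v \<Rightarrow> 'k) list \<Rightarrow> 'k" where
  "plucker V U ls =
     (let us = (SOME us. distinct us \<and> vectorspace.basis class_ring (V\<lparr>carrier := U\<rparr>) (set us)) in
      if length ls = length us \<and> (\<forall>l\<in>set ls. linear_form V l)
      then det (mat (length us) (length us) (\<lambda>(a, b). (ls ! a) (us ! b)))
      else 0)"

text \<open>Dimension vectors have integer entries, so that differences of dimension vectors are not
  truncated; a vector with a negative entry is the dimension vector of no submodule.\<close>

definition Gr :: "nat \<Rightarrow> ('k::field, 'v) cyc_rep \<Rightarrow> (nat \<Rightarrow> int) \<Rightarrow>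
    (nat \<Rightarrow> 'v set, nat, ('v \<Rightarrow> 'k) list, 'k) variety" where
  "Gr n M e = \<lparr>pts = {U \<in> submodules n M. \<forall>i<n. int (vdim (vsp M i) (U i)) = e i},
     hcoord = (\<lambda>U i. if i < n then plucker (vsp M i) (U i) else (\<lambda>_. 0))\<rparr>"

text \<open>\<open>U k i\<close> is the component at vertex \<open>i\<close> of the \<open>k\<close>-th submodule of the flag.\<close>

definition Fl :: "nat \<Rightarrow> ('k::field, 'v) cyc_rep \<Rightarrow> nat \<Rightarrow> (nat \<Rightarrow> nat \<Rightarrow> int) \<Rightarrow>
    (nat \<Rightarrow> nat \<Rightarrow> 'v set, nat \<times> nat, ('v \<Rightarrow> 'k) list, 'k) variety" where
  "Fl n M r dd = \<lparr>pts = {U \<in> extensional {..r}.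
       (\<forall>k\<le>r. U k \<in> pts (Gr n M (dd k))) \<and>
       U 0 = zero_sub n M \<and> U r = whole_sub n M \<and>
       (\<forall>k<r. sub_le n (U k) (U (Suc k)))},
     hcoord = (\<lambda>U (k, i). if k \<le> r \<and> i < n then plucker (vsp M i) (U k i) else (\<lambda>_. 0))\<rparr>"

definition complete_dim_filtration :: "nat \<Rightarrow> nat \<Rightarrow> (nat \<Rightarrow> nat \<Rightarrow> int) \<Rightarrow> bool" where
  "complete_dim_filtration n r dd \<longleftrightarrow>
     (\<forall>k\<le>r. \<forall>i<n. 0 \<le> dd k i) \<and> (\<forall>i<n. dd 0 i = 0) \<and>
     (\<forall>t<r. (\<Sum>i<n. dd (Suc t) i) - (\<Sum>i<n. dd t i) = 1)"

text \<open>\<open>W i l\<close> is \<open>W\<^sub>i\<^sup>l\<close>, for \<open>l\<close> between \<open>0\<close> and \<open>s\<^sub>i = vdim (vsp M i) (soc n M i)\<close>.\<close>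

definition complete_soc_flag ::
  "nat \<Rightarrow> ('k::field, 'v) cyc_rep \<Rightarrow> (nat \<Rightarrow> nat \<Rightarrow> 'v set) \<Rightarrow> bool" where
  "complete_soc_flag n M W \<longleftrightarrow> (\<forall>i<n. let s = vdim (vsp M i) (soc n M i) in
     W i 0 = {\<zero>\<^bsub>vsp M i\<^esub>} \<and> W i s = soc n M i \<and>
     (\<forall>l\<le>s. VectorSpace.subspace class_ring (W i l) (vsp M i) \<and> vdim (vsp M i) (W i l) = l) \<and>
     (\<forall>l<s. W i l \<subseteq> W i (Suc l)))"

definition refines_soc_rad ::
  "nat \<Rightarrow> ('k::field, 'v) cyc_rep \<Rightarrow> (nat \<Rightarrow> nat \<Rightarrow> 'v set) \<Rightarrow> bool" where
  "refines_soc_rad n M W \<longleftrightarrow>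
     (\<forall>i<n. \<forall>m. \<exists>l\<le>vdim (vsp M i) (soc n M i). soc n M i \<inter> radpow n M m i = W i l)"

text \<open>The \<open>i\<close>-th row vector of a relative position is \<open>w i 0, \<dots>, w i s\<^sub>i\<close>; further values of \<open>w i\<close> are
  irrelevant.\<close>

definition has_rel_pos :: "nat \<Rightarrow> ('k::field, 'v) cyc_rep \<Rightarrow> (nat \<Rightarrow> nat \<Rightarrow> 'v set) \<Rightarrow>
    (nat \<Rightarrow> nat \<Rightarrow> nat) \<Rightarrow> (nat \<Rightarrow> 'v set) \<Rightarrow> bool" where
  "has_rel_pos n M W w L \<longleftrightarrow>
     (\<forall>i<n. \<forall>l\<le>vdim (vsp M i) (soc n M i). vdim (vsp M i) (L i \<inter> W i l) = w i l)"

definition Gr_stratum :: "nat \<Rightarrow> ('k::field, 'v) cyc_rep \<Rightarrow> (nat \<Rightarrow> int) \<Rightarrow>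
    (nat \<Rightarrow> nat \<Rightarrow> 'v set) \<Rightarrow> (nat \<Rightarrow> nat \<Rightarrow> nat) \<Rightarrow>
    (nat \<Rightarrow> 'v set, nat, ('v \<Rightarrow> 'k) list, 'k) variety" where
  "Gr_stratum n M e W w = restrict_variety (Gr n M e) {L. has_rel_pos n M W w L}"

end

theory Submission
  imports Defs
begin

text \<open>
  The vector \<open>d\<^sup>1\<close> is a unit vector, so \<open>U\<^sub>0\<close> is a line in the socle, spanned by some \<open>u\<close> at a vertex \<open>i0\<close>.  Let \<open>u\<close> lie in the
  radical layer \<open>m\<close>, that is, let \<open>m\<close> be the largest length of a path with \<open>u\<close> in its image.  A line of the stratum is
  spanned by a vector \<open>u + v\<close> with \<open>v\<close> in the largest member of the flag that does not contain \<open>u\<close>.  Since the flag refines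
  the radical layers of the socle, each such \<open>v\<close> is again the end of a path of length \<open>m\<close>, and \<open>u\<close> does not lie in the sum of
  that member of the flag and the next radical layer.  So there is a form that is 1 at \<open>u\<close> and vanishes on both, and this
  form and the lifts of \<open>v\<close> along the path define an endomorphism \<open>\<psi>\<^sub>v\<close> of \<open>M\<close> with \<open>\<psi>\<^sub>v u = v\<close> that factors through a
  uniserial module.  After an elimination in the choice of the lifts, all products \<open>\<psi>\<^sub>v \<psi>\<^sub>v\<^sub>'\<close> vanish
  (\<open>stratum_endomorphisms\<close>).  Hence \<open>\<theta>\<^sub>v = id + \<psi>\<^sub>v\<close> is an automorphism of \<open>M\<close> with inverse \<open>id - \<psi>\<^sub>v\<close>; it carries \<open>U\<^sub>0\<close> to the
  line \<open>L\<close> of \<open>u + v\<close>, and both \<open>\<theta>\<^sub>v\<close> and its inverse are affine linear in \<open>v\<close>.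

  Composing the inverse of \<open>\<theta>\<^sub>v\<close> with the projection to \<open>N = M / U\<^sub>0\<close> yields a surjection \<open>h\<^sub>L\<close> from \<open>M\<close> to \<open>N\<close> with kernel \<open>L\<close>.  The
  isomorphism sends a flag \<open>U\<close> to \<open>L = U\<^sup>1\<close> and the flag of the images \<open>h\<^sub>L(U\<^sup>k\<^sup>+\<^sup>1)\<close>; its inverse takes preimages under \<open>h\<^sub>L\<close>.  The
  isomorphisms between quotients are instances of the third isomorphism theorem (\<open>rep_iso_quotients\<close>).

  For the regularity of both maps it suffices to write each block of coordinates as polynomials of a common
  multidegree, up to a common factor (\<open>morphismI\<close>).  Pluecker coordinates indexed by lists of linear forms behave
  well here: the coordinates of the image of a subspace are those of the subspace at the forms pulled back along the map
  (\<open>plucker_image\<close>, \<open>plucker_preimage_line\<close>).  The forms pulled back along \<open>\<theta>\<^sub>v\<close> are combinations of fixed forms, with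
  coefficients that are affine linear in \<open>v\<close>, hence quotients of two coordinates of \<open>L\<close>; expanding the determinant by
  multilinearity and clearing denominators gives the polynomials (\<open>multilinear_expansion\<close>).
\<close>


section \<open>Finite-dimensional vector spaces through their linear forms\<close>

lemma subspace_iff:
  fixes V :: "('k::field, 'v) module"
  assumes "vectorspace class_ring V"
  shows "VectorSpace.subspace class_ring U V \<longleftrightarrow> U \<subseteq> carrier V \<and> \<zero>\<^bsub>V\<^esub> \<in> U \<and>
    (\<forall>x\<in>U. \<forall>y\<in>U. x \<oplus>\<^bsub>V\<^esub> y \<in> U) \<and> (\<forall>c. \<forall>x\<in>U. c \<odot>\<^bsub>V\<^esub> x \<in> U)"
  using assms unfolding VectorSpace.subspace_def submodule_def
  by (auto simp: vectorspace_def)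

lemma subspace_D:
  fixes V :: "('k::field, 'v) module"
  assumes "VectorSpace.subspace class_ring U V"
  shows "vectorspace class_ring V" "U \<subseteq> carrier V" "\<zero>\<^bsub>V\<^esub> \<in> U"
    "x \<in> U \<Longrightarrow> y \<in> U \<Longrightarrow> x \<oplus>\<^bsub>V\<^esub> y \<in> U" "x \<in> U \<Longrightarrow> c \<odot>\<^bsub>V\<^esub> x \<in> U"
proof -
  show V: "vectorspace class_ring V" using assms by (simp add: VectorSpace.subspace_def)
  show "U \<subseteq> carrier V" "\<zero>\<^bsub>V\<^esub> \<in> U"
    "x \<in> U \<Longrightarrow> y \<in> U \<Longrightarrow> x \<oplus>\<^bsub>V\<^esub> y \<in> U" "x \<in> U \<Longrightarrow> c \<odot>\<^bsub>V\<^esub> x \<in> U"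
    using assms unfolding subspace_iff[OF V] by blast+
qed

lemma vs_closed:
  fixes V :: "('k::field, 'v) module"
  assumes "vectorspace class_ring V"
  shows "\<zero>\<^bsub>V\<^esub> \<in> carrier V"
    "x \<in> carrier V \<Longrightarrow> y \<in> carrier V \<Longrightarrow> x \<oplus>\<^bsub>V\<^esub> y \<in> carrier V"
    "x \<in> carrier V \<Longrightarrow> c \<odot>\<^bsub>V\<^esub> x \<in> carrier V"
    "x \<in> carrier V \<Longrightarrow> y \<in> carrier V \<Longrightarrow> x \<ominus>\<^bsub>V\<^esub> y \<in> carrier V"
proof -
  interpret vectorspace class_ring V by fact
  show "\<zero>\<^bsub>V\<^esub> \<in> carrier V"
    "x \<in> carrier V \<Longrightarrow> y \<in> carrier V \<Longrightarrow> x \<oplus>\<^bsub>V\<^esub> y \<in> carrier V"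
    "x \<in> carrier V \<Longrightarrow> c \<odot>\<^bsub>V\<^esub> x \<in> carrier V"
    "x \<in> carrier V \<Longrightarrow> y \<in> carrier V \<Longrightarrow> x \<ominus>\<^bsub>V\<^esub> y \<in> carrier V" by simp_all
qed

lemma vs_minus:
  fixes V :: "('k::field, 'v) module"
  assumes "vectorspace class_ring V" "x \<in> carrier V" "y \<in> carrier V"
  shows "x \<ominus>\<^bsub>V\<^esub> y = x \<oplus>\<^bsub>V\<^esub> (- 1) \<odot>\<^bsub>V\<^esub> y"
proof -
  interpret vectorspace class_ring V by fact
  have "(\<ominus>\<^bsub>class_ring\<^esub> \<one>\<^bsub>class_ring\<^esub>) \<odot>\<^bsub>V\<^esub> y = \<ominus>\<^bsub>V\<^esub> y"
    using assms(3) smult_one[OF assms(3)] by (simp add: smult_l_minus)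
  then show ?thesis by (simp add: a_minus_def class_ring_simps)
qed

lemma carrier_subspace:
  fixes V :: "('k::field, 'v) module"
  assumes "vectorspace class_ring V"
  shows "VectorSpace.subspace class_ring (carrier V) V"
  unfolding subspace_iff[OF assms] using vs_closed[OF assms] by auto

lemma zero_subspace:
  fixes V :: "('k::field, 'v) module"
  assumes "vectorspace class_ring V"
  shows "VectorSpace.subspace class_ring {\<zero>\<^bsub>V\<^esub>} V"
proof -
  interpret vectorspace class_ring V by fact
  show ?thesis unfolding subspace_iff[OF assms] using smult_r_null by auto
qed

lemma subspace_minus:
  fixes V :: "('k::field, 'v) module"
  assumes "VectorSpace.subspace class_ring U V" "x \<in> U" "y \<in> U"
  shows "x \<ominus>\<^bsub>V\<^esub> y \<in> U"
  using assms(2,3) subspace_D[OF assms(1)] vs_minus[of V x y] by (metis subsetD)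

lemma subspace_finsum:
  fixes V :: "('k::field, 'v) module"
  assumes U: "VectorSpace.subspace class_ring U V" and f: "\<And>a. a \<in> A \<Longrightarrow> f a \<in> U"
  shows "finsum V f A \<in> U"
proof -
  interpret vectorspace class_ring V using subspace_D(1)[OF U] .
  show ?thesis using f
  proof (induction A rule: infinite_finite_induct)
    case (insert x F)
    then have "finsum V f (insert x F) = f x \<oplus>\<^bsub>V\<^esub> finsum V f F"
      using subspace_D(2)[OF U] by (intro finsum_insert) auto
    then show ?case using insert subspace_D(4)[OF U] by auto
  qed (use subspace_D(3)[OF U] in auto)
qed

lemma linear_form_add: "linear_form V l \<Longrightarrow> x \<in> carrier V \<Longrightarrow> y \<in> carrier V \<Longrightarrow> l (x \<oplus>\<^bsub>V\<^esub> y) = l x + l y"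
  and linear_form_smult: "linear_form V l \<Longrightarrow> x \<in> carrier V \<Longrightarrow> l (c \<odot>\<^bsub>V\<^esub> x) = c * l x"
  unfolding linear_form_def by auto

lemma linear_form_zero:
  fixes V :: "('k::field, 'v) module"
  assumes "vectorspace class_ring V" "linear_form V l"
  shows "l \<zero>\<^bsub>V\<^esub> = 0"
proof -
  interpret vectorspace class_ring V by fact
  have "l (\<zero>\<^bsub>V\<^esub> \<oplus>\<^bsub>V\<^esub> \<zero>\<^bsub>V\<^esub>) = l \<zero>\<^bsub>V\<^esub> + l \<zero>\<^bsub>V\<^esub>" by (rule linear_form_add[OF assms(2)]) auto
  moreover have "\<zero>\<^bsub>V\<^esub> \<oplus>\<^bsub>V\<^esub> \<zero>\<^bsub>V\<^esub> = \<zero>\<^bsub>V\<^esub>" by simp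
  ultimately show ?thesis by (metis add_cancel_right_right)
qed

lemma linear_form_minus:
  fixes V :: "('k::field, 'v) module"
  assumes "vectorspace class_ring V" "linear_form V l" "x \<in> carrier V" "y \<in> carrier V"
  shows "l (x \<ominus>\<^bsub>V\<^esub> y) = l x - l y"
  using assms vs_closed[OF assms(1)] by (simp add: vs_minus linear_form_add linear_form_smult)

lemma linear_form_finsum:
  fixes V :: "('k::field, 'v) module"
  assumes V: "vectorspace class_ring V" and l: "linear_form V l" and f: "\<And>a. a \<in> A \<Longrightarrow> f a \<in> carrier V"
  shows "l (finsum V f A) = (\<Sum>a\<in>A. l (f a))"
proof -
  interpret vectorspace class_ring V by fact
  show ?thesis using f
  proof (induction A rule: infinite_finite_induct)
    case (insert x F)
    then have "finsum V f (insert x F) = f x \<oplus>\<^bsub>V\<^esub> finsum V f F"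
      by (intro finsum_insert) auto
    moreover have "finsum V f F \<in> carrier V" using insert by (intro finsum_closed) auto
    ultimately show ?case using insert by (simp add: linear_form_add[OF l])
  qed (auto simp: linear_form_zero[OF V l])
qed

lemma linear_form_comb:
  assumes "linear_form V l" "linear_form V m"
  shows "linear_form V (\<lambda>x. a * l x + b * m x)"
  using assms unfolding linear_form_def by (simp add: algebra_simps)

lemma linear_form_scale: "linear_form V l \<Longrightarrow> linear_form V (\<lambda>x. a * l x)"
  unfolding linear_form_def by (simp add: algebra_simps)

lemma linear_form_diff:
  assumes "linear_form V l" "linear_form V m"
  shows "linear_form V (\<lambda>x. l x - m x)"
  using linear_form_comb[OF assms, of 1 "-1"] by simp

lemma linear_form_sum:
  assumes "\<And>a. a \<in> A \<Longrightarrow> linear_form V (l a)"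
  shows "linear_form V (\<lambda>x. \<Sum>a\<in>A. l a x)"
  using assms
proof (induction A rule: infinite_finite_induct)
  case (insert x F)
  then show ?case using linear_form_comb[of V "l x" "\<lambda>y. \<Sum>a\<in>F. l a y" 1 1] by simp
qed (auto simp: linear_form_def)

text \<open>Everything below is phrased with linear forms rather than linear combinations, because forms take values
  in the type \<open>'k\<close>, where ordinary sums and determinants are at hand.  A basis is carried together with
  forms on the whole space that are dual to it.\<close>

definition dual_lists :: "('k::field, 'v) module \<Rightarrow> 'v list \<Rightarrow> ('v \<Rightarrow> 'k) list \<Rightarrow> bool" where
  "dual_lists V us ls \<longleftrightarrow> length ls = length us \<and> set us \<subseteq> carrier V \<and> (\<forall>l\<in>set ls. linear_form V l) \<and>
     (\<forall>a<length us. \<forall>b<length us. (ls ! a) (us ! b) = (if a = b then 1 else 0))"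

text \<open>The last clause is the expansion of \<open>x\<close> in the basis \<open>us\<close>, tested against all forms.\<close>

definition frame :: "('k::field, 'v) module \<Rightarrow> 'v set \<Rightarrow> 'v list \<Rightarrow> ('v \<Rightarrow> 'k) list \<Rightarrow> bool" where
  "frame V U us ls \<longleftrightarrow> dual_lists V us ls \<and> set us \<subseteq> U \<and>
     (\<forall>x\<in>U. \<forall>l. linear_form V l \<longrightarrow> l x = (\<Sum>a<length us. (ls ! a) x * l (us ! a)))"

text \<open>Finite dimension, with the separation of points by forms included: the two facts are inherited by
  quotients together.\<close>

definition fdspace :: "('k::field, 'v) module \<Rightarrow> bool" where
  "fdspace V \<longleftrightarrow> vectorspace class_ring V \<and> (\<exists>us ls. frame V (carrier V) us ls) \<and>
     (\<forall>x\<in>carrier V. (\<forall>l. linear_form V l \<longrightarrow> l x = 0) \<longrightarrow> x = \<zero>\<^bsub>V\<^esub>)"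

lemma fdspace_vs: "fdspace V \<Longrightarrow> vectorspace class_ring V"
  by (simp add: fdspace_def)

lemma form_eqI:
  assumes V: "fdspace V" and x: "x \<in> carrier V" and y: "y \<in> carrier V"
    and eq: "\<And>l. linear_form V l \<Longrightarrow> l x = l y"
  shows "x = y"
proof -
  note vs = fdspace_vs[OF V]
  interpret vectorspace class_ring V by fact
  have "\<forall>l. linear_form V l \<longrightarrow> l (x \<ominus>\<^bsub>V\<^esub> y) = 0"
    using eq x y by (simp add: linear_form_minus[OF vs])
  then have "x \<ominus>\<^bsub>V\<^esub> y = \<zero>\<^bsub>V\<^esub>" using V x y unfolding fdspace_def by simp
  then show ?thesis using x y by simp
qed

lemma comb_exists:
  assumes U: "VectorSpace.subspace class_ring U V" and us: "set us \<subseteq> U"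
  shows "\<exists>y\<in>U. \<forall>l. linear_form V l \<longrightarrow> l y = (\<Sum>a<length us. c a * l (us ! a))"
proof
  note vs = subspace_D(1)[OF U]
  have in_U: "us ! a \<in> U" if "a < length us" for a using us that nth_mem by blast
  let ?y = "finsum V (\<lambda>a. c a \<odot>\<^bsub>V\<^esub> us ! a) {..<length us}"
  show "?y \<in> U" using in_U subspace_D(5)[OF U] by (intro subspace_finsum[OF U]) auto
  show "\<forall>l. linear_form V l \<longrightarrow> l ?y = (\<Sum>a<length us. c a * l (us ! a))"
  proof (intro allI impI)
    fix l assume l: "linear_form V l"
    have "l ?y = (\<Sum>a<length us. l (c a \<odot>\<^bsub>V\<^esub> us ! a))"
      using in_U subspace_D(2)[OF U] by (intro linear_form_finsum[OF vs l]) (auto intro!: vs_closed[OF vs])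
    also have "\<dots> = (\<Sum>a<length us. c a * l (us ! a))"
      using in_U subspace_D(2)[OF U] by (intro sum.cong refl linear_form_smult[OF l]) auto
    finally show "l ?y = \<dots>" .
  qed
qed

lemma dual_lists_form: "dual_lists V us ls \<Longrightarrow> a < length us \<Longrightarrow> linear_form V (ls ! a)"
  unfolding dual_lists_def by (metis nth_mem)

lemma dual_lists_mem: "dual_lists V us ls \<Longrightarrow> a < length us \<Longrightarrow> us ! a \<in> carrier V"
  unfolding dual_lists_def by (metis nth_mem subsetD)

lemma dual_lists_eq: "dual_lists V us ls \<Longrightarrow> a < length us \<Longrightarrow> b < length us \<Longrightarrow>
    (ls ! a) (us ! b) = (if a = b then 1 else 0)"
  unfolding dual_lists_def by blast

text \<open>Subtracting the part that the list already accounts for turns a form into one that vanishes on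
  the list; this is the inductive step of every basis extension below.\<close>

lemma residual_form:
  assumes d: "dual_lists V us ls" and l: "linear_form V l"
  shows "linear_form V (\<lambda>x. l x - (\<Sum>a<length us. (ls ! a) x * l (us ! a)))"
    and "b < length us \<Longrightarrow> l (us ! b) - (\<Sum>a<length us. (ls ! a) (us ! b) * l (us ! a)) = 0"
proof -
  have "linear_form V (\<lambda>x. \<Sum>a<length us. l (us ! a) * (ls ! a) x)"
    using dual_lists_form[OF d] by (intro linear_form_sum linear_form_scale) auto
  then show "linear_form V (\<lambda>x. l x - (\<Sum>a<length us. (ls ! a) x * l (us ! a)))"
    using linear_form_diff[OF l] by (simp add: mult.commute)
  assume b: "b < length us"
  have "(\<Sum>a<length us. (ls ! a) (us ! b) * l (us ! a)) = (\<Sum>a<length us. if a = b then l (us ! a) else 0)"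
    using b by (intro sum.cong) (auto simp: dual_lists_eq[OF d])
  also have "\<dots> = l (us ! b)" using b by simp
  finally show "l (us ! b) - (\<Sum>a<length us. (ls ! a) (us ! b) * l (us ! a)) = 0" by simp
qed

lemma dual_lists_length:
  assumes f: "frame V U bs ks" and d: "dual_lists V us ls" and sub: "set us \<subseteq> U"
  shows "length us \<le> length bs"
proof (rule ccontr)
  assume "\<not> ?thesis"
  then have less: "length bs < length us" by simp
  \<comment> \<open>The Gram matrix of the longer list factors through a smaller dimension; padding both factors
    with zeros makes it a product of square matrices, one of which has a zero column.\<close>
  define N where "N = length us"
  define P where "P = mat N N (\<lambda>(a, d). if d < length bs then (ls ! a) (bs ! d) else 0)"
  define Q where "Q = mat N N (\<lambda>(d, b). if d < length bs then (ks ! d) (us ! b) else 0)"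
  have P: "P \<in> carrier_mat N N" and Q: "Q \<in> carrier_mat N N" by (auto simp: P_def Q_def)
  have "P * Q = 1\<^sub>m N"
  proof (rule eq_matI)
    fix a b assume "a < dim_row (1\<^sub>m N)" "b < dim_col (1\<^sub>m N)"
    then have ab: "a < N" "b < N" by auto
    have "(P * Q) $$ (a, b) = (\<Sum>d<N. P $$ (a, d) * Q $$ (d, b))"
      using P Q ab by (simp add: ab times_mat_def scalar_prod_def lessThan_atLeast0)
    also have "\<dots> = (\<Sum>d<N. if d < length bs then (ks ! d) (us ! b) * (ls ! a) (bs ! d) else 0)"
      using ab by (intro sum.cong) (auto simp: P_def Q_def)
    also have "\<dots> = (\<Sum>d<length bs. (ks ! d) (us ! b) * (ls ! a) (bs ! d))"
      using less by (intro sum.mono_neutral_cong_right) (auto simp: N_def)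
    also have "\<dots> = (ls ! a) (us ! b)"
    proof -
      have "us ! b \<in> U" using sub ab by (auto simp: N_def)
      then show ?thesis using f dual_lists_form[OF d] ab unfolding frame_def N_def by metis
    qed
    finally show "(P * Q) $$ (a, b) = 1\<^sub>m N $$ (a, b)"
      using ab dual_lists_eq[OF d] by (simp add: N_def)
  qed (auto simp: P_def Q_def)
  then have "det P * det Q = 1" using det_mult[OF P Q] by simp
  moreover have "det P = 0"
    unfolding laplace_expansion_column[OF P, of "length bs", unfolded N_def, OF less]
    using less by (intro sum.neutral) (auto simp: P_def N_def)
  ultimately show False by simp
qed

lemma frame_length:
  assumes "frame V U us ls" "frame V U bs ks"
  shows "length us = length bs"
  using dual_lists_length[OF assms(1), of bs ks] dual_lists_length[OF assms(2), of us ls] assms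
  by (auto simp: frame_def)

text \<open>As long as the expansion clause of a frame fails for some \<open>x\<close> in \<open>U\<close>, the difference between \<open>x\<close> and its
  would-be expansion is a new basis vector; the old forms vanish on it and a residual form does not.\<close>

lemma dual_lists_snoc:
  assumes U: "VectorSpace.subspace class_ring U V" and d: "dual_lists V us ls" and sub: "set us \<subseteq> U"
    and x: "x \<in> U" and l: "linear_form V l" and ne: "l x \<noteq> (\<Sum>a<length us. (ls ! a) x * l (us ! a))"
  shows "\<exists>y\<in>U. \<exists>k. dual_lists V (us @ [y]) (ls @ [k])"
proof -
  note vs = subspace_D(1)[OF U]
  note xV = subsetD[OF subspace_D(2)[OF U] x]
  obtain y where y: "y \<in> U" "\<And>l. linear_form V l \<Longrightarrow> l y = (\<Sum>a<length us. (ls ! a) x * l (us ! a))"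
    using comb_exists[OF U sub, of "\<lambda>a. (ls ! a) x"] by blast
  note yV = subsetD[OF subspace_D(2)[OF U] y(1)]
  define m where "m = (\<lambda>z. l z - (\<Sum>a<length us. (ls ! a) z * l (us ! a)))"
  define k where "k = (\<lambda>z. inverse (m x) * m z)"
  have m: "linear_form V m" "\<And>b. b < length us \<Longrightarrow> m (us ! b) = 0"
    unfolding m_def by (fact residual_form(1)[OF d l], fact residual_form(2)[OF d l])
  have k: "linear_form V k" unfolding k_def by (rule linear_form_scale[OF m(1)])
  have my: "m y = 0" using y(2)[OF m(1)] m(2) by simp
  have mx: "m x \<noteq> 0" using ne by (simp add: m_def)
  have kx: "k (x \<ominus>\<^bsub>V\<^esub> y) = 1"
    using linear_form_minus[OF vs m(1) xV yV] my mx by (simp add: k_def)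
  have ls0: "(ls ! a) (x \<ominus>\<^bsub>V\<^esub> y) = 0" if a: "a < length us" for a
  proof -
    have "(ls ! a) y = (\<Sum>b<length us. if b = a then (ls ! b) x else 0)"
      unfolding y(2)[OF dual_lists_form[OF d a]] using a
      by (intro sum.cong) (auto simp: dual_lists_eq[OF d])
    then have "(ls ! a) y = (ls ! a) x" using a by simp
    then show ?thesis using linear_form_minus[OF vs dual_lists_form[OF d a] xV yV] by simp
  qed
  have "dual_lists V (us @ [x \<ominus>\<^bsub>V\<^esub> y]) (ls @ [k])"
    unfolding dual_lists_def
  proof (intro conjI allI impI)
    show "length (ls @ [k]) = length (us @ [x \<ominus>\<^bsub>V\<^esub> y])" using d by (simp add: dual_lists_def)
    show "set (us @ [x \<ominus>\<^bsub>V\<^esub> y]) \<subseteq> carrier V"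
      using d vs_closed(4)[OF vs xV yV] by (auto simp: dual_lists_def)
    show "\<forall>l\<in>set (ls @ [k]). linear_form V l" using d k by (auto simp: dual_lists_def)
    fix a b assume "a < length (us @ [x \<ominus>\<^bsub>V\<^esub> y])" "b < length (us @ [x \<ominus>\<^bsub>V\<^esub> y])"
    moreover have "length ls = length us" using d by (simp add: dual_lists_def)
    ultimately show "((ls @ [k]) ! a) ((us @ [x \<ominus>\<^bsub>V\<^esub> y]) ! b) = (if a = b then 1 else 0)"
      using dual_lists_eq[OF d] ls0 kx m(2) by (auto simp: nth_append k_def less_Suc_eq)
  qed
  moreover have "x \<ominus>\<^bsub>V\<^esub> y \<in> U" by (rule subspace_minus[OF U x y(1)])
  ultimately show ?thesis by blast
qed

text \<open>The extension process stops, since dual lists are not longer than a frame of the whole space.  The given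
  forms \<open>ls\<close> survive unchanged; this is what later puts a prescribed form first.\<close>

lemma frame_extend:
  assumes V: "fdspace V" and U: "VectorSpace.subspace class_ring U V"
    and d: "dual_lists V us ls" and sub: "set us \<subseteq> U"
  obtains us' ls' where "frame V U (us @ us') (ls @ ls')"
proof -
  obtain bs ks where f: "frame V (carrier V) bs ks" using V by (auto simp: fdspace_def)
  have "\<exists>us' ls'. frame V U (us @ us') (ls @ ls')"
    using d sub
  proof (induction "length bs - length us" arbitrary: us ls rule: less_induct)
    case less
    show ?case
    proof (cases "frame V U us ls")
      case True
      then have "frame V U (us @ []) (ls @ [])" by simp
      then show ?thesis by blast
    next
      case False
      then obtain x l where "x \<in> U" "linear_form V l" "l x \<noteq> (\<Sum>a<length us. (ls ! a) x * l (us ! a))"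
        using less.prems unfolding frame_def by blast
      from dual_lists_snoc[OF U less.prems this] obtain y k where
        y: "y \<in> U" "dual_lists V (us @ [y]) (ls @ [k])" by blast
      have "length (us @ [y]) \<le> length bs"
        using dual_lists_length[OF f y(2)] y(2) by (auto simp: dual_lists_def)
      then have "length bs - length (us @ [y]) < length bs - length us" by simp
      moreover have "set (us @ [y]) \<subseteq> U" using y(1) less.prems(2) by simp
      ultimately obtain us' ls' where "frame V U ((us @ [y]) @ us') ((ls @ [k]) @ ls')"
        using less.hyps y(2) by blast
      then show ?thesis unfolding append.assoc by blast
    qed
  qed
  then show ?thesis using that by blast
qed

lemma dual_lists_Nil: "dual_lists V [] []"
  by (simp add: dual_lists_def)

lemma frame_exists:
  assumes "fdspace V" "VectorSpace.subspace class_ring U V"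
  obtains us ls where "frame V U us ls"
  using frame_extend[OF assms dual_lists_Nil] by auto

lemma separating_form:
  assumes V: "fdspace V" and U: "VectorSpace.subspace class_ring U V" and x: "x \<in> carrier V" "x \<notin> U"
  obtains l where "linear_form V l" "\<And>u. u \<in> U \<Longrightarrow> l u = 0" "l x = 1"
proof -
  obtain us ls where f: "frame V U us ls" by (rule frame_exists[OF V U])
  then have d: "dual_lists V us ls" and sub: "set us \<subseteq> U" by (auto simp: frame_def)
  obtain y where y: "y \<in> U" "\<And>l. linear_form V l \<Longrightarrow> l y = (\<Sum>a<length us. (ls ! a) x * l (us ! a))"
    using comb_exists[OF U sub, of "\<lambda>a. (ls ! a) x"] by blast
  have "x \<noteq> y" using x y by auto
  then obtain l where l: "linear_form V l" "l x \<noteq> l y"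
    using form_eqI[OF V x(1)] y(1) subspace_D(2)[OF U] by blast
  define m where "m = (\<lambda>z. l z - (\<Sum>a<length us. (ls ! a) z * l (us ! a)))"
  have m: "linear_form V m" "\<And>b. b < length us \<Longrightarrow> m (us ! b) = 0"
    unfolding m_def by (fact residual_form(1)[OF d l(1)], fact residual_form(2)[OF d l(1)])
  have mx: "m x \<noteq> 0" using l(2) y(2)[OF l(1)] by (simp add: m_def)
  show ?thesis
  proof (rule that[of "\<lambda>z. inverse (m x) * m z"])
    show "linear_form V (\<lambda>z. inverse (m x) * m z)" by (rule linear_form_scale[OF m(1)])
    show "inverse (m x) * m u = 0" if "u \<in> U" for u
    proof -
      have "m u = (\<Sum>a<length us. (ls ! a) u * m (us ! a))" using f that m(1) by (simp add: frame_def)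
      also have "\<dots> = 0" using m(2) by (intro sum.neutral) simp
      finally show ?thesis by simp
    qed
  qed (use mx in simp)
qed

subsection \<open>Comparison with bases\<close>

lemma basis_coordinates:
  fixes V :: "('k::field, 'v) module"
  assumes vs: "vectorspace class_ring V" and finB: "finite B" and B: "vectorspace.basis class_ring V B"
  obtains c where "\<And>b. b \<in> B \<Longrightarrow> linear_form V (c b)"
    "\<And>b b'. b \<in> B \<Longrightarrow> b' \<in> B \<Longrightarrow> c b b' = (if b = b' then 1 else 0)"
    "\<And>x l. x \<in> carrier V \<Longrightarrow> linear_form V l \<Longrightarrow> l x = (\<Sum>b\<in>B. c b x * l b)"
    "\<And>x. x \<in> carrier V \<Longrightarrow> (\<And>b. b \<in> B \<Longrightarrow> c b x = 0) \<Longrightarrow> x = \<zero>\<^bsub>V\<^esub>"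
proof -
  interpret vectorspace class_ring V by fact
  have BV: "B \<subseteq> carrier V" using B by (simp add: basis_def)
  have ex1: "\<exists>!a. a \<in> B \<rightarrow>\<^sub>E UNIV \<and> lincomb a B = v" if "v \<in> carrier V" for v
  proof -
    have "\<forall>v. v \<in> carrier V \<longrightarrow> (\<exists>!a. a \<in> B \<rightarrow>\<^sub>E carrier class_ring \<and> lincomb a B = v)"
      by (rule iffD1[OF basis_criterion[OF finB BV] B])
    then show ?thesis using that by simp
  qed
  define A where "A v = (THE a. a \<in> B \<rightarrow>\<^sub>E UNIV \<and> lincomb a B = v)" for v
  have A: "lincomb (A v) B = v" if "v \<in> carrier V" for v
    using theI'[OF ex1[OF that]] by (simp add: A_def)
  have uniq: "a b = A v b" if "v \<in> carrier V" "lincomb a B = v" "b \<in> B" for a v b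
  proof -
    have "lincomb (restrict a B) B = v"
      using that(2) by (subst lincomb_cong[OF refl BV, of _ a]) auto
    then have "restrict a B = A v"
      unfolding A_def using the1_equality[OF ex1[OF that(1)], of "restrict a B"] by auto
    then show ?thesis using that(3) by (metis restrict_apply')
  qed
  show ?thesis
  proof (rule that[of "\<lambda>b v. A v b"])
    fix b assume b: "b \<in> B"
    show "linear_form V (\<lambda>v. A v b)"
      unfolding linear_form_def
    proof (intro conjI allI ballI)
      fix x y assume x: "x \<in> carrier V" and y: "y \<in> carrier V"
      have "lincomb (\<lambda>b. A x b + A y b) B = x \<oplus>\<^bsub>V\<^esub> y"
        using lincomb_sum[OF finB BV, of "A x" "A y"] A[OF x] A[OF y] by simp
      then show "A (x \<oplus>\<^bsub>V\<^esub> y) b = A x b + A y b"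
        using uniq[of "x \<oplus>\<^bsub>V\<^esub> y" "\<lambda>b. A x b + A y b"] x y b by simp
    next
      fix c x assume x: "x \<in> carrier V"
      have "lincomb (\<lambda>b. c * A x b) B = c \<odot>\<^bsub>V\<^esub> x"
        using lincomb_smult[OF BV, of "A x" c] A[OF x] by simp
      then show "A (c \<odot>\<^bsub>V\<^esub> x) b = c * A x b"
        using uniq[of "c \<odot>\<^bsub>V\<^esub> x" "\<lambda>b. c * A x b"] x b by simp
    qed
  next
    fix b b' assume b: "b \<in> B" "b' \<in> B"
    have "lincomb (\<lambda>b. if b = b' then 1 else 0) B = (\<Oplus>\<^bsub>V\<^esub>b\<in>B. if b = b' then b else \<zero>\<^bsub>V\<^esub>)"
      unfolding lincomb_def using BV smult_one smult_l_null by (intro finsum_cong') auto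
    also have "\<dots> = b'" using b(2) BV finB finsum_singleton[of b' B "\<lambda>x. x"]
      by (auto simp: Pi_def eq_commute[of _ b'])
    finally show "A b' b = (if b = b' then 1 else 0)"
      using uniq[of b' "\<lambda>b. if b = b' then 1 else 0" b] b BV by auto
  next
    fix x l assume x: "x \<in> carrier V" and l: "linear_form V l"
    have "l x = l (lincomb (A x) B)" using A[OF x] by simp
    also have "\<dots> = (\<Sum>b\<in>B. l (A x b \<odot>\<^bsub>V\<^esub> b))"
      unfolding lincomb_def using BV by (intro linear_form_finsum[OF vs l]) auto
    also have "\<dots> = (\<Sum>b\<in>B. A x b * l b)"
      using BV by (intro sum.cong refl linear_form_smult[OF l]) auto
    finally show "l x = (\<Sum>b\<in>B. A x b * l b)" .
  next
    fix x assume x: "x \<in> carrier V" and 0: "\<And>b. b \<in> B \<Longrightarrow> A x b = 0"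
    have "lincomb (A x) B = (\<Oplus>\<^bsub>V\<^esub>b\<in>B. \<zero>\<^bsub>V\<^esub>)"
      unfolding lincomb_def using BV 0 smult_l_null by (intro finsum_cong') auto
    also have "\<dots> = \<zero>\<^bsub>V\<^esub>" by (rule finsum_zero)
    finally show "x = \<zero>\<^bsub>V\<^esub>" using A[OF x] by simp
  qed
qed

lemma fin_dim_fdspace:
  fixes V :: "('k::field, 'v) module"
  assumes vs: "vectorspace class_ring V" and fd: "vectorspace.fin_dim class_ring V"
  shows "fdspace V"
proof -
  interpret vectorspace class_ring V by fact
  obtain B where finB: "finite B" and B: "basis B" using finite_basis_exists[OF fd] by blast
  then have BV: "B \<subseteq> carrier V" by (simp add: basis_def)
  obtain us where us: "set us = B" "distinct us" using finite_distinct_list[OF finB] by blast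
  obtain c where c: "\<And>b. b \<in> B \<Longrightarrow> linear_form V (c b)"
    "\<And>b b'. b \<in> B \<Longrightarrow> b' \<in> B \<Longrightarrow> c b b' = (if b = b' then 1 else 0)"
    "\<And>x l. x \<in> carrier V \<Longrightarrow> linear_form V l \<Longrightarrow> l x = (\<Sum>b\<in>B. c b x * l b)"
    "\<And>x. x \<in> carrier V \<Longrightarrow> (\<And>b. b \<in> B \<Longrightarrow> c b x = 0) \<Longrightarrow> x = \<zero>\<^bsub>V\<^esub>"
    by (rule basis_coordinates[OF vs finB B]) (rule that, blast+)
  have mem: "us ! a \<in> B" if "a < length us" for a using us(1) that nth_mem by blast
  have "frame V (carrier V) us (map c us)"
    unfolding frame_def dual_lists_def
  proof (intro conjI allI ballI impI)
    fix a b assume "a < length us" "b < length us"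
    then show "(map c us ! a) (us ! b) = (if a = b then 1 else 0)"
      using c(2)[OF mem mem] us(2) by (simp add: nth_eq_iff_index_eq)
  next
    fix x l assume "x \<in> carrier V" "linear_form V l"
    then have "l x = (\<Sum>b\<in>B. c b x * l b)" by (rule c(3))
    also have "\<dots> = (\<Sum>a<length us. c (us ! a) x * l (us ! a))"
      using bij_betw_nth[OF us(2) refl us(1)[symmetric]] by (intro sum.reindex_bij_betw[symmetric])
    finally show "l x = (\<Sum>a<length us. (map c us ! a) x * l (us ! a))" by simp
  qed (use c(1) us(1) BV in auto)
  moreover have "x = \<zero>\<^bsub>V\<^esub>" if "x \<in> carrier V" "\<forall>l. linear_form V l \<longrightarrow> l x = 0" for x
    using c(4)[OF that(1)] c(1) that(2) by blast
  ultimately show ?thesis using vs by (auto simp: fdspace_def)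
qed

text \<open>Frames are the bases of subspaces in the sense of the vector space library, so they compute dimensions
  and may replace the basis that occurs in the definition of the Pluecker coordinates.\<close>

lemma frame_basis:
  fixes V :: "('k::field, 'v) module"
  assumes V: "fdspace V" and U: "VectorSpace.subspace class_ring U V" and f: "frame V U us ls"
  shows "distinct us" and "vectorspace.basis class_ring (V\<lparr>carrier := U\<rparr>) (set us)"
    and "vdim V U = length us"
proof -
  note vs = fdspace_vs[OF V]
  interpret V: vectorspace class_ring V by fact
  interpret U: vectorspace class_ring "V\<lparr>carrier := U\<rparr>" by (rule V.subspace_is_vs[OF U])
  have d: "dual_lists V us ls" and sub: "set us \<subseteq> U"
    and span: "\<And>x l. x \<in> U \<Longrightarrow> linear_form V l \<Longrightarrow> l x = (\<Sum>a<length us. (ls ! a) x * l (us ! a))"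
    using f by (auto simp: frame_def)
  note UV = subspace_D(2)[OF U]
  show dist: "distinct us"
    unfolding distinct_conv_nth using dual_lists_eq[OF d] by (metis one_neq_zero)
  have lf: "linear_form (V\<lparr>carrier := U\<rparr>) l" if "linear_form V l" for l
    using that UV by (auto simp: linear_form_def subset_iff)
  have comb: "l (U.lincomb a (set us)) = (\<Sum>i<length us. a (us ! i) * l (us ! i))"
    if l: "linear_form V l" for l a
  proof -
    have "l (U.lincomb a (set us)) = (\<Sum>u\<in>set us. l (a u \<odot>\<^bsub>V\<^esub> u))"
      unfolding U.lincomb_def
      using linear_form_finsum[OF U.vectorspace_axioms lf[OF l], of "set us" "\<lambda>u. a u \<odot>\<^bsub>V\<^esub> u"] sub
        subspace_D(5)[OF U] by auto
    also have "\<dots> = (\<Sum>u\<in>set us. a u * l u)"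
      using sub UV by (intro sum.cong refl linear_form_smult[OF l]) auto
    also have "\<dots> = (\<Sum>i<length us. a (us ! i) * l (us ! i))"
      using bij_betw_nth[OF dist refl refl] by (intro sum.reindex_bij_betw[symmetric])
    finally show ?thesis .
  qed
  have li: "U.lin_indpt (set us)"
  proof (rule U.finite_lin_indpt2)
    fix a assume 0: "U.lincomb a (set us) = \<zero>\<^bsub>V\<lparr>carrier := U\<rparr>\<^esub>"
    show "\<forall>v\<in>set us. a v = \<zero>\<^bsub>class_ring\<^esub>"
    proof
      fix v assume "v \<in> set us"
      then obtain i where i: "i < length us" "v = us ! i" by (auto simp: in_set_conv_nth)
      have "(ls ! i) (U.lincomb a (set us)) = 0"
        using 0 linear_form_zero[OF vs dual_lists_form[OF d i(1)]] by simp
      moreover have "(\<Sum>j<length us. a (us ! j) * (ls ! i) (us ! j)) =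
          (\<Sum>j<length us. if j = i then a (us ! j) else 0)"
        using i by (intro sum.cong) (auto simp: dual_lists_eq[OF d])
      ultimately show "a v = \<zero>\<^bsub>class_ring\<^esub>" using comb[OF dual_lists_form[OF d i(1)]] i by simp
    qed
  qed (use sub in auto)
  have "U.span (set us) = U"
  proof (intro equalityI subsetI)
    fix x assume "x \<in> U.span (set us)"
    then show "x \<in> U" using U.span_closed[of "set us" x] sub by simp
  next
    fix x assume x: "x \<in> U"
    define a where "a = (\<lambda>u. (ls ! (THE i. i < length us \<and> us ! i = u)) x)"
    have a: "a (us ! i) = (ls ! i) x" if "i < length us" for i
    proof -
      have "(THE j. j < length us \<and> us ! j = us ! i) = i"
        using that dist by (intro the_equality) (auto simp: nth_eq_iff_index_eq)
      then show ?thesis by (simp add: a_def)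
    qed
    have mem: "U.lincomb a (set us) \<in> U" using sub U.lincomb_closed[of "set us" a] by simp
    have "x = U.lincomb a (set us)"
    proof (rule form_eqI[OF V])
      show "l x = l (U.lincomb a (set us))" if "linear_form V l" for l
        unfolding span[OF x that] comb[OF that] using a by (intro sum.cong) auto
    qed (use x mem UV in auto)
    then show "x \<in> U.span (set us)"
      unfolding U.span_def by (intro CollectI exI[of _ a] exI[of _ "set us"]) simp
  qed
  then show B: "U.basis (set us)" using li sub by (simp add: U.basis_def)
  show "vdim V U = length us"
    unfolding vdim_def using U.dim_basis[OF _ B] distinct_card[OF dist] by simp
qed

lemma basis_frame:
  fixes V :: "('k::field, 'v) module"
  assumes V: "fdspace V" and U: "VectorSpace.subspace class_ring U V" and dist: "distinct us"
    and B: "vectorspace.basis class_ring (V\<lparr>carrier := U\<rparr>) (set us)"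
  obtains ls where "frame V U us ls"
proof -
  note vs = fdspace_vs[OF V]
  note UV = subspace_D(2)[OF U]
  interpret V: vectorspace class_ring V by fact
  interpret U: vectorspace class_ring "V\<lparr>carrier := U\<rparr>" by (rule V.subspace_is_vs[OF U])
  have sub: "set us \<subseteq> U" using B by (simp add: U.basis_def)
  obtain c where c: "\<And>b. b \<in> set us \<Longrightarrow> linear_form (V\<lparr>carrier := U\<rparr>) (c b)"
    "\<And>b b'. b \<in> set us \<Longrightarrow> b' \<in> set us \<Longrightarrow> c b b' = (if b = b' then 1 else 0)"
    "\<And>x l. x \<in> carrier (V\<lparr>carrier := U\<rparr>) \<Longrightarrow> linear_form (V\<lparr>carrier := U\<rparr>) l \<Longrightarrow>
      l x = (\<Sum>b\<in>set us. c b x * l b)"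
    by (rule basis_coordinates[OF U.vectorspace_axioms finite_set B]) (rule that, blast+)
  obtain ws ks where f: "frame V U ws ks" by (rule frame_exists[OF V U])
  then have d: "dual_lists V ws ks" and ws: "set ws \<subseteq> U" by (auto simp: frame_def)
  have lf: "linear_form (V\<lparr>carrier := U\<rparr>) l" if "linear_form V l" for l
    using that UV by (auto simp: linear_form_def subset_iff)
  \<comment> \<open>The coordinates on \<open>U\<close> extend to \<open>V\<close> along the projection given by any frame.\<close>
  define e where "e = (\<lambda>b x. \<Sum>i<length ws. c b (ws ! i) * (ks ! i) x)"
  have e: "linear_form V (e b)" for b
    unfolding e_def using dual_lists_form[OF d] by (intro linear_form_sum linear_form_scale) auto
  have e_eq: "e b x = c b x" if b: "b \<in> set us" and x: "x \<in> U" for b x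
  proof -
    obtain y where y: "y \<in> U" "\<And>l. linear_form V l \<Longrightarrow> l y = (\<Sum>i<length ws. (ks ! i) x * l (ws ! i))"
      "\<And>l. linear_form (V\<lparr>carrier := U\<rparr>) l \<Longrightarrow> l y = (\<Sum>i<length ws. (ks ! i) x * l (ws ! i))"
    proof -
      let ?U = "V\<lparr>carrier := U\<rparr>"
      have "VectorSpace.subspace class_ring U ?U"
        using carrier_subspace[OF U.vectorspace_axioms] by simp
      from comb_exists[OF this ws, of "\<lambda>i. (ks ! i) x"] show ?thesis using that lf by blast
    qed
    have "x = y"
    proof (rule form_eqI[OF V])
      show "l x = l y" if "linear_form V l" for l
        unfolding y(2)[OF that] using f x that by (simp add: frame_def)
    qed (use x y(1) UV in auto)
    then show ?thesis using y(3)[OF c(1)[OF b]] by (simp add: e_def mult.commute)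
  qed
  have mem: "us ! a \<in> set us" if "a < length us" for a using that by simp
  have "frame V U us (map e us)"
    unfolding frame_def dual_lists_def
  proof (intro conjI allI ballI impI)
    fix a b assume "a < length us" "b < length us"
    then show "(map e us ! a) (us ! b) = (if a = b then 1 else 0)"
      using c(2)[OF mem mem] e_eq[OF mem] sub dist by (simp add: nth_eq_iff_index_eq subset_eq)
  next
    fix x l assume x: "x \<in> U" and l: "linear_form V l"
    then have "l x = (\<Sum>b\<in>set us. c b x * l b)" using c(3)[of x l] lf[OF l] x by simp
    also have "\<dots> = (\<Sum>b\<in>set us. e b x * l b)" using e_eq x by (intro sum.cong) auto
    also have "\<dots> = (\<Sum>a<length us. e (us ! a) x * l (us ! a))"
      using bij_betw_nth[OF dist refl refl] by (intro sum.reindex_bij_betw[symmetric])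
    finally show "l x = (\<Sum>a<length us. (map e us ! a) x * l (us ! a))" by simp
  qed (use e sub UV in auto)
  then show ?thesis by (rule that)
qed

lemma dual_lists_frame:
  assumes V: "fdspace V" and U: "VectorSpace.subspace class_ring U V"
    and d: "dual_lists V us ls" "set us \<subseteq> U"
    and len: "length us = vdim V U"
  shows "frame V U us ls"
proof -
  obtain us' ls' where f: "frame V U (us @ us') (ls @ ls')" by (rule frame_extend[OF V U d])
  note l = frame_basis(3)[OF V U f]
  from len have "us' = []" "length (us @ us') = length (ls @ ls')"
    using l f by (auto simp: frame_def dual_lists_def)
  moreover have "length us = length ls" using d by (simp add: dual_lists_def)
  ultimately show "frame V U us ls" using f by simp
qed

subsection \<open>Quotients\<close>

lemma quot_coset:
  fixes V :: "('k::field, 'v) module"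
  assumes S: "VectorSpace.subspace class_ring S V"
  shows "x \<in> carrier V \<Longrightarrow> y \<in> S +>\<^bsub>V\<^esub> x \<longleftrightarrow> y \<in> carrier V \<and> y \<ominus>\<^bsub>V\<^esub> x \<in> S"
    and "x \<in> carrier V \<Longrightarrow> y \<in> carrier V \<Longrightarrow> S +>\<^bsub>V\<^esub> x = S +>\<^bsub>V\<^esub> y \<longleftrightarrow> x \<ominus>\<^bsub>V\<^esub> y \<in> S"
    and "x \<in> carrier V \<Longrightarrow> y \<in> carrier V \<Longrightarrow>
      set_add V (S +>\<^bsub>V\<^esub> x) (S +>\<^bsub>V\<^esub> y) = S +>\<^bsub>V\<^esub> (x \<oplus>\<^bsub>V\<^esub> y)"
    and "x \<in> carrier V \<Longrightarrow> (\<Union>z\<in>S +>\<^bsub>V\<^esub> x. S +>\<^bsub>V\<^esub> (c \<odot>\<^bsub>V\<^esub> z)) = S +>\<^bsub>V\<^esub> (c \<odot>\<^bsub>V\<^esub> x)"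
    and "S +>\<^bsub>V\<^esub> \<zero>\<^bsub>V\<^esub> = S"
proof -
  interpret V: vectorspace class_ring V using subspace_D(1)[OF S] .
  note vs = V.vectorspace_axioms
  note SV = subspace_D(2)[OF S]
  have inv: "\<ominus>\<^bsub>V\<^esub> x \<in> S" if "x \<in> S" for x
  proof -
    have "\<zero>\<^bsub>V\<^esub> \<ominus>\<^bsub>V\<^esub> x \<in> S" using subspace_minus[OF S subspace_D(3)[OF S] that] .
    then show ?thesis using that SV by (simp add: a_minus_def subset_eq)
  qed
  have "subgroup S (add_monoid V)"
    using S inv SV subspace_D[OF S] by (intro V.add.subgroupI) (auto simp: a_inv_def)
  then interpret S: additive_subgroup S V by (rule additive_subgroup.intro)
  interpret S: abelian_subgroup S V
    by (intro abelian_subgroupI3 S.additive_subgroup_axioms V.abelian_group_axioms)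
  show mem: "y \<in> S +>\<^bsub>V\<^esub> x \<longleftrightarrow> y \<in> carrier V \<and> y \<ominus>\<^bsub>V\<^esub> x \<in> S" if "x \<in> carrier V" for x y
    using S.a_rcos_module[OF that, of y] V.a_r_coset_subset_G[OF SV that] by (auto simp: a_minus_def)
  show eq: "S +>\<^bsub>V\<^esub> x = S +>\<^bsub>V\<^esub> y \<longleftrightarrow> x \<ominus>\<^bsub>V\<^esub> y \<in> S" if "x \<in> carrier V" "y \<in> carrier V" for x y
  proof -
    have "x \<ominus>\<^bsub>V\<^esub> x = \<zero>\<^bsub>V\<^esub>" using that by (simp add: a_minus_def V.r_neg)
    then have "x \<in> S +>\<^bsub>V\<^esub> x" using mem[OF that(1), of x] that(1) S.zero_closed by metis
    moreover have "S +>\<^bsub>V\<^esub> y = S +>\<^bsub>V\<^esub> x" if "x \<in> S +>\<^bsub>V\<^esub> y"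
      using S.a_repr_independence' that \<open>y \<in> carrier V\<close> by blast
    ultimately show ?thesis using mem[OF that(2), of x] that by metis
  qed
  show "set_add V (S +>\<^bsub>V\<^esub> x) (S +>\<^bsub>V\<^esub> y) = S +>\<^bsub>V\<^esub> (x \<oplus>\<^bsub>V\<^esub> y)"
    if "x \<in> carrier V" "y \<in> carrier V" for x y
    using S.a_rcos_sum that by blast
  show "S +>\<^bsub>V\<^esub> \<zero>\<^bsub>V\<^esub> = S" using SV by simp
  show "(\<Union>z\<in>S +>\<^bsub>V\<^esub> x. S +>\<^bsub>V\<^esub> (c \<odot>\<^bsub>V\<^esub> z)) = S +>\<^bsub>V\<^esub> (c \<odot>\<^bsub>V\<^esub> x)" if x: "x \<in> carrier V" for x c
  proof -
    have "S +>\<^bsub>V\<^esub> (c \<odot>\<^bsub>V\<^esub> z) = S +>\<^bsub>V\<^esub> (c \<odot>\<^bsub>V\<^esub> x)" if "z \<in> S +>\<^bsub>V\<^esub> x" for z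
    proof -
      have z: "z \<in> carrier V" "z \<ominus>\<^bsub>V\<^esub> x \<in> S" using that mem[OF x] by auto
      have "(c \<odot>\<^bsub>V\<^esub> z) \<ominus>\<^bsub>V\<^esub> (c \<odot>\<^bsub>V\<^esub> x) = c \<odot>\<^bsub>V\<^esub> (z \<ominus>\<^bsub>V\<^esub> x)"
        using x z(1) V.smult_r_distr V.smult_r_minus by (simp add: a_minus_def)
      then show ?thesis using x z subspace_D(5)[OF S z(2)] by (subst eq) auto
    qed
    moreover have "x \<in> S +>\<^bsub>V\<^esub> x"
      using mem[OF x, of x] x S.zero_closed V.r_neg by (simp add: a_minus_def)
    ultimately show ?thesis by blast
  qed
qed

lemma quot_space_sel:
  "carrier (quot_space V S) = (\<lambda>x. S +>\<^bsub>V\<^esub> x) ` carrier V"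
  "\<zero>\<^bsub>quot_space V S\<^esub> = S"
  "x \<oplus>\<^bsub>quot_space V S\<^esub> y = set_add V x y"
  "c \<odot>\<^bsub>quot_space V S\<^esub> x = (\<Union>z\<in>x. S +>\<^bsub>V\<^esub> (c \<odot>\<^bsub>V\<^esub> z))"
  by (auto simp: quot_space_def A_RCOSETS_def')

lemma quot_space_vs:
  fixes V :: "('k::field, 'v) module"
  assumes S: "VectorSpace.subspace class_ring S V"
  shows "vectorspace class_ring (quot_space V S)"
proof -
  interpret V: vectorspace class_ring V using subspace_D(1)[OF S] .
  have q: "x \<in> carrier V \<Longrightarrow> c \<odot>\<^bsub>quot_space V S\<^esub> (S +>\<^bsub>V\<^esub> x) = S +>\<^bsub>V\<^esub> (c \<odot>\<^bsub>V\<^esub> x)"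
    "x \<in> carrier V \<Longrightarrow> y \<in> carrier V \<Longrightarrow>
      (S +>\<^bsub>V\<^esub> x) \<oplus>\<^bsub>quot_space V S\<^esub> (S +>\<^bsub>V\<^esub> y) = S +>\<^bsub>V\<^esub> (x \<oplus>\<^bsub>V\<^esub> y)" for x y c
    by (simp_all add: quot_space_sel quot_coset(3,4)[OF S])
  have q0: "\<zero>\<^bsub>quot_space V S\<^esub> = S +>\<^bsub>V\<^esub> \<zero>\<^bsub>V\<^esub>"
    by (simp add: quot_space_sel quot_coset(5)[OF S])
  note q = quot_space_sel(1) q q0
  show ?thesis
  proof (rule vs_criteria)
    show "field (class_ring :: 'k ring)" by (rule class_field)
    show "\<zero>\<^bsub>quot_space V S\<^esub> \<in> carrier (quot_space V S)"
      unfolding q0 quot_space_sel(1) by auto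
    show "\<forall>v\<in>carrier (quot_space V S). \<exists>neg_v\<in>carrier (quot_space V S).
        v \<oplus>\<^bsub>quot_space V S\<^esub> neg_v = \<zero>\<^bsub>quot_space V S\<^esub>"
    proof
      fix v assume "v \<in> carrier (quot_space V S)"
      then obtain x where x: "x \<in> carrier V" "v = S +>\<^bsub>V\<^esub> x" by (auto simp: q(1))
      show "\<exists>neg_v\<in>carrier (quot_space V S). v \<oplus>\<^bsub>quot_space V S\<^esub> neg_v = \<zero>\<^bsub>quot_space V S\<^esub>"
        using x by (intro bexI[of _ "S +>\<^bsub>V\<^esub> (\<ominus>\<^bsub>V\<^esub> x)"]) (auto simp: q V.r_neg)
    qed
    show "\<forall>a b v. a \<in> carrier class_ring \<and> b \<in> carrier class_ring \<and> v \<in> carrier (quot_space V S) \<longrightarrow>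
       (a \<otimes>\<^bsub>class_ring\<^esub> b) \<odot>\<^bsub>quot_space V S\<^esub> v = a \<odot>\<^bsub>quot_space V S\<^esub> (b \<odot>\<^bsub>quot_space V S\<^esub> v)"
      using V.smult_assoc1 by (auto simp: q)
    show "\<forall>v\<in>carrier (quot_space V S). \<one>\<^bsub>class_ring\<^esub> \<odot>\<^bsub>quot_space V S\<^esub> v = v"
      using V.smult_one by (auto simp: q)
    show "\<forall>a b v. a \<in> carrier class_ring \<and> b \<in> carrier class_ring \<and> v \<in> carrier (quot_space V S) \<longrightarrow>
       (a \<oplus>\<^bsub>class_ring\<^esub> b) \<odot>\<^bsub>quot_space V S\<^esub> v =
       a \<odot>\<^bsub>quot_space V S\<^esub> v \<oplus>\<^bsub>quot_space V S\<^esub> b \<odot>\<^bsub>quot_space V S\<^esub> v"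
      using V.smult_l_distr by (auto simp: q)
    show "\<forall>a v w. a \<in> carrier class_ring \<and> v \<in> carrier (quot_space V S) \<and> w \<in> carrier (quot_space V S) \<longrightarrow>
       a \<odot>\<^bsub>quot_space V S\<^esub> (v \<oplus>\<^bsub>quot_space V S\<^esub> w) =
       a \<odot>\<^bsub>quot_space V S\<^esub> v \<oplus>\<^bsub>quot_space V S\<^esub> a \<odot>\<^bsub>quot_space V S\<^esub> w"
      using V.smult_r_distr by (auto simp: q)
  qed (auto simp: q V.a_ac)
qed

lemma linear_map_iff:
  fixes V :: "('k::field, 'v) module" and W :: "('k, 'w) module"
  shows "linear_map class_ring V W f \<longleftrightarrow> vectorspace class_ring V \<and> vectorspace class_ring W \<and>
    (\<forall>x\<in>carrier V. f x \<in> carrier W) \<and>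
    (\<forall>x\<in>carrier V. \<forall>y\<in>carrier V. f (x \<oplus>\<^bsub>V\<^esub> y) = f x \<oplus>\<^bsub>W\<^esub> f y) \<and>
    (\<forall>c. \<forall>x\<in>carrier V. f (c \<odot>\<^bsub>V\<^esub> x) = c \<odot>\<^bsub>W\<^esub> f x)"
  unfolding linear_map_def mod_hom_def mod_hom_axioms_def module_hom_def
  by (auto simp: vectorspace_def)

lemma linear_map_D:
  fixes V :: "('k::field, 'v) module" and W :: "('k, 'w) module"
  assumes "linear_map class_ring V W f"
  shows "vectorspace class_ring V" "vectorspace class_ring W"
    "x \<in> carrier V \<Longrightarrow> f x \<in> carrier W"
    "x \<in> carrier V \<Longrightarrow> y \<in> carrier V \<Longrightarrow> f (x \<oplus>\<^bsub>V\<^esub> y) = f x \<oplus>\<^bsub>W\<^esub> f y"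
    "x \<in> carrier V \<Longrightarrow> f (c \<odot>\<^bsub>V\<^esub> x) = c \<odot>\<^bsub>W\<^esub> f x"
    "f \<zero>\<^bsub>V\<^esub> = \<zero>\<^bsub>W\<^esub>"
    "x \<in> carrier V \<Longrightarrow> y \<in> carrier V \<Longrightarrow> f (x \<ominus>\<^bsub>V\<^esub> y) = f x \<ominus>\<^bsub>W\<^esub> f y"
proof -
  show *: "vectorspace class_ring V" "vectorspace class_ring W"
    "x \<in> carrier V \<Longrightarrow> f x \<in> carrier W"
    "x \<in> carrier V \<Longrightarrow> y \<in> carrier V \<Longrightarrow> f (x \<oplus>\<^bsub>V\<^esub> y) = f x \<oplus>\<^bsub>W\<^esub> f y"
    "x \<in> carrier V \<Longrightarrow> f (c \<odot>\<^bsub>V\<^esub> x) = c \<odot>\<^bsub>W\<^esub> f x" for x y c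
    using assms unfolding linear_map_iff by auto
  show "f \<zero>\<^bsub>V\<^esub> = \<zero>\<^bsub>W\<^esub>" by (rule linear_map.T0_is_0[OF assms])
  show "x \<in> carrier V \<Longrightarrow> y \<in> carrier V \<Longrightarrow> f (x \<ominus>\<^bsub>V\<^esub> y) = f x \<ominus>\<^bsub>W\<^esub> f y"
    using * vs_closed(3)[OF *(1)] by (simp add: vs_minus[OF *(1)] vs_minus[OF *(2)])
qed

lemma linear_map_comp:
  fixes V :: "('k::field, 'v) module" and W :: "('k, 'w) module" and X :: "('k, 'x) module"
  assumes "linear_map class_ring V W f" "linear_map class_ring W X g"
  shows "linear_map class_ring V X (g \<circ> f)"
  using assms unfolding linear_map_iff by auto

lemma linear_form_pullback:
  fixes V :: "('k::field, 'v) module" and W :: "('k, 'w) module"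
  assumes "linear_map class_ring V W f" "linear_form W l"
  shows "linear_form V (l \<circ> f)"
  using linear_map_D[OF assms(1)] assms(2) unfolding linear_form_def by auto

lemma image_subspace:
  fixes V :: "('k::field, 'v) module" and W :: "('k, 'w) module"
  assumes f: "linear_map class_ring V W f" and U: "VectorSpace.subspace class_ring U V"
  shows "VectorSpace.subspace class_ring (f ` U) W"
proof -
  note D = linear_map_D[OF f]
  note UD = subspace_D[OF U]
  have "f x \<oplus>\<^bsub>W\<^esub> f y \<in> f ` U" if "x \<in> U" "y \<in> U" for x y
    using D(4)[of x y] UD(2,4) that by (metis imageI subsetD)
  moreover have "c \<odot>\<^bsub>W\<^esub> f x \<in> f ` U" if "x \<in> U" for c x
    using D(5)[of x c] UD(2,5) that by (metis imageI subsetD)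
  moreover have "\<zero>\<^bsub>W\<^esub> \<in> f ` U" using D(6) UD(3) by (metis imageI)
  ultimately show ?thesis unfolding subspace_iff[OF D(2)] using D(3) UD(2) by auto
qed

lemma preimage_subspace:
  fixes V :: "('k::field, 'v) module" and W :: "('k, 'w) module"
  assumes f: "linear_map class_ring V W f" and S: "VectorSpace.subspace class_ring S W"
  shows "VectorSpace.subspace class_ring {x \<in> carrier V. f x \<in> S} V"
  unfolding subspace_iff[OF linear_map_D(1)[OF f]]
  using linear_map_D[OF f] subspace_D[OF S] vs_closed[OF linear_map_D(1)[OF f]] by auto

text \<open>The value at \<open>y\<close> is taken at an arbitrary preimage.  This is meaningful when \<open>l\<close> kills the kernel of \<open>h\<close>,
  but \<open>descend V h\<close> is additive in \<open>l\<close> in any case, since the preimage does not depend on \<open>l\<close>.\<close>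

definition descend :: "('k::field, 'v) module \<Rightarrow> ('v \<Rightarrow> 'w) \<Rightarrow> ('v \<Rightarrow> 'k) \<Rightarrow> 'w \<Rightarrow> 'k" where
  "descend V h l = (\<lambda>y. l (SOME x. x \<in> carrier V \<and> h x = y))"

lemma descend:
  fixes V :: "('k::field, 'v) module" and W :: "('k, 'w) module"
  assumes h: "linear_map class_ring V W h" and surj: "h ` carrier V = carrier W"
    and l: "linear_form V l" and ker: "\<And>x. x \<in> carrier V \<Longrightarrow> h x = \<zero>\<^bsub>W\<^esub> \<Longrightarrow> l x = 0"
  shows "x \<in> carrier V \<Longrightarrow> descend V h l (h x) = l x"
    and "linear_form W (descend V h l)"
proof -
  note D = linear_map_D[OF h]
  interpret W: vectorspace class_ring W by (rule D(2))
  show eq: "descend V h l (h x) = l x" if x: "x \<in> carrier V" for x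
  proof -
    define y where "y = (SOME y. y \<in> carrier V \<and> h y = h x)"
    have y: "y \<in> carrier V" "h y = h x"
      unfolding y_def using someI[of "\<lambda>y. y \<in> carrier V \<and> h y = h x" x] x by auto
    have "h (y \<ominus>\<^bsub>V\<^esub> x) = \<zero>\<^bsub>W\<^esub>" using D(7)[OF y(1) x] y(2) D(3)[OF x] W.r_neg by (simp add: a_minus_def)
    then have "l (y \<ominus>\<^bsub>V\<^esub> x) = 0" using ker vs_closed(4)[OF D(1)] x y by blast
    then show ?thesis using linear_form_minus[OF D(1) l y(1) x] by (simp add: descend_def y_def)
  qed
  show "linear_form W (descend V h l)"
    unfolding linear_form_def surj[symmetric]
    using eq D(4,5) vs_closed[OF D(1)] linear_form_add[OF l] linear_form_smult[OF l]
    by (auto simp flip: D(4,5))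
qed

lemma sum_lessThan_add:
  "(\<Sum>b<m + n. F b) = (\<Sum>b<m. F b) + (\<Sum>b<n. F (m + b))" for F :: "nat \<Rightarrow> 'a::comm_monoid_add"
  by (induction n) (auto simp: add.assoc)

text \<open>If \<open>ks\<close> spans the kernel, the forms \<open>ls\<close>, which vanish on \<open>ks\<close> by duality, descend to the image, where
  they are dual to the images of \<open>us\<close>.\<close>

lemma frame_image:
  fixes V :: "('k::field, 'v) module" and W :: "('k, 'w) module"
  assumes h: "linear_map class_ring V W h" and surj: "h ` carrier V = carrier W"
    and K: "frame V {x \<in> carrier V. h x = \<zero>\<^bsub>W\<^esub>} ks ms"
    and U: "U \<subseteq> carrier V" and f: "frame V U (ks @ us) (ms @ ls)"
  shows "frame W (h ` U) (map h us) (map (descend V h) ls)"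
proof -
  note D = linear_map_D[OF h]
  have d: "dual_lists V (ks @ us) (ms @ ls)" and sub: "set (ks @ us) \<subseteq> U"
    using f by (auto simp: frame_def)
  have len: "length ms = length ks" "length ls = length us"
    using K d by (auto simp: frame_def dual_lists_def)
  have form: "linear_form V l" if "l \<in> set ls" for l using d that by (auto simp: dual_lists_def)
  have ker0: "h k = \<zero>\<^bsub>W\<^esub>" if "k \<in> set ks" for k using K that by (auto simp: frame_def)
  have ls_ks: "(ls ! a) (ks ! b) = 0" if "a < length ls" "b < length ks" for a b
    using dual_lists_eq[OF d, of "length ks + a" b] that len by (simp add: nth_append)
  have ker: "l x = 0" if l: "l \<in> set ls" and x: "x \<in> carrier V" "h x = \<zero>\<^bsub>W\<^esub>" for l x
  proof -
    obtain a where a: "a < length ls" "l = ls ! a" using l by (auto simp: in_set_conv_nth)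
    have "l x = (\<Sum>b<length ks. (ms ! b) x * l (ks ! b))"
      using K x form[OF l] by (auto simp: frame_def)
    also have "\<dots> = 0" using ls_ks a by (intro sum.neutral) auto
    finally show ?thesis .
  qed
  have desc: "descend V h l (h x) = l x" "linear_form W (descend V h l)"
    if "l \<in> set ls" "x \<in> carrier V" for l x
    using descend[OF h surj form[OF that(1)]] ker[OF that(1)] that(2) by blast+
  have mem: "us ! b \<in> carrier V" if "b < length us" for b
  proof -
    have "us ! b \<in> set (ks @ us)" using that by simp
    then show ?thesis using U sub by blast
  qed
  show "frame W (h ` U) (map h us) (map (descend V h) ls)"
    unfolding frame_def dual_lists_def
  proof (intro conjI allI ballI impI)
    show "set (map h us) \<subseteq> carrier W" using d D(3) by (auto simp: dual_lists_def)
    show "linear_form W l" if "l \<in> set (map (descend V h) ls)" for l using desc(2)[OF _ vs_closed(1)[OF D(1)]] that by auto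
    fix a b assume ab: "a < length (map h us)" "b < length (map h us)"
    then have "(map (descend V h) ls ! a) (map h us ! b) = (ls ! a) (us ! b)"
      using desc(1)[of "ls ! a" "us ! b"] mem len by simp
    also have "\<dots> = (if a = b then 1 else 0)"
      using dual_lists_eq[OF d, of "length ks + a" "length ks + b"] ab len by (simp add: nth_append)
    finally show "(map (descend V h) ls ! a) (map h us ! b) = (if a = b then 1 else 0)" .
  next
    fix y l assume y: "y \<in> h ` U" and l: "linear_form W l"
    then obtain x where x: "x \<in> U" "y = h x" by auto
    have "l y = (l \<circ> h) x" using x by simp
    also have "\<dots> = (\<Sum>b<length (ks @ us). ((ms @ ls) ! b) x * (l \<circ> h) ((ks @ us) ! b))"
      using f x linear_form_pullback[OF h l] unfolding frame_def by blast
    also have "\<dots> = (\<Sum>b<length ks. (ms ! b) x * l (h (ks ! b))) +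
        (\<Sum>b<length us. (ls ! b) x * l (h (us ! b)))"
      unfolding length_append sum_lessThan_add by (simp add: nth_append len)
    also have "(\<Sum>b<length ks. (ms ! b) x * l (h (ks ! b))) = 0"
      using ker0 linear_form_zero[OF D(2) l] by (intro sum.neutral) simp
    also have "(\<Sum>b<length us. (ls ! b) x * l (h (us ! b))) =
        (\<Sum>a<length (map h us). (map (descend V h) ls ! a) y * l (map h us ! a))"
      using x U len by (intro sum.cong) (auto simp: desc(1) subset_iff)
    finally show "l y = (\<Sum>a<length (map h us). (map (descend V h) ls ! a) y * l (map h us ! a))"
      by simp
  qed (use len sub in auto)
qed

lemma vs_minus_zero:
  fixes V :: "('k::field, 'v) module"
  assumes "vectorspace class_ring V" "x \<in> carrier V"
  shows "x \<ominus>\<^bsub>V\<^esub> \<zero>\<^bsub>V\<^esub> = x"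
proof -
  interpret V: vectorspace class_ring V by fact
  show ?thesis using assms(2) by (simp add: a_minus_def V.add.inv_one)
qed

lemma quot_proj:
  fixes V :: "('k::field, 'v) module"
  assumes S: "VectorSpace.subspace class_ring S V"
  shows "linear_map class_ring V (quot_space V S) (\<lambda>x. S +>\<^bsub>V\<^esub> x)"
    and "(\<lambda>x. S +>\<^bsub>V\<^esub> x) ` carrier V = carrier (quot_space V S)"
    and "x \<in> carrier V \<Longrightarrow> S +>\<^bsub>V\<^esub> x = \<zero>\<^bsub>quot_space V S\<^esub> \<longleftrightarrow> x \<in> S"
proof -
  note vs = subspace_D(1)[OF S]
  interpret V: vectorspace class_ring V by (rule vs)
  show "linear_map class_ring V (quot_space V S) (\<lambda>x. S +>\<^bsub>V\<^esub> x)"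
    unfolding linear_map_iff using vs quot_space_vs[OF S]
    by (auto simp: quot_space_sel(1) quot_space_sel(3,4) quot_coset(3,4)[OF S])
  show "(\<lambda>x. S +>\<^bsub>V\<^esub> x) ` carrier V = carrier (quot_space V S)" by (simp add: quot_space_sel)
  show "S +>\<^bsub>V\<^esub> x = \<zero>\<^bsub>quot_space V S\<^esub> \<longleftrightarrow> x \<in> S" if "x \<in> carrier V"
    using quot_coset(2)[OF S that vs_closed(1)[OF vs]] that
    by (simp add: quot_space_sel(2) quot_coset(5)[OF S] vs_minus_zero[OF vs])
qed

lemma kernel_subspace:
  fixes V :: "('k::field, 'v) module" and W :: "('k, 'w) module"
  assumes h: "linear_map class_ring V W h"
  shows "VectorSpace.subspace class_ring {x \<in> carrier V. h x = \<zero>\<^bsub>W\<^esub>} V"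
  using preimage_subspace[OF h zero_subspace[OF linear_map_D(2)[OF h]]] by simp

lemma fdspace_image:
  fixes V :: "('k::field, 'v) module" and W :: "('k, 'w) module"
  assumes V: "fdspace V" and h: "linear_map class_ring V W h" and surj: "h ` carrier V = carrier W"
  shows "fdspace W"
proof -
  let ?K = "{x \<in> carrier V. h x = \<zero>\<^bsub>W\<^esub>}"
  note K = kernel_subspace[OF h]
  obtain ks ms where f: "frame V ?K ks ms" by (rule frame_exists[OF V K])
  then have "dual_lists V ks ms" "set ks \<subseteq> carrier V" by (auto simp: frame_def)
  then obtain us ls where f2: "frame V (carrier V) (ks @ us) (ms @ ls)"
    using frame_extend[OF V carrier_subspace[OF fdspace_vs[OF V]]] by blast
  have "frame W (carrier W) (map h us) (map (descend V h) ls)"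
    using frame_image[OF h surj f _ f2] surj by simp
  moreover have "y = \<zero>\<^bsub>W\<^esub>" if y: "y \<in> carrier W" "\<forall>l. linear_form W l \<longrightarrow> l y = 0" for y
  proof (rule ccontr)
    assume ne: "y \<noteq> \<zero>\<^bsub>W\<^esub>"
    obtain x where x: "x \<in> carrier V" "y = h x" using y(1) surj by blast
    obtain l where l: "linear_form V l" "\<And>u. u \<in> ?K \<Longrightarrow> l u = 0" "l x = 1"
      using separating_form[OF V K x(1)] ne x by blast
    have "descend V h l (h x) = l x" "linear_form W (descend V h l)"
      using descend[OF h surj l(1)] l(2) x by blast+
    then show False using y(2) l(3) x by auto
  qed
  ultimately show ?thesis using linear_map_D(2)[OF h] unfolding fdspace_def by blast
qed

text \<open>Rank and nullity: a frame of \<open>U\<close> can be chosen to start with a frame of the kernel.\<close>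

lemma vdim_image:
  fixes V :: "('k::field, 'v) module" and W :: "('k, 'w) module"
  assumes V: "fdspace V" and h: "linear_map class_ring V W h" and surj: "h ` carrier V = carrier W"
    and U: "VectorSpace.subspace class_ring U V" and K: "{x \<in> carrier V. h x = \<zero>\<^bsub>W\<^esub>} \<subseteq> U"
  shows "vdim V U = vdim V {x \<in> carrier V. h x = \<zero>\<^bsub>W\<^esub>} + vdim W (h ` U)"
proof -
  let ?K = "{x \<in> carrier V. h x = \<zero>\<^bsub>W\<^esub>}"
  note KS = kernel_subspace[OF h]
  obtain ks ms where f: "frame V ?K ks ms" by (rule frame_exists[OF V KS])
  then have "dual_lists V ks ms" "set ks \<subseteq> U" using K by (auto simp: frame_def)
  then obtain us ls where f2: "frame V U (ks @ us) (ms @ ls)"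
    using frame_extend[OF V U] by blast
  have "frame W (h ` U) (map h us) (map (descend V h) ls)"
    by (rule frame_image[OF h surj f subspace_D(2)[OF U] f2])
  from frame_basis(3)[OF fdspace_image[OF V h surj] image_subspace[OF h U] this]
    frame_basis(3)[OF V U f2] frame_basis(3)[OF V KS f] show ?thesis by simp
qed

section \<open>Pluecker coordinates\<close>

text \<open>The minor that \<open>plucker\<close> assigns to a list of forms, for an explicit basis.\<close>

definition gram :: "('v \<Rightarrow> 'k::field) list \<Rightarrow> 'v list \<Rightarrow> 'k" where
  "gram fs us = det (mat (length us) (length us) (\<lambda>(a, b). (fs ! a) (us ! b)))"

lemma gram_cong:
  assumes "\<And>a b. a < length us \<Longrightarrow> b < length us \<Longrightarrow> (fs ! a) (us ! b) = (gs ! a) (vs ! b)"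
    and "length us = length vs"
  shows "gram fs us = gram gs vs"
  unfolding gram_def assms(2)[symmetric]
  using assms(1) by (intro arg_cong[of _ _ det] eq_matI) auto

text \<open>The transition matrix has entries \<open>(ls ! d) (vs ! b)\<close>, where \<open>ls\<close> is dual to \<open>us\<close>.\<close>

lemma gram_change_basis:
  assumes f: "frame V U us ls" and g: "frame V U vs ms"
    and fs: "length fs = length us" "\<And>l. l \<in> set fs \<Longrightarrow> linear_form V l"
  shows "gram fs vs = gram fs us * gram ls vs"
proof -
  define N where "N = length us"
  have len: "length vs = N" using frame_length[OF f g] by (simp add: N_def)
  define P where "P = mat N N (\<lambda>(a, d). (fs ! a) (us ! d))"
  define Q where "Q = mat N N (\<lambda>(d, b). (ls ! d) (vs ! b))"
  have P: "P \<in> carrier_mat N N" and Q: "Q \<in> carrier_mat N N" by (auto simp: P_def Q_def)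
  have "P * Q = mat N N (\<lambda>(a, b). (fs ! a) (vs ! b))"
  proof (rule eq_matI)
    fix a b assume "a < dim_row (mat N N (\<lambda>(a, b). (fs ! a) (vs ! b)))"
      "b < dim_col (mat N N (\<lambda>(a, b). (fs ! a) (vs ! b)))"
    then have ab: "a < N" "b < N" by auto
    have vb: "vs ! b \<in> U" using g ab len nth_mem[of b vs] by (auto simp: frame_def)
    have fa: "linear_form V (fs ! a)" using fs ab by (simp add: N_def)
    have "(P * Q) $$ (a, b) = (\<Sum>d<N. P $$ (a, d) * Q $$ (d, b))"
      using P Q ab by (simp add: times_mat_def scalar_prod_def lessThan_atLeast0)
    also have "\<dots> = (\<Sum>d<N. (ls ! d) (vs ! b) * (fs ! a) (us ! d))"
      using ab by (intro sum.cong) (auto simp: P_def Q_def)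
    also have "\<dots> = (fs ! a) (vs ! b)"
      using f vb fa unfolding frame_def N_def by metis
    finally show "(P * Q) $$ (a, b) = mat N N (\<lambda>(a, b). (fs ! a) (vs ! b)) $$ (a, b)"
      using ab by simp
  qed (auto simp: P_def Q_def)
  then show ?thesis using det_mult[OF P Q] by (simp add: gram_def len N_def[symmetric] P_def Q_def)
qed

lemma gram_dual:
  assumes "dual_lists V us ls"
  shows "gram ls us = 1"
proof -
  have "mat (length us) (length us) (\<lambda>(a, b). (ls ! a) (us ! b)) = 1\<^sub>m (length us)"
    by (rule eq_matI) (auto simp: dual_lists_eq[OF assms])
  then show ?thesis by (simp add: gram_def)
qed

text \<open>Whatever basis the definition of the coordinates chooses, any frame computes them up to a
  common nonzero factor.\<close>

lemma plucker_frame: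
  assumes V: "fdspace V" and U: "VectorSpace.subspace class_ring U V" and f: "frame V U us ls"
  obtains c where "c \<noteq> 0"
    "\<And>fs. plucker V U fs =
      (if length fs = length us \<and> (\<forall>l\<in>set fs. linear_form V l) then c * gram fs us else 0)"
proof -
  let ?P = "\<lambda>us. distinct us \<and> vectorspace.basis class_ring (V\<lparr>carrier := U\<rparr>) (set us)"
  define vs where "vs = (SOME us. ?P us)"
  have "?P us" using frame_basis[OF V U f] by blast
  then have vs: "?P vs" unfolding vs_def by (rule someI)
  then obtain ms where g: "frame V U vs ms" using basis_frame[OF V U] by blast
  have len: "length vs = length us" by (rule frame_length[OF g f])
  have d: "dual_lists V us ls" "dual_lists V vs ms" using f g by (auto simp: frame_def)
  have "gram ms us * gram ls vs = 1"
    using gram_change_basis[OF f g, of ms] gram_dual[OF d(2)] d(2) len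
    by (simp add: dual_lists_def)
  then have "gram ls vs \<noteq> 0" by auto
  moreover have "plucker V U fs =
      (if length fs = length us \<and> (\<forall>l\<in>set fs. linear_form V l) then gram ls vs * gram fs us else 0)" for fs
    unfolding plucker_def vs_def[symmetric] Let_def len
    using gram_change_basis[OF f g, of fs] len by (simp add: gram_def)
  ultimately show ?thesis by (rule that)
qed

lemma plucker_cong:
  assumes V: "fdspace V" and U: "VectorSpace.subspace class_ring U V"
    and len: "length fs = length gs" and eq: "\<And>a x. a < length fs \<Longrightarrow> x \<in> carrier V \<Longrightarrow> (fs ! a) x = (gs ! a) x"
  shows "plucker V U fs = plucker V U gs"
proof -
  obtain us ls where f: "frame V U us ls" by (rule frame_exists[OF V U])
  obtain c where c: "\<And>fs. plucker V U fs =
      (if length fs = length us \<and> (\<forall>l\<in>set fs. linear_form V l) then c * gram fs us else 0)"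
    using plucker_frame[OF V U f] by blast
  have "linear_form V (fs ! a) \<longleftrightarrow> linear_form V (gs ! a)" if "a < length fs" for a
    using eq[OF that] vs_closed[OF fdspace_vs[OF V]] unfolding linear_form_def by simp
  then have "(\<forall>l\<in>set fs. linear_form V l) \<longleftrightarrow> (\<forall>l\<in>set gs. linear_form V l)"
    using len by (simp add: all_set_conv_all_nth)
  moreover have "gram fs us = gram gs us" if "length fs = length us"
  proof (rule gram_cong)
    fix a b assume "a < length us" "b < length us"
    moreover have "us ! b \<in> carrier V" if "b < length us"
      using f that dual_lists_mem unfolding frame_def by blast
    ultimately show "(fs ! a) (us ! b) = (gs ! a) (us ! b)" using eq that by simp
  qed simp
  ultimately show ?thesis unfolding c using len by auto
qed

lemma plucker_length:
  assumes V: "fdspace V" and U: "VectorSpace.subspace class_ring U V"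
    and fs: "length fs \<noteq> vdim V U \<or> \<not> (\<forall>l\<in>set fs. linear_form V l)"
  shows "plucker V U fs = 0"
proof -
  obtain us ls where f: "frame V U us ls" by (rule frame_exists[OF V U])
  show ?thesis using plucker_frame[OF V U f] fs frame_basis(3)[OF V U f] by metis
qed

text \<open>A determinant is linear in each of its rows.\<close>

lemma plucker_row_sum:
  assumes l: "\<And>k. k \<in> I \<Longrightarrow> linear_form V (l k)" and I: "finite I"
  shows "plucker V U (xs @ (\<lambda>z. \<Sum>k\<in>I. \<gamma> k * l k z) # ys) =
    (\<Sum>k\<in>I. \<gamma> k * plucker V U (xs @ l k # ys))"
proof -
  define us where "us = (SOME us. distinct us \<and> vectorspace.basis class_ring (V\<lparr>carrier := U\<rparr>) (set us))"
  define m where "m = (\<lambda>z. \<Sum>k\<in>I. \<gamma> k * l k z)"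
  define ok where "ok \<longleftrightarrow> Suc (length xs + length ys) = length us \<and> (\<forall>l\<in>set xs \<union> set ys. linear_form V l)"
  let ?A = "\<lambda>f. mat (length us) (length us) (\<lambda>(a, b). ((xs @ f # ys) ! a) (us ! b))"
  have pl: "plucker V U (xs @ f # ys) = (if ok then det (?A f) else 0)" if "linear_form V f" for f
    unfolding plucker_def us_def[symmetric] Let_def using that by (auto simp: ok_def)
  have m: "linear_form V m" unfolding m_def using l by (intro linear_form_sum linear_form_scale)
  show ?thesis
  proof (cases ok)
    case True
    then have i: "length xs < length us" by (simp add: ok_def)
    have A: "?A f \<in> carrier_mat (length us) (length us)" for f by simp
    have cof: "cofactor (?A f) (length xs) j = cofactor (?A g) (length xs) j" if "j < length us" for f g j
      unfolding cofactor_def mat_delete_def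
      using that by (intro arg_cong[of _ _ "\<lambda>B. _ * det B"] eq_matI) (auto simp: nth_append)
    have det: "det (?A f) = (\<Sum>j<length us. f (us ! j) * cofactor (?A m) (length xs) j)" for f
      unfolding laplace_expansion_row[OF A i, of f]
      using i cof[of _ f m] by (intro sum.cong) auto
    have "det (?A m) = (\<Sum>j<length us. \<Sum>k\<in>I. \<gamma> k * (l k (us ! j) * cofactor (?A m) (length xs) j))"
      unfolding det[of m] by (simp add: m_def sum_distrib_right mult.assoc)
    also have "\<dots> = (\<Sum>k\<in>I. \<gamma> k * det (?A (l k)))"
      unfolding det[of "l _"] sum_distrib_left by (rule sum.swap)
    finally show ?thesis unfolding m_def[symmetric] using True l by (simp add: pl m cong: sum.cong)
  qed (use l in \<open>simp add: pl m m_def[symmetric] cong: sum.cong\<close>)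
qed

text \<open>The forms dual to the kernel complete the forms on the image to forms on the source; the Gram
  matrix is then block triangular.\<close>

lemma plucker_image:
  fixes V :: "('k::field, 'v) module" and W :: "('k, 'w) module"
  assumes V: "fdspace V" and h: "linear_map class_ring V W h" and surj: "h ` carrier V = carrier W"
    and U: "VectorSpace.subspace class_ring U V" and KU: "{x \<in> carrier V. h x = \<zero>\<^bsub>W\<^esub>} \<subseteq> U"
    and K: "frame V {x \<in> carrier V. h x = \<zero>\<^bsub>W\<^esub>} ks ms" and len: "length ks \<le> 1"
  obtains c where "c \<noteq> 0"
    "\<And>fs. (\<forall>l\<in>set fs. linear_form W l) \<Longrightarrow>
      plucker W (h ` U) fs = c * plucker V U (ms @ map (\<lambda>l. l \<circ> h) fs)"
proof -
  have d: "dual_lists V ks ms" "set ks \<subseteq> U" using K KU by (auto simp: frame_def)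
  then obtain us ls where f: "frame V U (ks @ us) (ms @ ls)"
    using frame_extend[OF V U] by blast
  have lms: "length ms = length ks" using d by (simp add: dual_lists_def)
  note W = fdspace_image[OF V h surj]
  note fW = frame_image[OF h surj K subspace_D(2)[OF U] f]
  obtain c where c: "c \<noteq> 0" "\<And>fs. plucker V U fs =
      (if length fs = length (ks @ us) \<and> (\<forall>l\<in>set fs. linear_form V l) then c * gram fs (ks @ us) else 0)"
    by (rule plucker_frame[OF V U f]) (rule that, blast+)
  obtain c' where c': "c' \<noteq> 0" "\<And>fs. plucker W (h ` U) fs =
      (if length fs = length (map h us) \<and> (\<forall>l\<in>set fs. linear_form W l) then c' * gram fs (map h us) else 0)"
    by (rule plucker_frame[OF W image_subspace[OF h U] fW]) (rule that, blast+)
  have forms: "\<forall>l\<in>set (ms @ map (\<lambda>l. l \<circ> h) fs). linear_form V l" if "\<forall>l\<in>set fs. linear_form W l" for fs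
    using that d linear_form_pullback[OF h] by (auto simp: dual_lists_def)
  have gram: "gram (ms @ map (\<lambda>l. l \<circ> h) fs) (ks @ us) = gram fs (map h us)"
    if fs: "length fs = length us" "\<forall>l\<in>set fs. linear_form W l" for fs
  proof (cases ks)
    case Nil
    then show ?thesis using lms fs by (intro gram_cong) auto
  next
    case (Cons k ks')
    then have ks: "ks = [k]" using len by simp
    obtain m where ms: "ms = [m]" using lms ks by (cases ms) auto
    have mk: "m k = 1" using dual_lists_eq[OF d(1), of 0 0] ks ms by simp
    have hk: "h k = \<zero>\<^bsub>W\<^esub>" using K ks by (auto simp: frame_def)
    let ?A = "mat (Suc (length us)) (Suc (length us))
      (\<lambda>(a, b). ((m # map (\<lambda>l. l \<circ> h) fs) ! a) ((k # us) ! b))"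
    have A: "?A \<in> carrier_mat (Suc (length us)) (Suc (length us))" by simp
    have "gram (ms @ map (\<lambda>l. l \<circ> h) fs) (ks @ us) = det ?A" by (simp add: gram_def ks ms)
    also have "\<dots> = (\<Sum>i<Suc (length us). ?A $$ (i, 0) * cofactor ?A i 0)"
      by (rule laplace_expansion_column[OF A]) simp
    also have "\<dots> = (\<Sum>i<Suc (length us). if i = 0 then cofactor ?A 0 0 else 0)"
    proof (rule sum.cong[OF refl])
      fix i assume i: "i \<in> {..<Suc (length us)}"
      show "?A $$ (i, 0) * cofactor ?A i 0 = (if i = 0 then cofactor ?A 0 0 else 0)"
      proof (cases i)
        case (Suc j)
        then have "linear_form W (fs ! j)" using i fs by simp
        then show ?thesis using Suc i fs hk linear_form_zero[OF linear_map_D(2)[OF h]] by simp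
      qed (simp add: mk)
    qed
    also have "\<dots> = cofactor ?A 0 0" by simp
    also have "\<dots> = gram fs (map h us)"
      unfolding cofactor_def gram_def mat_delete_def using fs
      by (auto intro!: arg_cong[of _ _ det] eq_matI)
    finally show ?thesis .
  qed
  show ?thesis
  proof (rule that[of "c' / c"])
    show "c' / c \<noteq> 0" using c c' by simp
    fix fs :: "('w \<Rightarrow> 'k) list" assume fs: "\<forall>l\<in>set fs. linear_form W l"
    show "plucker W (h ` U) fs = c' / c * plucker V U (ms @ map (\<lambda>l. l \<circ> h) fs)"
      unfolding c(2) c'(2) using fs forms[OF fs] gram[of fs] lms c(1) by auto
  qed
qed

text \<open>Conversely, if the kernel is a line spanned by \<open>k\<close>, expanding along the column of \<open>k\<close> expresses
  the coordinates of a preimage through those of the image.\<close>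

lemma plucker_preimage_line:
  fixes V :: "('k::field, 'v) module" and W :: "('k, 'w) module"
  assumes V: "fdspace V" and h: "linear_map class_ring V W h" and surj: "h ` carrier V = carrier W"
    and U: "VectorSpace.subspace class_ring U V" and KU: "{x \<in> carrier V. h x = \<zero>\<^bsub>W\<^esub>} \<subseteq> U"
    and K: "frame V {x \<in> carrier V. h x = \<zero>\<^bsub>W\<^esub>} [k] [m]"
  obtains c where "c \<noteq> 0"
    "\<And>fs. length fs = vdim V U \<Longrightarrow> \<forall>l\<in>set fs. linear_form V l \<Longrightarrow>
      plucker V U fs = c * (\<Sum>i<length fs. (- 1) ^ i * (fs ! i) k *
        plucker W (h ` U) (map (\<lambda>l. descend V h (\<lambda>x. l x - l k * m x)) (take i fs @ drop (Suc i) fs)))"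
proof -
  have d: "dual_lists V [k] [m]" "set [k] \<subseteq> U" using K KU by (auto simp: frame_def)
  then obtain us ls where f: "frame V U ([k] @ us) ([m] @ ls)"
    using frame_extend[OF V U] by blast
  note D = linear_map_D[OF h]
  note W = fdspace_image[OF V h surj]
  note fW = frame_image[OF h surj K subspace_D(2)[OF U] f]
  obtain c where c: "c \<noteq> 0" "\<And>fs. plucker V U fs =
      (if length fs = length ([k] @ us) \<and> (\<forall>l\<in>set fs. linear_form V l) then c * gram fs ([k] @ us) else 0)"
    by (rule plucker_frame[OF V U f]) (rule that, blast+)
  obtain c' where c': "c' \<noteq> 0" "\<And>fs. plucker W (h ` U) fs =
      (if length fs = length (map h us) \<and> (\<forall>l\<in>set fs. linear_form W l) then c' * gram fs (map h us) else 0)"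
    by (rule plucker_frame[OF W image_subspace[OF h U] fW]) (rule that, blast+)
  have m: "linear_form V m" using d by (simp add: dual_lists_def)
  have fd: "dual_lists V ([k] @ us) ([m] @ ls)" using f by (simp add: frame_def)
  have m_us: "m (us ! b) = 0" and usV: "us ! b \<in> carrier V" if "b < length us" for b
    using dual_lists_eq[OF fd, of 0 "Suc b"] dual_lists_mem[OF fd, of "Suc b"] that by auto
  define bar where "bar = (\<lambda>l. descend V h (\<lambda>x. l x - l k * m x))"
  have bar: "linear_form W (bar l)" "\<And>x. x \<in> carrier V \<Longrightarrow> bar l (h x) = l x - l k * m x"
    if l: "linear_form V l" for l
  proof -
    have 1: "linear_form V (\<lambda>x. l x - l k * m x)"
      using l m by (intro linear_form_diff linear_form_scale)
    have 2: "l x - l k * m x = 0" if "x \<in> carrier V" "h x = \<zero>\<^bsub>W\<^esub>" for x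
      using K l that by (simp add: frame_def mult.commute)
    show "linear_form W (bar l)" "\<And>x. x \<in> carrier V \<Longrightarrow> bar l (h x) = l x - l k * m x"
      unfolding bar_def using descend[OF h surj 1 2] by blast+
  qed
  show ?thesis
  proof (rule that[of "c / c'"])
    show "c / c' \<noteq> 0" using c c' by simp
    fix fs :: "('v \<Rightarrow> 'k) list"
    assume len: "length fs = vdim V U" and fs: "\<forall>l\<in>set fs. linear_form V l"
    have len': "length fs = Suc (length us)" using len frame_basis(3)[OF V U f] by simp
    let ?A = "mat (Suc (length us)) (Suc (length us)) (\<lambda>(a, b). (fs ! a) ((k # us) ! b))"
    have A: "?A \<in> carrier_mat (Suc (length us)) (Suc (length us))" by simp
    have cof: "(fs ! i) k * cofactor ?A i 0 =
        (- 1) ^ i * (fs ! i) k * (plucker W (h ` U) (map bar (take i fs @ drop (Suc i) fs)) / c')"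
      if i: "i < length fs" for i
    proof -
      let ?gs = "map bar (take i fs @ drop (Suc i) fs)"
      have gl: "length ?gs = length us" using i len' by simp
      have gf: "\<forall>l\<in>set ?gs. linear_form W l"
        using fs bar(1) by (auto dest: in_set_takeD in_set_dropD)
      have "mat_delete ?A i 0 = mat (length us) (length us) (\<lambda>(a, b). (?gs ! a) (map h us ! b))"
      proof (rule eq_matI)
        fix a b assume "a < dim_row (mat (length us) (length us) (\<lambda>(a, b). (?gs ! a) (map h us ! b)))"
          "b < dim_col (mat (length us) (length us) (\<lambda>(a, b). (?gs ! a) (map h us ! b)))"
        then have ab: "a < length us" "b < length us" by auto
        let ?a = "if a < i then a else Suc a"
        have a: "?a < length fs" using ab len' by auto
        have "?gs ! a = bar (fs ! ?a)" using ab i len' by (auto simp: nth_append min_def)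
        then have "(?gs ! a) (map h us ! b) = (fs ! ?a) (us ! b)"
          using bar(2)[of "fs ! ?a" "us ! b"] fs a ab usV m_us by simp
        then show "mat_delete ?A i 0 $$ (a, b) =
            mat (length us) (length us) (\<lambda>(a, b). (?gs ! a) (map h us ! b)) $$ (a, b)"
          using ab a len' by (simp add: mat_delete_def)
      qed (auto simp: mat_delete_def)
      then have "cofactor ?A i 0 = (- 1) ^ i * gram ?gs (map h us)"
        by (simp add: cofactor_def gram_def)
      also have "gram ?gs (map h us) = plucker W (h ` U) ?gs / c'"
        unfolding c'(2) using gl gf c'(1) by simp
      finally show ?thesis by simp
    qed
    have "plucker V U fs = c * det ?A" unfolding c(2) using len' fs by (simp add: gram_def)
    also have "det ?A = (\<Sum>i<Suc (length us). ?A $$ (i, 0) * cofactor ?A i 0)"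
      by (rule laplace_expansion_column[OF A]) simp
    also have "\<dots> = (\<Sum>i<length fs. (- 1) ^ i * (fs ! i) k *
        (plucker W (h ` U) (map bar (take i fs @ drop (Suc i) fs)) / c'))"
      unfolding len'[symmetric] using cof by (intro sum.cong) (auto simp: len')
    also have "c * \<dots> = c / c' * (\<Sum>i<length fs. (- 1) ^ i * (fs ! i) k *
        plucker W (h ` U) (map bar (take i fs @ drop (Suc i) fs)))"
      by (simp add: sum_divide_distrib[symmetric])
    finally show "plucker V U fs = c / c' * (\<Sum>i<length fs. (- 1) ^ i * (fs ! i) k *
        plucker W (h ` U) (map (\<lambda>l. descend V h (\<lambda>x. l x - l k * m x)) (take i fs @ drop (Suc i) fs)))"
      by (simp add: bar_def)
  qed
qed

section \<open>Morphisms given by multihomogeneous polynomials\<close>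

lemma mhpoly_cong: "mhpoly D P \<Longrightarrow> (\<And>i. D i = E i) \<Longrightarrow> (\<And>z. P z = Q z) \<Longrightarrow> mhpoly E Q"
proof -
  assume "mhpoly D P" "\<And>i. D i = E i" "\<And>z. P z = Q z"
  moreover from this have "D = E" "P = Q" by auto
  ultimately show ?thesis by simp
qed

lemma mhpoly_scale: "mhpoly D P \<Longrightarrow> mhpoly D (\<lambda>z. a * P z)"
  using mhpoly.mult[OF mhpoly.const[of a], of D P] by simp

lemma mhpoly_zero: "mhpoly D P \<Longrightarrow> mhpoly D (\<lambda>z :: 'j \<Rightarrow> 'c \<Rightarrow> 'k. 0 :: 'k)" for P :: "('j \<Rightarrow> 'c \<Rightarrow> 'k::field) \<Rightarrow> 'k"
  using mhpoly_scale[of D P 0] by simp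

lemma mhpoly_sum:
  fixes P :: "'i \<Rightarrow> ('j \<Rightarrow> 'c \<Rightarrow> 'k::field) \<Rightarrow> 'k" and R :: "('j \<Rightarrow> 'c \<Rightarrow> 'k) \<Rightarrow> 'k"
  assumes "\<And>k. k \<in> I \<Longrightarrow> mhpoly D (P k)" "mhpoly D R"
  shows "mhpoly D (\<lambda>z. \<Sum>k\<in>I. P k z)"
  using assms(1)
proof (induction I rule: infinite_finite_induct)
  case (insert x F)
  then show ?case using mhpoly.add[of D "P x" "\<lambda>z. \<Sum>k\<in>F. P k z"] by simp
qed (auto intro: mhpoly_zero[OF assms(2)])

lemma mhpoly_finite: "mhpoly D P \<Longrightarrow> finite {j. D j \<noteq> 0}"
proof (induction rule: mhpoly.induct)
  case (mult D P E Q)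
  have "{j. D j + E j \<noteq> 0} = {j. D j \<noteq> 0} \<union> {j. E j \<noteq> 0}" by auto
  then show ?case using mult by simp
qed auto

lemma mhpoly_homogeneous:
  assumes "mhpoly D P"
  shows "P (\<lambda>j c. s j * z j c) = (\<Prod>j | D j \<noteq> 0. s j ^ D j) * P z"
  using assms
proof (induction rule: mhpoly.induct)
  case (mult D P E Q)
  have fin: "finite {j. D j \<noteq> 0}" "finite {j. E j \<noteq> 0}"
    using mhpoly_finite mult.hyps by auto
  let ?A = "{j. D j \<noteq> 0} \<union> {j. E j \<noteq> 0}"
  have "(\<Prod>j | D j + E j \<noteq> 0. s j ^ (D j + E j)) = (\<Prod>j\<in>?A. s j ^ D j * s j ^ E j)"
    by (intro prod.cong) (auto simp: power_add)
  also have "\<dots> = (\<Prod>j\<in>?A. s j ^ D j) * (\<Prod>j\<in>?A. s j ^ E j)" by (rule prod.distrib)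
  also have "(\<Prod>j\<in>?A. s j ^ D j) = (\<Prod>j | D j \<noteq> 0. s j ^ D j)"
    using fin by (intro prod.mono_neutral_right) auto
  also have "(\<Prod>j\<in>?A. s j ^ E j) = (\<Prod>j | E j \<noteq> 0. s j ^ E j)"
    using fin by (intro prod.mono_neutral_right) auto
  finally show ?case using mult.IH by (simp add: ac_simps)
qed (auto simp: distrib_left)

lemma mhpoly_subst:
  assumes P: "mhpoly D P" and G: "\<And>j c. mhpoly (E j) (G j c)"
  shows "mhpoly (\<lambda>i. \<Sum>j | D j \<noteq> 0. D j * E j i) (\<lambda>z. P (\<lambda>j c. G j c z))"
  using P
proof (induction rule: mhpoly.induct)
  case (const a)
  show ?case using mhpoly.const[of a] by simp
next
  case (coord j c)
  have "{i. ((\<lambda>_. 0)(j := 1)) i \<noteq> (0::nat)} = {j}" by auto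
  then show ?case using G[of j c] by simp
next
  case (add D P Q)
  then show ?case by (intro mhpoly.add)
next
  case (mult D P D' Q)
  have fin: "finite {j. D j \<noteq> 0}" "finite {j. D' j \<noteq> 0}"
    using mhpoly_finite mult.hyps by auto
  let ?A = "{j. D j \<noteq> 0} \<union> {j. D' j \<noteq> 0}"
  have "(\<Sum>j | D j + D' j \<noteq> 0. (D j + D' j) * E j i) =
      (\<Sum>j | D j \<noteq> 0. D j * E j i) + (\<Sum>j | D' j \<noteq> 0. D' j * E j i)" for i
  proof -
    have "(\<Sum>j | D j + D' j \<noteq> 0. (D j + D' j) * E j i) = (\<Sum>j\<in>?A. D j * E j i + D' j * E j i)"
      by (intro sum.cong) (auto simp: algebra_simps)
    also have "\<dots> = (\<Sum>j\<in>?A. D j * E j i) + (\<Sum>j\<in>?A. D' j * E j i)" by (rule sum.distrib)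
    also have "(\<Sum>j\<in>?A. D j * E j i) = (\<Sum>j | D j \<noteq> 0. D j * E j i)"
      using fin by (intro sum.mono_neutral_right) auto
    also have "(\<Sum>j\<in>?A. D' j * E j i) = (\<Sum>j | D' j \<noteq> 0. D' j * E j i)"
      using fin by (intro sum.mono_neutral_right) auto
    finally show ?thesis .
  qed
  then show ?case using mhpoly.mult[OF mult.IH] by simp
qed

lemma topspace_zariski: "topspace (zariski X) = pts X"
proof (rule equalityI)
  have "zopen X (topspace (zariski X))" by (simp flip: openin_zariski)
  then show "topspace (zariski X) \<subseteq> pts X" unfolding zopen_def by blast
  have "zopen X (pts X)"
    unfolding zopen_def by (intro exI[of _ "{\<lambda>z. 1}"]) (auto intro: mhpoly.const)
  then show "pts X \<subseteq> topspace (zariski X)" by (simp add: openin_subset flip: openin_zariski)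
qed

text \<open>It suffices that each block of coordinates of \<open>f x\<close> is given by polynomials of one common
  multidegree in the coordinates of \<open>x\<close>, up to a nonzero factor.  That factor may depend on \<open>x\<close> in an
  arbitrary way, since only multihomogeneous expressions are ever evaluated.\<close>

lemma morphismI:
  fixes X :: "('a, 'j, 'c, 'k::field) variety" and Y :: "('b, 'l, 'd, 'k) variety"
  assumes f: "\<And>x. x \<in> pts X \<Longrightarrow> f x \<in> pts Y"
    and ex: "\<And>j. \<exists>E s. (\<forall>x\<in>pts X. s x \<noteq> 0) \<and>
      (\<forall>c. \<exists>G. mhpoly E G \<and> (\<forall>x\<in>pts X. hcoord Y (f x) j c = s x * G (hcoord X x)))"
  shows "morphism X Y f"
proof -
  have "\<forall>j. \<exists>E s G. (\<forall>x\<in>pts X. s x \<noteq> 0) \<and> (\<forall>c. mhpoly E (G c)) \<and>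
      (\<forall>c. \<forall>x\<in>pts X. hcoord Y (f x) j c = s x * G c (hcoord X x))"
    using ex by metis
  then obtain E s G where s: "\<And>j x. x \<in> pts X \<Longrightarrow> s j x \<noteq> 0" and G: "\<And>j c. mhpoly (E j) (G j c)"
    and eq: "\<And>j c x. x \<in> pts X \<Longrightarrow> hcoord Y (f x) j c = s j x * G j c (hcoord X x)"
    by metis
  define t where "t = (\<lambda>D :: 'l \<Rightarrow> nat. \<lambda>i. \<Sum>j | D j \<noteq> 0. D j * E j i)"
  define \<sigma> where "\<sigma> = (\<lambda>D x. \<Prod>j | D j \<noteq> 0. s j x ^ D j)"
  define pull where "pull = (\<lambda>P :: ('l \<Rightarrow> 'd \<Rightarrow> 'k) \<Rightarrow> 'k. \<lambda>z. P (\<lambda>j c. G j c z))"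
  have pull: "mhpoly (t D) (pull P)" if "mhpoly D P" for D P
    unfolding t_def pull_def by (rule mhpoly_subst[OF that G])
  have pull_eq: "P (hcoord Y (f x)) = \<sigma> D x * pull P (hcoord X x)"
    if "x \<in> pts X" "mhpoly D P" for x D P
  proof -
    have "hcoord Y (f x) = (\<lambda>j c. s j x * G j c (hcoord X x))"
      using eq[OF that(1)] by (intro ext)
    then show ?thesis
      using mhpoly_homogeneous[OF that(2), of "\<lambda>j. s j x"] by (simp add: \<sigma>_def pull_def)
  qed
  have \<sigma>: "\<sigma> D x \<noteq> 0" if "x \<in> pts X" "mhpoly D P" for x D and P :: "('l \<Rightarrow> 'd \<Rightarrow> 'k) \<Rightarrow> 'k"
    unfolding \<sigma>_def using s[OF that(1)] mhpoly_finite[OF that(2)] by simp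
  have open_pre: "openin (zariski X) {x \<in> pts X. f x \<in> S}" if "openin (zariski Y) S" for S
  proof -
    from that obtain F where F: "\<forall>P\<in>F. \<exists>D. mhpoly D P"
      "S = {y \<in> pts Y. \<exists>P\<in>F. P (hcoord Y y) \<noteq> 0}" unfolding openin_zariski zopen_def by blast
    have "{x \<in> pts X. f x \<in> S} = {x \<in> pts X. \<exists>Q\<in>pull ` F. Q (hcoord X x) \<noteq> 0}"
    proof -
      have "P (hcoord Y (f x)) \<noteq> 0 \<longleftrightarrow> pull P (hcoord X x) \<noteq> 0" if "x \<in> pts X" "P \<in> F" for x P
      proof -
        obtain D where D: "mhpoly D P" using F(1) \<open>P \<in> F\<close> by blast
        show ?thesis unfolding pull_eq[OF that(1) D] using \<sigma>[OF that(1) D] by simp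
      qed
      then show ?thesis using f unfolding F(2) by auto
    qed
    moreover have "\<forall>Q\<in>pull ` F. \<exists>D. mhpoly D Q" using F(1) pull by blast
    ultimately show ?thesis unfolding openin_zariski zopen_def by blast
  qed
  show ?thesis
    unfolding morphism_def
  proof (intro conjI allI impI)
    show "continuous_map (zariski X) (zariski Y) f"
      unfolding continuous_map_def topspace_zariski using f open_pre by auto
    fix S \<phi> assume S: "openin (zariski Y) S \<and> regular Y S \<phi>"
    show "regular X {x \<in> pts X. f x \<in> S} (\<phi> \<circ> f)"
      unfolding regular_def
    proof
      fix x assume "x \<in> {x \<in> pts X. f x \<in> S}"
      then have x: "x \<in> pts X" "f x \<in> S" by auto
      from S x(2) obtain T D P Q where T: "openin (zariski Y) T" "f x \<in> T" "T \<subseteq> S"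
        and PQ: "mhpoly D P" "mhpoly D Q"
        and \<phi>: "\<forall>y\<in>T. Q (hcoord Y y) \<noteq> 0 \<and> \<phi> y = P (hcoord Y y) / Q (hcoord Y y)"
        unfolding regular_def by blast
      have "pull Q (hcoord X y) \<noteq> 0 \<and> (\<phi> \<circ> f) y = pull P (hcoord X y) / pull Q (hcoord X y)"
        if "y \<in> {x \<in> pts X. f x \<in> T}" for y
      proof -
        have y: "y \<in> pts X" "f y \<in> T" using that by auto
        then show ?thesis
          using \<phi> pull_eq[OF y(1) PQ(1)] pull_eq[OF y(1) PQ(2)] \<sigma>[OF y(1) PQ(1)] by auto
      qed
      then show "\<exists>T D P Q. openin (zariski X) T \<and> x \<in> T \<and> T \<subseteq> {x \<in> pts X. f x \<in> S} \<and>
          mhpoly D P \<and> mhpoly D Q \<and>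
          (\<forall>y\<in>T. Q (hcoord X y) \<noteq> 0 \<and> (\<phi> \<circ> f) y = P (hcoord X y) / Q (hcoord X y))"
        using T x open_pre[OF T(1)] pull[OF PQ(1)] pull[OF PQ(2)]
        by (intro exI[of _ "{x \<in> pts X. f x \<in> T}"] exI[of _ "t D"] exI[of _ "pull P"] exI[of _ "pull Q"])
          auto
    qed
  qed
qed

section \<open>Lines, sums and intersections of subspaces\<close>

lemma vdim_0:
  fixes V :: "('k::field, 'v) module"
  assumes V: "fdspace V" and U: "VectorSpace.subspace class_ring U V"
  shows "vdim V U = 0 \<longleftrightarrow> U = {\<zero>\<^bsub>V\<^esub>}"
proof -
  obtain us ls where f: "frame V U us ls" by (rule frame_exists[OF V U])
  note l = frame_basis(3)[OF V U f]
  show ?thesis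
  proof
    assume "vdim V U = 0"
    then have "l x = 0" if "x \<in> U" "linear_form V l" for x l using f l that by (simp add: frame_def)
    then have "x = \<zero>\<^bsub>V\<^esub>" if "x \<in> U" for x
      using form_eqI[OF V, of x "\<zero>\<^bsub>V\<^esub>"] that subspace_D(2,3)[OF U]
        linear_form_zero[OF fdspace_vs[OF V]] by (metis subsetD)
    then show "U = {\<zero>\<^bsub>V\<^esub>}" using subspace_D(3)[OF U] by blast
  next
    assume U0: "U = {\<zero>\<^bsub>V\<^esub>}"
    have "us = []"
    proof (rule ccontr)
      assume "us \<noteq> []"
      then have 0: "0 < length us" by simp
      have d: "dual_lists V us ls" and sub: "set us \<subseteq> U" using f by (auto simp: frame_def)
      have "us ! 0 = \<zero>\<^bsub>V\<^esub>" using sub U0 0 nth_mem by blast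
      then show False
        using dual_lists_eq[OF d 0 0] linear_form_zero[OF fdspace_vs[OF V] dual_lists_form[OF d 0]] by simp
    qed
    then show "vdim V U = 0" using l by simp
  qed
qed

lemma line_frame:
  fixes V :: "('k::field, 'v) module"
  assumes V: "fdspace V" and U: "VectorSpace.subspace class_ring U V" and dim: "vdim V U = 1"
    and l: "linear_form V l" and u: "u \<in> U" "l u = 1"
  shows "frame V U [u] [l]"
proof (rule dual_lists_frame[OF V U])
  show "dual_lists V [u] [l]" using l u subspace_D(2)[OF U] by (auto simp: dual_lists_def)
qed (use dim u in auto)

lemma line_scalar:
  fixes V :: "('k::field, 'v) module"
  assumes V: "fdspace V" and U: "VectorSpace.subspace class_ring U V" and dim: "vdim V U = 1"
    and u: "u \<in> U" "u \<noteq> \<zero>\<^bsub>V\<^esub>" and x: "x \<in> U"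
  obtains c where "x = c \<odot>\<^bsub>V\<^esub> u"
proof -
  note vs = fdspace_vs[OF V]
  note UV = subspace_D(2)[OF U]
  have "u \<in> carrier V" "u \<notin> {\<zero>\<^bsub>V\<^esub>}" using u UV by auto
  then obtain l where l: "linear_form V l" "l u = 1"
    using separating_form[OF V zero_subspace[OF vs]] by metis
  have f: "frame V U [u] [l]" by (rule line_frame[OF V U dim l(1) u(1) l(2)])
  have "x = l x \<odot>\<^bsub>V\<^esub> u"
  proof (rule form_eqI[OF V])
    fix m assume m: "linear_form V m"
    show "m x = m (l x \<odot>\<^bsub>V\<^esub> u)"
      using f x m linear_form_smult[OF m, of u] u UV by (auto simp: frame_def)
  qed (use x u UV vs_closed(3)[OF vs] in auto)
  then show ?thesis by (rule that)
qed

lemma subspace_sum: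
  fixes V :: "('k::field, 'v) module"
  assumes S: "VectorSpace.subspace class_ring S V" and T: "VectorSpace.subspace class_ring T V"
  shows "VectorSpace.subspace class_ring {s \<oplus>\<^bsub>V\<^esub> t | s t. s \<in> S \<and> t \<in> T} V"
proof -
  interpret V: vectorspace class_ring V using subspace_D(1)[OF S] .
  have "{s \<oplus>\<^bsub>V\<^esub> t | s t. s \<in> S \<and> t \<in> T} = V.submodule_sum S T"
    unfolding V.submodule_sum_def by auto
  then show ?thesis using V.sum_is_subspace[OF S T] by simp
qed

lemma subspace_inter:
  fixes V :: "('k::field, 'v) module"
  assumes S: "VectorSpace.subspace class_ring S V" and T: "VectorSpace.subspace class_ring T V"
  shows "VectorSpace.subspace class_ring (S \<inter> T) V"
  using subspace_D[OF S] subspace_D[OF T] unfolding subspace_iff[OF subspace_D(1)[OF S]] by auto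

lemma subspace_of_subspace:
  fixes V :: "('k::field, 'v) module"
  assumes R: "VectorSpace.subspace class_ring R V"
  shows "VectorSpace.subspace class_ring U (V\<lparr>carrier := R\<rparr>) \<longleftrightarrow>
    VectorSpace.subspace class_ring U V \<and> U \<subseteq> R"
proof -
  interpret V: vectorspace class_ring V using subspace_D(1)[OF R] .
  show ?thesis
    using subspace_D(2)[OF R] unfolding subspace_iff[OF V.vectorspace_axioms]
      subspace_iff[OF V.subspace_is_vs[OF R]] by auto
qed

lemma diff_add_cancel_carrier:
  fixes V :: "('k::field, 'v) module"
  assumes vs: "vectorspace class_ring V" and "x \<in> carrier V" "y \<in> carrier V"
  shows "(x \<ominus>\<^bsub>V\<^esub> y) \<oplus>\<^bsub>V\<^esub> y = x"
proof -
  interpret V: vectorspace class_ring V by (rule vs)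
  show ?thesis using assms by (simp add: a_minus_def V.a_assoc V.l_neg)
qed

lemma add_minus_assoc:
  fixes V :: "('k::field, 'v) module"
  assumes vs: "vectorspace class_ring V" and "x \<in> carrier V" "y \<in> carrier V" "z \<in> carrier V"
  shows "x \<oplus>\<^bsub>V\<^esub> (y \<ominus>\<^bsub>V\<^esub> z) = (x \<oplus>\<^bsub>V\<^esub> y) \<ominus>\<^bsub>V\<^esub> z"
proof -
  interpret V: vectorspace class_ring V by (rule vs)
  show ?thesis using assms by (simp add: a_minus_def V.a_assoc)
qed

section \<open>Nilpotent representations of the oriented cycle\<close>

locale nilpotent_cyc =
  fixes n :: nat and M :: "('k::field, 'v) cyc_rep"
  assumes n: "n \<ge> 1" and nil: "nilpotent_rep n M"
begin

definition pr :: "nat \<Rightarrow> nat" where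
  "pr i = (i + n - 1) mod n"

lemma pr_less: "pr i < n"
  using n by (simp add: pr_def)

lemma Suc_pr: "i < n \<Longrightarrow> Suc (pr i) mod n = i"
  unfolding pr_def using n by (simp add: mod_Suc_eq)

lemma pr_Suc: "i < n \<Longrightarrow> pr (Suc i mod n) = i"
  unfolding pr_def using n by (cases "Suc i = n") auto

lemma less_n: "i mod n < n"
  using n by simp

lemma arr_linear: "i < n \<Longrightarrow> linear_map class_ring (vsp M i) (vsp M (Suc i mod n)) (arr M i)"
  using nil by (simp add: nilpotent_rep_def is_rep_def)

lemma fd: "i < n \<Longrightarrow> fdspace (vsp M i)"
  using nil by (intro fin_dim_fdspace) (auto simp: nilpotent_rep_def is_rep_def)

lemma vs: "i < n \<Longrightarrow> vectorspace class_ring (vsp M i)"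
  using fd fdspace_vs by blast

lemma path_linear:
  assumes i: "i < n"
  shows "linear_map class_ring (vsp M i) (vsp M ((i + m) mod n)) (path_map n M i m)"
proof (induction m)
  case 0
  show ?case using i vs[OF i] by (auto simp: linear_map_iff)
next
  case (Suc m)
  have "Suc ((i + m) mod n) mod n = (i + Suc m) mod n" by (simp add: mod_Suc_eq)
  then show ?case using linear_map_comp[OF Suc arr_linear[OF less_n]] by (simp add: comp_def)
qed

lemma path_closed: "i < n \<Longrightarrow> x \<in> carrier (vsp M i) \<Longrightarrow> (i + m) mod n = j \<Longrightarrow>
    path_map n M i m x \<in> carrier (vsp M j)"
  using linear_map_D(3)[OF path_linear] by blast

lemma path_zero: "i < n \<Longrightarrow> (i + m) mod n = j \<Longrightarrow> path_map n M i m \<zero>\<^bsub>vsp M i\<^esub> = \<zero>\<^bsub>vsp M j\<^esub>"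
  using linear_map_D(6)[OF path_linear] by blast

lemma path_add: "path_map n M i (m + k) x = path_map n M ((i + m) mod n) k (path_map n M i m x)"
  by (induction k) (simp_all add: mod_add_left_eq add.assoc)

lemma path_Suc_left:
  assumes "i < n"
  shows "path_map n M i (Suc m) x = path_map n M (Suc i mod n) m (arr M i x)"
  using path_add[of i 1 m x] assms by simp

text \<open>Nilpotency is assumed for the full turns around the cycle only, but all sufficiently long paths
  contain many full turns.\<close>

lemma path_nilpotent:
  obtains N where "\<And>i m x. i < n \<Longrightarrow> N \<le> m \<Longrightarrow> x \<in> carrier (vsp M i) \<Longrightarrow>
    path_map n M i m x = \<zero>\<^bsub>vsp M ((i + m) mod n)\<^esub>"
proof -
  have pow: "(path_map n M i n ^^ k) x = path_map n M i (k * n) x" if "i < n" for i k x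
  proof (induction k)
    case (Suc k)
    have "path_map n M i (Suc k * n) x = path_map n M ((i + k * n) mod n) n (path_map n M i (k * n) x)"
      using path_add[of i "k * n" n x] by (simp add: add.commute)
    then show ?case using Suc that by simp
  qed simp
  have "\<forall>i. \<exists>k. i < n \<longrightarrow> (\<forall>x\<in>carrier (vsp M i). (path_map n M i n ^^ k) x = \<zero>\<^bsub>vsp M i\<^esub>)"
    using nil by (auto simp: nilpotent_rep_def)
  then obtain k where k: "\<And>i x. i < n \<Longrightarrow> x \<in> carrier (vsp M i) \<Longrightarrow>
      path_map n M i (k i * n) x = \<zero>\<^bsub>vsp M i\<^esub>"
    using pow by metis
  show ?thesis
  proof (rule that[of "\<Sum>i<n. k i * n"])
    fix i m x assume i: "i < n" and m: "(\<Sum>i<n. k i * n) \<le> m" and x: "x \<in> carrier (vsp M i)"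
    have "k i * n \<le> (\<Sum>i<n. k i * n)" using i by (intro member_le_sum) auto
    then obtain d where d: "m = k i * n + d" using m le_Suc_ex le_trans by blast
    have "path_map n M i m x = path_map n M i d \<zero>\<^bsub>vsp M i\<^esub>"
      unfolding d path_add using k[OF i x] i by simp
    also have "\<dots> = \<zero>\<^bsub>vsp M ((i + m) mod n)\<^esub>"
    proof (rule path_zero[OF i])
      have "i + m = (i + d) + k i * n" by (simp add: d)
      then show "(i + d) mod n = (i + m) mod n" by (metis mod_mult_self1)
    qed
    finally show "path_map n M i m x = \<zero>\<^bsub>vsp M ((i + m) mod n)\<^esub>" .
  qed
qed

text \<open>A family that is covered by its own image under the arrows is covered by arbitrarily long paths,
  hence zero.\<close>

lemma nakayama:
  assumes sub: "\<And>i. i < n \<Longrightarrow> S i \<subseteq> carrier (vsp M i)"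
    and cov: "\<And>i. i < n \<Longrightarrow> S (Suc i mod n) \<subseteq> arr M i ` S i" and j: "j < n"
  shows "S j \<subseteq> {\<zero>\<^bsub>vsp M j\<^esub>}"
proof -
  obtain N where N: "\<And>i m x. i < n \<Longrightarrow> N \<le> m \<Longrightarrow> x \<in> carrier (vsp M i) \<Longrightarrow>
    path_map n M i m x = \<zero>\<^bsub>vsp M ((i + m) mod n)\<^esub>" using path_nilpotent by metis
  have "S ((j + m) mod n) \<subseteq> path_map n M j m ` S j" for m
  proof (induction m)
    case (Suc m)
    have "S ((j + Suc m) mod n) \<subseteq> arr M ((j + m) mod n) ` S ((j + m) mod n)"
      using cov[OF less_n[of "j + m"]] by (simp add: mod_Suc_eq)
    then show ?case using Suc by force
  qed (use j in auto)
  from this[of "N * n"] have "S j \<subseteq> path_map n M j (N * n) ` S j" using j by simp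
  moreover have "N \<le> N * n" using n by simp
  then have "path_map n M j (N * n) x = \<zero>\<^bsub>vsp M j\<^esub>" if "x \<in> S j" for x
    using N[OF j, of "N * n" x] that sub[OF j] j by auto
  ultimately show ?thesis by auto
qed

lemma submodule_D:
  assumes "U \<in> submodules n M" "i < n"
  shows "VectorSpace.subspace class_ring (U i) (vsp M i)"
    "x \<in> U i \<Longrightarrow> arr M i x \<in> U (Suc i mod n)" "U i \<subseteq> carrier (vsp M i)"
proof -
  show S: "VectorSpace.subspace class_ring (U i) (vsp M i)" using assms by (simp add: submodules_def)
  show "U i \<subseteq> carrier (vsp M i)" by (rule subspace_D(2)[OF S])
  show "x \<in> U i \<Longrightarrow> arr M i x \<in> U (Suc i mod n)"
    using assms unfolding submodules_def by blast
qed

lemma submodule_eqI: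
  assumes "U \<in> submodules n M" "T \<in> submodules n M" "\<And>i. i < n \<Longrightarrow> U i = T i"
  shows "U = T"
  using assms unfolding submodules_def by (intro extensionalityI[of U "{..<n}" T]) auto

lemma zero_submodule: "zero_sub n M \<in> submodules n M"
  unfolding submodules_def zero_sub_def
  using zero_subspace[OF vs] linear_map_D(6)[OF arr_linear] less_n by auto

lemma whole_submodule: "whole_sub n M \<in> submodules n M"
  unfolding submodules_def whole_sub_def
  using carrier_subspace[OF vs] linear_map_D(3)[OF arr_linear] less_n by auto

text \<open>For nilpotent representations this is the radical of the submodule \<open>R\<close>, as shown below.\<close>

definition shift :: "(nat \<Rightarrow> 'v set) \<Rightarrow> nat \<Rightarrow> 'v set" where
  "shift R = (\<lambda>i\<in>{..<n}. arr M (pr i) ` R (pr i))"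

lemma shift_Suc: "i < n \<Longrightarrow> shift R (Suc i mod n) = arr M i ` R i"
  using less_n by (simp add: shift_def pr_Suc)

lemma shift_le: "R \<in> submodules n M \<Longrightarrow> i < n \<Longrightarrow> shift R i \<subseteq> R i"
  using submodule_D(2)[of R "pr i"] pr_less Suc_pr by (auto simp: shift_def)

lemma shift_submodule:
  assumes R: "R \<in> submodules n M"
  shows "shift R \<in> submodules n M"
  unfolding submodules_def
proof (intro CollectI conjI allI impI)
  show "shift R \<in> extensional {..<n}" by (simp add: shift_def)
  fix i assume i: "i < n"
  show "VectorSpace.subspace class_ring (shift R i) (vsp M i)"
    using image_subspace[OF arr_linear[OF pr_less] submodule_D(1)[OF R pr_less], of i] i
    by (simp add: shift_def Suc_pr)
  show "arr M i ` shift R i \<subseteq> shift R (Suc i mod n)"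
    unfolding shift_Suc[OF i] using shift_le[OF R i] by blast
qed

text \<open>The image of a simple submodule under the arrows is a submodule of it, and a
  proper one by \<open>nakayama\<close>, hence zero.\<close>

lemma simple_killed:
  assumes S: "S \<in> simple_submodules n M" and i: "i < n" and x: "x \<in> S i"
  shows "arr M i x = \<zero>\<^bsub>vsp M (Suc i mod n)\<^esub>"
proof -
  have Sm: "S \<in> submodules n M" and ne: "S \<noteq> zero_sub n M"
    and simple: "\<And>T. T \<in> submodules n M \<Longrightarrow> sub_le n T S \<Longrightarrow> T = zero_sub n M \<or> T = S"
    using S by (auto simp: simple_submodules_def)
  have "shift S \<noteq> S"
  proof
    assume eq: "shift S = S"
    have "S j = zero_sub n M j" if j: "j < n" for j
    proof -
      have "S j \<subseteq> {\<zero>\<^bsub>vsp M j\<^esub>}"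
        using submodule_D(3)[OF Sm] shift_Suc[of _ S] unfolding eq by (intro nakayama j) auto
      then show ?thesis using subspace_D(3)[OF submodule_D(1)[OF Sm j]] j by (auto simp: zero_sub_def)
    qed
    then show False using ne submodule_eqI[OF Sm zero_submodule] by blast
  qed
  then have "shift S = zero_sub n M"
    using simple[OF shift_submodule[OF Sm]] shift_le[OF Sm] by (auto simp: sub_le_def)
  then have "arr M i ` S i = {\<zero>\<^bsub>vsp M (Suc i mod n)\<^esub>}"
    using shift_Suc[OF i, of S] less_n by (simp add: zero_sub_def)
  then show ?thesis using x by blast
qed

lemma soc_killed:
  assumes i: "i < n" and x: "x \<in> soc n M i"
  shows "x \<in> carrier (vsp M i)" "arr M i x = \<zero>\<^bsub>vsp M (Suc i mod n)\<^esub>"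
proof -
  interpret V: vectorspace class_ring "vsp M i" by (rule vs[OF i])
  let ?K = "{x \<in> carrier (vsp M i). arr M i x = \<zero>\<^bsub>vsp M (Suc i mod n)\<^esub>}"
  have "VectorSpace.subspace class_ring ?K (vsp M i)" by (rule kernel_subspace[OF arr_linear[OF i]])
  then have K: "submodule class_ring ?K (vsp M i)" by (simp add: VectorSpace.subspace_def)
  have "(\<Union>S\<in>simple_submodules n M. S i) \<subseteq> ?K"
    using simple_killed[OF _ i] submodule_D(3)[OF _ i] by (auto simp: simple_submodules_def)
  then have "soc n M i \<subseteq> ?K" using V.span_is_subset[OF _ K] i by (simp add: soc_def)
  then show "x \<in> carrier (vsp M i)" "arr M i x = \<zero>\<^bsub>vsp M (Suc i mod n)\<^esub>" using x by auto
qed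

text \<open>A submodule whose total dimension is 1 is simple, since a nonzero submodule of it contains a nonzero
  vector of the line.\<close>

lemma line_in_soc:
  assumes L: "L \<in> submodules n M" and i0: "i0 < n"
    and dim: "\<And>i. i < n \<Longrightarrow> vdim (vsp M i) (L i) = (if i = i0 then 1 else 0)"
  shows "L i0 \<subseteq> soc n M i0"
proof -
  interpret V: vectorspace class_ring "vsp M i0" by (rule vs[OF i0])
  have L0: "L i = {\<zero>\<^bsub>vsp M i\<^esub>}" if "i < n" "i \<noteq> i0" for i
    using dim[OF that(1)] vdim_0[OF fd submodule_D(1)[OF L]] that by simp
  have "L \<in> simple_submodules n M"
    unfolding simple_submodules_def
  proof (intro CollectI conjI ballI impI)
    show "L \<in> submodules n M" by (rule L)
    show "L \<noteq> zero_sub n M"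
      using dim[OF i0] vdim_0[OF fd[OF i0] submodule_D(1)[OF L i0]] i0 by (auto simp: zero_sub_def)
    fix T assume T: "T \<in> submodules n M" and le: "sub_le n T L"
    have T0: "T i = {\<zero>\<^bsub>vsp M i\<^esub>}" if "i < n" "i \<noteq> i0" for i
      using L0[OF that] le that(1) subspace_D(3)[OF submodule_D(1)[OF T that(1)]]
      by (auto simp: sub_le_def)
    show "T = zero_sub n M \<or> T = L"
    proof (cases "T i0 = {\<zero>\<^bsub>vsp M i0\<^esub>}")
      case True
      then have "T = zero_sub n M"
        using T0 by (intro submodule_eqI[OF T zero_submodule]) (auto simp: zero_sub_def)
      then show ?thesis ..
    next
      case False
      note TS = submodule_D(1)[OF T i0]
      obtain t where t: "t \<in> T i0" "t \<noteq> \<zero>\<^bsub>vsp M i0\<^esub>" using False subspace_D(3)[OF TS] by blast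
      have TL: "T i0 \<subseteq> L i0" using le i0 by (simp add: sub_le_def)
      have "x \<in> T i0" if x: "x \<in> L i0" for x
      proof -
        obtain c where "x = c \<odot>\<^bsub>vsp M i0\<^esub> t"
          using line_scalar[OF fd[OF i0] submodule_D(1)[OF L i0] _ _ t(2) x] dim[OF i0] t(1) TL by auto
        then show ?thesis using subspace_D(5)[OF TS t(1)] by simp
      qed
      then have "T i = L i" if "i < n" for i using TL T0 L0 that by (cases "i = i0") auto
      then show ?thesis using submodule_eqI[OF T L] by blast
    qed
  qed
  then have "L i0 \<subseteq> (\<Union>S\<in>simple_submodules n M. S i0)" by blast
  also have "\<dots> \<subseteq> soc n M i0"
  proof -
    have "(\<Union>S\<in>simple_submodules n M. S i0) \<subseteq> carrier (vsp M i0)"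
      using submodule_D(3)[OF _ i0] by (auto simp: simple_submodules_def)
    then show ?thesis using V.in_own_span i0 by (simp add: soc_def)
  qed
  finally show ?thesis .
qed


subsection \<open>The radical\<close>

lemma submodules_sub_rep:
  assumes R: "R \<in> submodules n M"
  shows "U \<in> submodules n (sub_rep M R) \<longleftrightarrow> U \<in> submodules n M \<and> (\<forall>i<n. U i \<subseteq> R i)"
  using subspace_of_subspace[OF submodule_D(1)[OF R]]
  unfolding submodules_def by (auto simp: sub_rep_def)

lemma whole_sub_rep:
  assumes R: "R \<in> submodules n M"
  shows "whole_sub n (sub_rep M R) = R"
proof
  show "whole_sub n (sub_rep M R) i = R i" for i
    using R by (auto simp: whole_sub_def sub_rep_def submodules_def extensional_def)
qed

text \<open>Otherwise maximality forces \<open>R = S + shift R\<close>, and iterating this equation gives \<open>R = S\<close> because long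
  paths vanish.\<close>

lemma maximal_contains_shift:
  assumes R: "R \<in> submodules n M" and S: "S \<in> maximal_submodules n (sub_rep M R)" and i: "i < n"
  shows "shift R i \<subseteq> S i"
proof -
  have Sm: "S \<in> submodules n M" and SR: "\<And>i. i < n \<Longrightarrow> S i \<subseteq> R i" and ne: "S \<noteq> R"
    and maxi: "\<And>T. T \<in> submodules n M \<Longrightarrow> (\<And>i. i < n \<Longrightarrow> T i \<subseteq> R i) \<Longrightarrow> sub_le n S T \<Longrightarrow> T = S \<or> T = R"
    using S submodules_sub_rep[OF R] whole_sub_rep[OF R] by (auto simp: maximal_submodules_def)
  note ShR = shift_submodule[OF R]
  define T where "T = (\<lambda>i\<in>{..<n}. {s \<oplus>\<^bsub>vsp M i\<^esub> t | s t. s \<in> S i \<and> t \<in> shift R i})"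
  have TI: "s \<oplus>\<^bsub>vsp M i\<^esub> t \<in> T i" if "i < n" "s \<in> S i" "t \<in> shift R i" for i s t
    using that unfolding T_def by auto
  have TE: "\<exists>s t. s \<in> S i \<and> t \<in> shift R i \<and> x = s \<oplus>\<^bsub>vsp M i\<^esub> t" if "i < n" "x \<in> T i" for i x
    using that unfolding T_def by auto
  have Tm: "T \<in> submodules n M"
    unfolding submodules_def
  proof (intro CollectI conjI allI impI)
    show "T \<in> extensional {..<n}" by (simp add: T_def)
    fix i assume i: "i < n"
    show "VectorSpace.subspace class_ring (T i) (vsp M i)"
      using subspace_sum[OF submodule_D(1)[OF Sm i] submodule_D(1)[OF ShR i]] i by (simp add: T_def)
    show "arr M i ` T i \<subseteq> T (Suc i mod n)"
    proof
      fix y assume "y \<in> arr M i ` T i"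
      then obtain s t where st: "s \<in> S i" "t \<in> shift R i" "y = arr M i (s \<oplus>\<^bsub>vsp M i\<^esub> t)"
        using TE[OF i] by blast
      then have "y = arr M i s \<oplus>\<^bsub>vsp M (Suc i mod n)\<^esub> arr M i t"
        using linear_map_D(4)[OF arr_linear[OF i]] submodule_D(3)[OF Sm i] submodule_D(3)[OF ShR i] by blast
      then show "y \<in> T (Suc i mod n)"
        using TI[OF less_n] submodule_D(2)[OF Sm i st(1)] submodule_D(2)[OF ShR i st(2)] by simp
    qed
  qed
  have TR: "T i \<subseteq> R i" if i: "i < n" for i
  proof
    fix x assume "x \<in> T i"
    then obtain s t where "s \<in> S i" "t \<in> shift R i" "x = s \<oplus>\<^bsub>vsp M i\<^esub> t" using TE[OF i] by blast
    then show "x \<in> R i"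
      using subspace_D(4)[OF submodule_D(1)[OF R i]] SR[OF i] shift_le[OF R i] by blast
  qed
  have zero: "\<zero>\<^bsub>vsp M i\<^esub> \<in> S i" "\<zero>\<^bsub>vsp M i\<^esub> \<in> shift R i" if "i < n" for i
    using subspace_D(3) submodule_D(1) Sm ShR that by blast+
  have ST: "S i \<subseteq> T i" "shift R i \<subseteq> T i" if i: "i < n" for i
  proof -
    interpret V: vectorspace class_ring "vsp M i" by (rule vs[OF i])
    show "S i \<subseteq> T i"
    proof
      fix x assume x: "x \<in> S i"
      then have "x \<oplus>\<^bsub>vsp M i\<^esub> \<zero>\<^bsub>vsp M i\<^esub> = x" using submodule_D(3)[OF Sm i] by auto
      then show "x \<in> T i" using TI[OF i x zero(2)[OF i]] by simp
    qed
    show "shift R i \<subseteq> T i"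
    proof
      fix x assume x: "x \<in> shift R i"
      then have "\<zero>\<^bsub>vsp M i\<^esub> \<oplus>\<^bsub>vsp M i\<^esub> x = x" using submodule_D(3)[OF ShR i] by auto
      then show "x \<in> T i" using TI[OF i zero(1)[OF i] x] by simp
    qed
  qed
  have "T \<noteq> R"
  proof
    assume TR_eq: "T = R"
    obtain N where N: "\<And>i m x. i < n \<Longrightarrow> N \<le> m \<Longrightarrow> x \<in> carrier (vsp M i) \<Longrightarrow>
      path_map n M i m x = \<zero>\<^bsub>vsp M ((i + m) mod n)\<^esub>" using path_nilpotent by metis
    \<comment> \<open>Modulo \<open>S\<close>, every element of \<open>R\<close> is the end of an arbitrarily long path.\<close>
    have long: "\<exists>y\<in>R j. x \<ominus>\<^bsub>vsp M ((j + m) mod n)\<^esub> path_map n M j m y \<in> S ((j + m) mod n)"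
      if j: "j < n" and "x \<in> R ((j + m) mod n)" for j m x
      using that(2)
    proof (induction m arbitrary: x)
      case 0
      interpret V: vectorspace class_ring "vsp M j" by (rule vs[OF j])
      have "x \<ominus>\<^bsub>vsp M j\<^esub> x = \<zero>\<^bsub>vsp M j\<^esub>"
        using 0 j submodule_D(3)[OF R j] V.r_neg by (auto simp: a_minus_def)
      then show ?case using 0 j zero(1) by (intro bexI[of _ x]) auto
    next
      case (Suc m)
      let ?k = "(j + m) mod n" and ?l = "(j + Suc m) mod n"
      have kl: "Suc ?k mod n = ?l" by (simp add: mod_Suc_eq)
      have k: "?k < n" and l: "?l < n" using less_n by blast+
      interpret V: vectorspace class_ring "vsp M ?l" by (rule vs[OF l])
      obtain s t where st: "s \<in> S ?l" "t \<in> shift R ?l" "x = s \<oplus>\<^bsub>vsp M ?l\<^esub> t"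
        using TE[OF l, of x] Suc.prems TR_eq by auto
      obtain x' where x': "x' \<in> R ?k" "t = arr M ?k x'" using st(2) shift_Suc[OF k, of R] kl by auto
      obtain y where y: "y \<in> R j" "x' \<ominus>\<^bsub>vsp M ?k\<^esub> path_map n M j m y \<in> S ?k"
        using Suc.IH[OF x'(1)] by blast
      let ?p = "path_map n M j m y"
      have x'V: "x' \<in> carrier (vsp M ?k)" using x'(1) submodule_D(3)[OF R k] by blast
      have pV: "?p \<in> carrier (vsp M ?k)"
        using path_closed[OF j _ refl] y(1) submodule_D(3)[OF R j] by blast
      note D = linear_map_D[OF arr_linear[OF k], unfolded kl]
      have "t \<ominus>\<^bsub>vsp M ?l\<^esub> arr M ?k ?p \<in> S ?l"
        using submodule_D(2)[OF Sm k y(2)] D(7)[OF x'V pV] x'(2) kl by simp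
      then have "s \<oplus>\<^bsub>vsp M ?l\<^esub> (t \<ominus>\<^bsub>vsp M ?l\<^esub> arr M ?k ?p) \<in> S ?l"
        using subspace_D(4)[OF submodule_D(1)[OF Sm l] st(1)] by blast
      moreover have "s \<oplus>\<^bsub>vsp M ?l\<^esub> (t \<ominus>\<^bsub>vsp M ?l\<^esub> arr M ?k ?p) = x \<ominus>\<^bsub>vsp M ?l\<^esub> arr M ?k ?p"
        unfolding st(3) using st(1) submodule_D(3)[OF Sm l] D(3)[OF x'V] D(3)[OF pV] x'(2)
        by (intro add_minus_assoc[OF vs[OF l]]) (auto simp: kl)
      ultimately show ?case using y(1) by (intro bexI[of _ y]) simp_all
    qed
    have "R i = S i" if i: "i < n" for i
    proof -
      have "x \<in> S i" if x: "x \<in> R i" for x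
      proof -
        have iN: "(i + N * n) mod n = i" using i by simp
        obtain y where y: "y \<in> R i" "x \<ominus>\<^bsub>vsp M i\<^esub> path_map n M i (N * n) y \<in> S i"
          using long[OF i, of x "N * n"] x iN by auto
        have "path_map n M i (N * n) y = \<zero>\<^bsub>vsp M i\<^esub>"
          using N[OF i, of "N * n" y] y(1) submodule_D(3)[OF R i] n iN by auto
        then show ?thesis using y(2) vs_minus_zero[OF vs[OF i], of x] x submodule_D(3)[OF R i] by auto
      qed
      then show ?thesis using SR[OF i] by blast
    qed
    then show False using ne submodule_eqI[OF R Sm] by blast
  qed
  then have "T = S" using maxi[OF Tm TR] ST(1) by (auto simp: sub_le_def)
  then show ?thesis using ST(2)[OF i] by simp
qed

text \<open>A hyperplane that contains the image of the arrows at one vertex, taken together with everything at the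
  other vertices, is a maximal submodule; such hyperplanes cut out exactly that image.\<close>

lemma rad_eq_shift:
  assumes R: "R \<in> submodules n M"
  shows "rad n (sub_rep M R) = shift R"
proof
  fix i
  show "rad n (sub_rep M R) i = shift R i"
  proof (cases "i < n")
    case i: True
    note ShR = shift_submodule[OF R]
    show ?thesis
    proof (intro equalityI subsetI)
      fix x assume "x \<in> shift R i"
      then show "x \<in> rad n (sub_rep M R) i"
        using maximal_contains_shift[OF R _ i] shift_le[OF R i] i by (auto simp: rad_def sub_rep_def)
    next
      fix x assume x: "x \<in> rad n (sub_rep M R) i"
      have xR: "x \<in> R i" using x i by (simp add: rad_def sub_rep_def)
      have in_max: "x \<in> S i" if "S \<in> maximal_submodules n (sub_rep M R)" for S
        using x i that by (simp add: rad_def)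
      show "x \<in> shift R i"
      proof (rule ccontr)
        assume no: "x \<notin> shift R i"
        note RV = submodule_D(3)[OF R i]
        obtain l where l: "linear_form (vsp M i) l" "\<And>u. u \<in> shift R i \<Longrightarrow> l u = 0" "l x = 1"
          using separating_form[OF fd[OF i] submodule_D(1)[OF ShR i] _ no] xR RV by auto
        define S where "S = (\<lambda>j\<in>{..<n}. if j = i then {y \<in> R i. l y = 0} else R j)"
        have S_j: "S j = R j" if "j < n" "j \<noteq> i" for j
          using i that by (auto simp: S_def)
        have S_i: "S i = {y \<in> R i. l y = 0}" using i by (simp add: S_def)
        have SR: "S j \<subseteq> R j" if "j < n" for j using that by (auto simp: S_def)
        have ShS: "shift R j \<subseteq> S j" if "j < n" for j
          using that l(2) shift_le[OF R that] by (auto simp: S_def)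
        note RS = subspace_D[OF submodule_D(1)[OF R i]]
        have Sm: "S \<in> submodules n M"
          unfolding submodules_def
        proof (intro CollectI conjI allI impI)
          show "S \<in> extensional {..<n}" by (simp add: S_def)
          fix j assume j: "j < n"
          show "VectorSpace.subspace class_ring (S j) (vsp M j)"
          proof (cases "j = i")
            case True
            have "l (a \<oplus>\<^bsub>vsp M i\<^esub> b) = l a + l b" if "a \<in> R i" "b \<in> R i" for a b
              using linear_form_add[OF l(1)] that RV by blast
            moreover have "l (c \<odot>\<^bsub>vsp M i\<^esub> a) = c * l a" if "a \<in> R i" for a c
              using linear_form_smult[OF l(1)] that RV by blast
            ultimately show ?thesis
              unfolding True S_i subspace_iff[OF vs[OF i]]
              using RS linear_form_zero[OF vs[OF i] l(1)] by auto
          qed (use S_j j submodule_D(1)[OF R j] in simp)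
          show "arr M j ` S j \<subseteq> S (Suc j mod n)"
            using SR[OF j] shift_Suc[OF j, of R] ShS[OF less_n[of "Suc j"]] by blast
        qed
        have "S \<in> maximal_submodules n (sub_rep M R)"
          unfolding maximal_submodules_def whole_sub_rep[OF R] submodules_sub_rep[OF R]
        proof (intro CollectI conjI ballI impI allI)
          show "S \<in> submodules n M" by (rule Sm)
          show "\<And>j. j < n \<Longrightarrow> S j \<subseteq> R j" by (rule SR)
          have "x \<notin> S i" using S_i l(3) by simp
          then show "S \<noteq> R" using xR by blast
          fix T assume "T \<in> submodules n (sub_rep M R)" and le: "sub_le n S T"
          then have T: "T \<in> submodules n M" and TR: "\<And>j. j < n \<Longrightarrow> T j \<subseteq> R j"
            using submodules_sub_rep[OF R] by auto
          have ST: "S j \<subseteq> T j" if "j < n" for j using le that by (simp add: sub_le_def)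
          have Tj: "T j = R j" if "j < n" "j \<noteq> i" for j
            using ST[OF that(1)] TR[OF that(1)] S_j[OF that] by auto
          show "T = S \<or> T = R"
          proof (cases "\<forall>t\<in>T i. l t = 0")
            case True
            then have "T i = S i" using TR[OF i] ST[OF i] S_i by auto
            then have "T j = S j" if "j < n" for j using Tj S_j that by (cases "j = i") auto
            then show ?thesis using submodule_eqI[OF T Sm] by blast
          next
            case False
            then obtain t where t: "t \<in> T i" "l t \<noteq> 0" by blast
            note TS = subspace_D[OF submodule_D(1)[OF T i]]
            have "y \<in> T i" if y: "y \<in> R i" for y
            proof -
              let ?c = "(l y / l t) \<odot>\<^bsub>vsp M i\<^esub> t"
              have yV: "y \<in> carrier (vsp M i)" and tV: "t \<in> carrier (vsp M i)"
                using y RV t(1) TS(2) by auto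
              have cT: "?c \<in> T i" by (rule TS(5)[OF t(1)])
              then have cV: "?c \<in> carrier (vsp M i)" using TS(2) by blast
              have "l (y \<ominus>\<^bsub>vsp M i\<^esub> ?c) = 0"
                using linear_form_minus[OF vs[OF i] l(1) yV cV] linear_form_smult[OF l(1) tV] t(2) by simp
              moreover have "y \<ominus>\<^bsub>vsp M i\<^esub> ?c \<in> R i"
                using subspace_minus[OF submodule_D(1)[OF R i] y] cT TR[OF i] by blast
              ultimately have "y \<ominus>\<^bsub>vsp M i\<^esub> ?c \<in> T i" using S_i ST[OF i] by blast
              then have "(y \<ominus>\<^bsub>vsp M i\<^esub> ?c) \<oplus>\<^bsub>vsp M i\<^esub> ?c \<in> T i" using TS(4) cT by blast
              then show ?thesis using diff_add_cancel_carrier[OF vs[OF i] yV cV] by simp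
            qed
            then have "T j = R j" if "j < n" for j using Tj TR that by (cases "j = i") auto
            then show ?thesis using submodule_eqI[OF T R] by blast
          qed
        qed
        then have "x \<in> S i" by (rule in_max)
        then show False using S_i l(3) by simp
      qed
    qed
  qed (simp add: rad_def shift_def)
qed

lemma radpow_submodule: "radpow n M m \<in> submodules n M"
  by (induction m) (simp_all add: whole_submodule rad_eq_shift shift_submodule)

lemma radpow_Suc: "radpow n M (Suc m) = shift (radpow n M m)"
  by (simp add: rad_eq_shift[OF radpow_submodule])

text \<open>Since an index modulo \<open>n\<close> determines the starting vertex of a path of length \<open>m\<close> from its end, the
  iterated radical at one vertex is the image of a single path.\<close>

lemma radpow_path:
  assumes j: "j < n"
  shows "radpow n M m ((j + m) mod n) = path_map n M j m ` carrier (vsp M j)"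
proof (induction m)
  case 0
  show ?case using j by (simp add: whole_sub_def)
next
  case (Suc m)
  have "radpow n M (Suc m) ((j + Suc m) mod n) = arr M ((j + m) mod n) ` radpow n M m ((j + m) mod n)"
    using shift_Suc[OF less_n[of "j + m"], of "radpow n M m"] radpow_Suc[of m] by (simp add: mod_Suc_eq)
  then show ?case using Suc by (auto simp: image_image)
qed

lemma index_back: "i < n \<Longrightarrow> ((i + m * (n - 1)) mod n + m) mod n = i"
proof -
  assume i: "i < n"
  have "i + m * (n - 1) + m = i + m * n" using n by (cases n) auto
  then have "(i + m * (n - 1) + m) mod n = i" using i by (metis mod_less mod_mult_self1)
  then show ?thesis by (simp only: mod_add_left_eq)
qed

lemma radpow_eventually_zero:
  obtains m where "\<And>i. i < n \<Longrightarrow> radpow n M m i = {\<zero>\<^bsub>vsp M i\<^esub>}"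
proof -
  obtain N where N: "\<And>i m x. i < n \<Longrightarrow> N \<le> m \<Longrightarrow> x \<in> carrier (vsp M i) \<Longrightarrow>
    path_map n M i m x = \<zero>\<^bsub>vsp M ((i + m) mod n)\<^esub>" using path_nilpotent by metis
  have "radpow n M N i = {\<zero>\<^bsub>vsp M i\<^esub>}" if i: "i < n" for i
  proof -
    let ?j = "(i + N * (n - 1)) mod n"
    have j: "?j < n" "(?j + N) mod n = i" using less_n index_back[OF i] by blast+
    then have "radpow n M N i \<subseteq> {\<zero>\<^bsub>vsp M i\<^esub>}" using radpow_path[OF j(1), of N] N[OF j(1), of N] by auto
    then show ?thesis using subspace_D(3)[OF submodule_D(1)[OF radpow_submodule i]] by blast
  qed
  then show ?thesis by (rule that)
qed


subsection \<open>Endomorphisms through uniserial modules\<close>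

definition endo :: "(nat \<Rightarrow> 'v \<Rightarrow> 'v) \<Rightarrow> bool" where
  "endo \<psi> \<longleftrightarrow> (\<forall>i<n. linear_map class_ring (vsp M i) (vsp M i) (\<psi> i)) \<and>
     (\<forall>i<n. \<forall>z\<in>carrier (vsp M i). \<psi> (Suc i mod n) (arr M i z) = arr M i (\<psi> i z))"

text \<open>The element \<open>y\<close> is corrected by multiples of the elements to which the paths of positive length send \<open>x\<close>.
  Taking \<open>a = m - 1, m - 2, \<dots>\<close> in turn, the correction for \<open>a\<close> does not disturb the vanishing already
  achieved, because \<open>path_map n M j m x\<close> is killed by the next arrow; and it does not change the end of \<open>y\<close>.\<close>

lemma adapted_lift:
  assumes j: "j < n" and i: "(j + m) mod n = i" and l: "linear_form (vsp M i) l"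
    and x: "x \<in> carrier (vsp M j)" and lx: "l (path_map n M j m x) = 1"
    and kx: "arr M i (path_map n M j m x) = \<zero>\<^bsub>vsp M (Suc i mod n)\<^esub>"
    and y: "y \<in> carrier (vsp M j)" and ly: "l (path_map n M j m y) = 0"
  obtains y' where "y' \<in> carrier (vsp M j)" "path_map n M j m y' = path_map n M j m y"
    "\<And>a. a \<le> m \<Longrightarrow> (j + a) mod n = i \<Longrightarrow> l (path_map n M j a y') = 0"
proof -
  have i_less: "i < n" using i less_n by blast
  have beyond: "path_map n M j (m + d) x = \<zero>\<^bsub>vsp M ((j + (m + d)) mod n)\<^esub>" if d: "d > 0" for d
  proof -
    obtain d' where d': "d = Suc d'" using d by (cases d) auto
    have "path_map n M j (m + d) x = path_map n M (Suc i mod n) d' (arr M i (path_map n M j m x))"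
      unfolding path_add i d' by (rule path_Suc_left[OF i_less])
    also have "\<dots> = \<zero>\<^bsub>vsp M ((j + (m + d)) mod n)\<^esub>"
      unfolding kx
    proof (rule path_zero[OF less_n])
      show "(Suc i mod n + d') mod n = (j + (m + d)) mod n"
        unfolding i[symmetric] d' by (simp add: mod_simps add.assoc)
    qed
    finally show ?thesis .
  qed
  have "\<exists>y'\<in>carrier (vsp M j). path_map n M j m y' = path_map n M j m y \<and>
      (\<forall>a. k \<le> a \<and> a \<le> m \<and> (j + a) mod n = i \<longrightarrow> l (path_map n M j a y') = 0)" if "k \<le> Suc m" for k
    using that
  proof (induction rule: inc_induct)
    case base
    show ?case using y by (intro bexI[of _ y]) auto
  next
    case (step k)
    then obtain z where z: "z \<in> carrier (vsp M j)" "path_map n M j m z = path_map n M j m y"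
      and lz: "\<And>a. Suc k \<le> a \<Longrightarrow> a \<le> m \<Longrightarrow> (j + a) mod n = i \<Longrightarrow> l (path_map n M j a z) = 0" by blast
    consider "(j + k) mod n \<noteq> i \<or> k = m" | "(j + k) mod n = i" "k < m" using step.hyps by linarith
    then show ?case
    proof cases
      case 1
      have "l (path_map n M j a z) = 0" if "k \<le> a" "a \<le> m" "(j + a) mod n = i" for a
      proof (cases "a = k")
        case True
        then have "a = m" using 1 that by simp
        then show ?thesis using ly z(2) by simp
      qed (use lz that in auto)
      then show ?thesis using z by (intro bexI[of _ z]) auto
    next
      case 2
      define e where "e = m - k"
      have e: "e > 0" "m = k + e" using 2 by (auto simp: e_def)
      have je: "(j + e) mod n = j"
      proof -
        have "(j + k + e) mod n = (j + k) mod n" using 2 i e by (simp add: add.assoc)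
        then have "n dvd e" using mod_eq_dvd_iff_nat[of "j + k" "j + k + e" n] by simp
        then have "e mod n = 0" by simp
        then show ?thesis using j by (simp add: mod_add_right_eq[symmetric])
      qed
      define c where "c = l (path_map n M j k z)"
      define p where "p = path_map n M j e x"
      have p: "p \<in> carrier (vsp M j)" unfolding p_def by (rule path_closed[OF j x je])
      have pp: "path_map n M j a p = path_map n M j (e + a) x" for a
        unfolding p_def path_add je ..
      have cp: "c \<odot>\<^bsub>vsp M j\<^esub> p \<in> carrier (vsp M j)" by (rule vs_closed(3)[OF vs[OF j] p])
      define z' where "z' = z \<ominus>\<^bsub>vsp M j\<^esub> c \<odot>\<^bsub>vsp M j\<^esub> p"
      have path_z': "path_map n M j a z' = path_map n M j a z \<ominus>\<^bsub>vsp M ((j + a) mod n)\<^esub>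
          c \<odot>\<^bsub>vsp M ((j + a) mod n)\<^esub> path_map n M j (e + a) x" for a
        unfolding z'_def linear_map_D(7)[OF path_linear[OF j] z(1) cp]
          linear_map_D(5)[OF path_linear[OF j] p] pp ..
      have l_z': "l (path_map n M j a z') = l (path_map n M j a z) - c * l (path_map n M j (e + a) x)"
        if a: "(j + a) mod n = i" for a
      proof -
        have 1: "path_map n M j a z \<in> carrier (vsp M i)" by (rule path_closed[OF j z(1) a])
        have 2: "path_map n M j (e + a) x \<in> carrier (vsp M i)"
          unfolding pp[symmetric] by (rule path_closed[OF j p a])
        show ?thesis
          unfolding path_z' a
          using linear_form_minus[OF vs[OF i_less] l 1 vs_closed(3)[OF vs[OF i_less] 2]]
            linear_form_smult[OF l 2] by simp
      qed
      have tail: "path_map n M j (e + a) x = \<zero>\<^bsub>vsp M ((j + a) mod n)\<^esub>" if "k < a" for a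
      proof -
        have "e + a = m + (a - k)" using that e by simp
        moreover have "(j + (e + a)) mod n = (j + a) mod n"
          using je by (metis add.assoc mod_add_left_eq)
        ultimately show ?thesis using beyond[of "a - k"] that by simp
      qed
      have "path_map n M j m z' = path_map n M j m y"
      proof -
        interpret V: vectorspace class_ring "vsp M i" by (rule vs[OF i_less])
        have zm: "path_map n M j m z \<in> carrier (vsp M i)" by (rule path_closed[OF j z(1) i])
        have "path_map n M j (e + m) x = \<zero>\<^bsub>vsp M i\<^esub>" using tail[of m] 2 i by simp
        then have "path_map n M j m z' = path_map n M j m z \<ominus>\<^bsub>vsp M i\<^esub> \<zero>\<^bsub>vsp M i\<^esub>"
          unfolding path_z' i using V.smult_r_null[of c] by simp
        then show ?thesis using vs_minus_zero[OF vs[OF i_less] zm] z(2) by simp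
      qed
      moreover have "l (path_map n M j a z') = 0" if a: "k \<le> a" "a \<le> m" "(j + a) mod n = i" for a
      proof (cases "a = k")
        case True
        then show ?thesis
          using l_z'[OF a(3)] lx e(2) by (simp add: c_def add.commute)
      next
        case False
        then show ?thesis
          using l_z'[OF a(3)] lz[of a] tail[of a] a linear_form_zero[OF vs[OF i_less] l] by simp
      qed
      moreover have "z' \<in> carrier (vsp M j)" unfolding z'_def by (rule vs_closed(4)[OF vs[OF j] z(1) cp])
      ultimately show ?thesis by (intro bexI[of _ z']) auto
    qed
  qed
  from this[of 0] show ?thesis using that by auto
qed

text \<open>A functional \<open>l\<close> at the vertex \<open>(j + m) mod n\<close> that kills the ends of all paths of length \<open>m + 1\<close> amounts to a
  homomorphism from \<open>M\<close> to the uniserial module of length \<open>m + 1\<close> whose top is at \<open>j\<close>; an element \<open>y\<close> at \<open>j\<close>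
  that is killed by the path of length \<open>m + 1\<close> amounts to a homomorphism from that uniserial module to \<open>M\<close>.
  The following map is their composite.  Only those indices \<open>t\<close> occur for which the path of length \<open>t\<close> from \<open>j\<close>
  ends at the vertex \<open>i\<close>.\<close>

definition transvection :: "nat \<Rightarrow> nat \<Rightarrow> ('v \<Rightarrow> 'k) \<Rightarrow> 'v \<Rightarrow> nat \<Rightarrow> 'v \<Rightarrow> 'v" where
  "transvection j m l y i z = finsum (vsp M i)
     (\<lambda>t. l (path_map n M i (m - t) z) \<odot>\<^bsub>vsp M i\<^esub> path_map n M j t y) {t. t \<le> m \<and> (j + t) mod n = i}"

lemma transvection_closed:
  assumes "j < n" "y \<in> carrier (vsp M j)" "i < n"
  shows "transvection j m l y i z \<in> carrier (vsp M i)"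
  unfolding transvection_def using path_closed[OF assms(1,2)] vs_closed(3)[OF vs[OF assms(3)]]
  by (intro subspace_finsum[OF carrier_subspace[OF vs[OF assms(3)]]]) auto

lemma transvection_form:
  assumes "j < n" "y \<in> carrier (vsp M j)" "i < n" "linear_form (vsp M i) k"
  shows "k (transvection j m l y i z) =
    (\<Sum>t | t \<le> m \<and> (j + t) mod n = i. l (path_map n M i (m - t) z) * k (path_map n M j t y))"
proof -
  have "k (transvection j m l y i z) = (\<Sum>t | t \<le> m \<and> (j + t) mod n = i.
      k (l (path_map n M i (m - t) z) \<odot>\<^bsub>vsp M i\<^esub> path_map n M j t y))"
    unfolding transvection_def using path_closed[OF assms(1,2)] vs_closed(3)[OF vs[OF assms(3)]]
    by (intro linear_form_finsum[OF vs[OF assms(3)] assms(4)]) auto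
  also have "\<dots> = (\<Sum>t | t \<le> m \<and> (j + t) mod n = i. l (path_map n M i (m - t) z) * k (path_map n M j t y))"
    using path_closed[OF assms(1,2)] by (intro sum.cong refl linear_form_smult[OF assms(4)]) auto
  finally show ?thesis .
qed

lemma transvection_end_vertex:
  assumes j: "j < n" and i0: "(j + m) mod n = i0" and t: "t \<le> m" "(j + t) mod n = i"
  shows "(i + (m - t)) mod n = i0"
proof -
  have "(i + (m - t)) mod n = (j + t + (m - t)) mod n" unfolding t(2)[symmetric] by (rule mod_add_left_eq)
  then show ?thesis using i0 t(1) by simp
qed

lemma transvection_functional:
  assumes j: "j < n" and i0: "(j + m) mod n = i0" and l: "linear_form (vsp M i0) l"
    and i: "i < n" and t: "t \<le> m" "(j + t) mod n = i"
  shows "linear_form (vsp M i) (\<lambda>z. l (path_map n M i (m - t) z))"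
proof -
  have "linear_map class_ring (vsp M i) (vsp M i0) (path_map n M i (m - t))"
    using path_linear[OF i, of "m - t"] transvection_end_vertex[OF j i0 t] by simp
  from linear_form_pullback[OF this l] show ?thesis by (simp add: comp_def)
qed

text \<open>Passing an arrow to either side shifts the summation index by one.  The two boundary terms vanish, one
  since \<open>l\<close> kills the ends of paths of length \<open>m + 1\<close>, the other since the end of \<open>y\<close> is killed by the next arrow.\<close>

lemma transvection_endo:
  assumes j: "j < n" and i0: "(j + m) mod n = i0" and l: "linear_form (vsp M i0) l"
    and lz: "\<And>i z. i < n \<Longrightarrow> (i + Suc m) mod n = i0 \<Longrightarrow> z \<in> carrier (vsp M i) \<Longrightarrow>
      l (path_map n M i (Suc m) z) = 0"
    and y: "y \<in> carrier (vsp M j)" and ky: "arr M i0 (path_map n M j m y) = \<zero>\<^bsub>vsp M (Suc i0 mod n)\<^esub>"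
  shows "endo (transvection j m l y)"
  unfolding endo_def
proof (intro conjI allI impI ballI)
  fix i assume i: "i < n"
  let ?A = "\<lambda>i. {t. t \<le> m \<and> (j + t) mod n = i}"
  note fn = transvection_functional[OF j i0 l i]
  show "linear_map class_ring (vsp M i) (vsp M i) (transvection j m l y i)"
    unfolding linear_map_iff
  proof (intro conjI ballI allI)
    fix a b c assume a: "a \<in> carrier (vsp M i)"
    show "transvection j m l y i a \<in> carrier (vsp M i)" by (rule transvection_closed[OF j y i])
    show "transvection j m l y i (c \<odot>\<^bsub>vsp M i\<^esub> a) = c \<odot>\<^bsub>vsp M i\<^esub> transvection j m l y i a"
    proof (rule form_eqI[OF fd[OF i]])
      fix k assume k: "linear_form (vsp M i) k"
      have "(\<Sum>t\<in>?A i. l (path_map n M i (m - t) (c \<odot>\<^bsub>vsp M i\<^esub> a)) * k (path_map n M j t y)) =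
          (\<Sum>t\<in>?A i. c * (l (path_map n M i (m - t) a) * k (path_map n M j t y)))"
        using linear_form_smult[OF fn a] by (intro sum.cong) auto
      then show "k (transvection j m l y i (c \<odot>\<^bsub>vsp M i\<^esub> a)) = k (c \<odot>\<^bsub>vsp M i\<^esub> transvection j m l y i a)"
        by (simp add: transvection_form[OF j y i k] linear_form_smult[OF k transvection_closed[OF j y i]]
            sum_distrib_left)
    qed (use vs_closed(3)[OF vs[OF i]] transvection_closed[OF j y i] in auto)
    assume b: "b \<in> carrier (vsp M i)"
    show "transvection j m l y i (a \<oplus>\<^bsub>vsp M i\<^esub> b) =
        transvection j m l y i a \<oplus>\<^bsub>vsp M i\<^esub> transvection j m l y i b"
    proof (rule form_eqI[OF fd[OF i]])
      fix k assume k: "linear_form (vsp M i) k"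
      have "(\<Sum>t\<in>?A i. l (path_map n M i (m - t) (a \<oplus>\<^bsub>vsp M i\<^esub> b)) * k (path_map n M j t y)) =
          (\<Sum>t\<in>?A i. l (path_map n M i (m - t) a) * k (path_map n M j t y) +
            l (path_map n M i (m - t) b) * k (path_map n M j t y))"
        using linear_form_add[OF fn a b] by (intro sum.cong) (auto simp: distrib_right)
      then show "k (transvection j m l y i (a \<oplus>\<^bsub>vsp M i\<^esub> b)) =
          k (transvection j m l y i a \<oplus>\<^bsub>vsp M i\<^esub> transvection j m l y i b)"
        by (simp add: transvection_form[OF j y i k] sum.distrib
            linear_form_add[OF k transvection_closed[OF j y i] transvection_closed[OF j y i]])
    qed (use vs_closed(2)[OF vs[OF i]] transvection_closed[OF j y i] in auto)
  qed (use vs[OF i] in auto)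
  fix z assume z: "z \<in> carrier (vsp M i)"
  let ?i = "Suc i mod n"
  have i': "?i < n" by (rule less_n)
  show "transvection j m l y ?i (arr M i z) = arr M i (transvection j m l y i z)"
  proof (rule form_eqI[OF fd[OF i']])
    fix k assume k: "linear_form (vsp M ?i) k"
    define g where "g = (\<lambda>t. l (path_map n M i (Suc m - t) z) * k (path_map n M j t y))"
    let ?B = "{t. t \<noteq> 0 \<and> t \<le> m \<and> (j + t) mod n = ?i}"
    have ka: "linear_form (vsp M i) (k \<circ> arr M i)" by (rule linear_form_pullback[OF arr_linear[OF i] k])
    have step: "(j + t) mod n = i \<longleftrightarrow> (j + Suc t) mod n = ?i" for t
    proof
      assume "(j + Suc t) mod n = ?i"
      then have "Suc ((j + t) mod n) mod n = Suc i mod n" by (simp add: mod_Suc_eq)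
      then have "pr (Suc ((j + t) mod n) mod n) = pr (Suc i mod n)" by simp
      then show "(j + t) mod n = i" using pr_Suc[OF i] pr_Suc[OF less_n] by simp
    qed (use mod_Suc_eq[of "j + t" n] in auto)
    have "k (transvection j m l y ?i (arr M i z)) =
        (\<Sum>t\<in>?A ?i. l (path_map n M ?i (m - t) (arr M i z)) * k (path_map n M j t y))"
      by (rule transvection_form[OF j y i' k])
    also have "\<dots> = (\<Sum>t\<in>?A ?i. g t)"
    proof (rule sum.cong[OF refl])
      fix t assume "t \<in> ?A ?i"
      then have "Suc m - t = Suc (m - t)" by auto
      then show "l (path_map n M ?i (m - t) (arr M i z)) * k (path_map n M j t y) = g t"
        using path_Suc_left[OF i, of "m - t" z] by (simp add: g_def del: path_map.simps)
    qed
    also have "\<dots> = (\<Sum>t\<in>?B. g t)"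
    proof (rule sum.mono_neutral_right)
      show "\<forall>t\<in>?A ?i - ?B. g t = 0"
      proof
        fix t assume "t \<in> ?A ?i - ?B"
        then have t: "t = 0" "j = ?i" using j by auto
        have "(i + Suc m) mod n = (?i + m) mod n" by (simp add: mod_add_left_eq)
        then have "(i + Suc m) mod n = i0" using i0 t(2) by simp
        then show "g t = 0" using lz[OF i _ z] t by (simp add: g_def del: path_map.simps)
      qed
    qed auto
    finally have left: "k (transvection j m l y ?i (arr M i z)) = (\<Sum>t\<in>?B. g t)" .
    have "k (arr M i (transvection j m l y i z)) =
        (\<Sum>t\<in>?A i. l (path_map n M i (m - t) z) * (k \<circ> arr M i) (path_map n M j t y))"
      using transvection_form[OF j y i ka] by simp
    also have "\<dots> = (\<Sum>t\<in>?A i. g (Suc t))"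
    proof (rule sum.cong[OF refl])
      fix t assume "t \<in> ?A i"
      then have "path_map n M j (Suc t) y = arr M i (path_map n M j t y)" by auto
      then show "l (path_map n M i (m - t) z) * (k \<circ> arr M i) (path_map n M j t y) = g (Suc t)"
        by (simp add: g_def del: path_map.simps)
    qed
    also have "\<dots> = (\<Sum>t\<in>Suc ` ?A i. g t)" by (simp add: sum.reindex)
    also have "\<dots> = (\<Sum>t\<in>?B. g t)"
    proof (rule sum.mono_neutral_right)
      show "?B \<subseteq> Suc ` ?A i"
      proof
        fix t assume "t \<in> ?B"
        then obtain t' where "t = Suc t'" "t' \<le> m" "(j + Suc t') mod n = ?i" by (cases t) auto
        then show "t \<in> Suc ` ?A i" using step by blast
      qed
      show "\<forall>t\<in>Suc ` ?A i - ?B. g t = 0"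
      proof
        fix t assume "t \<in> Suc ` ?A i - ?B"
        then obtain t' where t': "t = Suc t'" "t' \<le> m" "(j + t') mod n = i" "t \<notin> ?B" by blast
        then have "\<not> Suc t' \<le> m" using step by auto
        then have "t' = m" using t'(2) by simp
        then have "t = Suc m" "i = i0" using t' i0 by auto
        then have "path_map n M j t y = \<zero>\<^bsub>vsp M ?i\<^esub>" using ky i0 by simp
        then show "g t = 0" using linear_form_zero[OF vs[OF i'] k] by (simp add: g_def)
      qed
    qed auto
    finally show "k (transvection j m l y ?i (arr M i z)) = k (arr M i (transvection j m l y i z))"
      using left by simp
  qed (use transvection_closed[OF j y] i i' linear_map_D(3)[OF arr_linear[OF i]] in auto)
qed

text \<open>As \<open>u\<close> is killed by the next arrow, only the path of length \<open>0\<close> contributes on the side of \<open>l\<close>.\<close>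

lemma transvection_end:
  assumes j: "j < n" and i0: "(j + m) mod n = i0" and l: "linear_form (vsp M i0) l"
    and u: "u \<in> carrier (vsp M i0)" "l u = 1" "arr M i0 u = \<zero>\<^bsub>vsp M (Suc i0 mod n)\<^esub>"
    and y: "y \<in> carrier (vsp M j)"
  shows "transvection j m l y i0 u = path_map n M j m y"
proof -
  have i0_less: "i0 < n" using i0 less_n by blast
  show ?thesis
  proof (rule form_eqI[OF fd[OF i0_less]])
    fix k assume k: "linear_form (vsp M i0) k"
    let ?A = "{t. t \<le> m \<and> (j + t) mod n = i0}"
    have "k (transvection j m l y i0 u) = (\<Sum>t\<in>?A. l (path_map n M i0 (m - t) u) * k (path_map n M j t y))"
      by (rule transvection_form[OF j y i0_less k])
    also have "\<dots> = (\<Sum>t\<in>?A. if t = m then k (path_map n M j m y) else 0)"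
    proof (rule sum.cong[OF refl])
      fix t assume t: "t \<in> ?A"
      show "l (path_map n M i0 (m - t) u) * k (path_map n M j t y) =
          (if t = m then k (path_map n M j m y) else 0)"
      proof (cases "t = m")
        case False
        then obtain d where d: "m - t = Suc d" using t by (cases "m - t") auto
        have "(Suc i0 mod n + d) mod n = (i0 + (m - t)) mod n" unfolding d by (simp add: mod_add_left_eq)
        then have "(Suc i0 mod n + d) mod n = i0" using transvection_end_vertex[OF j i0] t by simp
        then have "path_map n M i0 (m - t) u = \<zero>\<^bsub>vsp M i0\<^esub>"
          unfolding d path_Suc_left[OF i0_less] u(3) by (rule path_zero[OF less_n])
        then show ?thesis using False linear_form_zero[OF vs[OF i0_less] l] by simp
      qed (simp add: u(2))
    qed
    also have "\<dots> = k (path_map n M j m y)" using i0 by simp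
    finally show "k (transvection j m l y i0 u) = k (path_map n M j m y)" .
  qed (use transvection_closed[OF j y i0_less] path_closed[OF j y i0] in auto)
qed

text \<open>The composite only involves the values of \<open>l\<close> on the ends of paths that start at \<open>y'\<close>: for length at
  most \<open>m\<close> they vanish by assumption, for larger length the path itself does.\<close>

lemma transvection_square_zero:
  assumes j: "j < n" and i0: "(j + m) mod n = i0" and l: "linear_form (vsp M i0) l"
    and y: "y \<in> carrier (vsp M j)" and y': "y' \<in> carrier (vsp M j)"
    and ky': "arr M i0 (path_map n M j m y') = \<zero>\<^bsub>vsp M (Suc i0 mod n)\<^esub>"
    and ly': "\<And>a. a \<le> m \<Longrightarrow> (j + a) mod n = i0 \<Longrightarrow> l (path_map n M j a y') = 0"
    and i: "i < n" and z: "z \<in> carrier (vsp M i)"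
  shows "transvection j m l y i (transvection j m l y' i z) = \<zero>\<^bsub>vsp M i\<^esub>"
proof (rule form_eqI[OF fd[OF i]])
  have i0_less: "i0 < n" using i0 less_n by blast
  fix k assume k: "linear_form (vsp M i) k"
  let ?A = "{t. t \<le> m \<and> (j + t) mod n = i}"
  have path_y': "l (path_map n M j a y') = 0" if "(j + a) mod n = i0" for a
  proof (cases "a \<le> m")
    case False
    then obtain d where d: "a = m + Suc d" by (metis less_iff_Suc_add linorder_not_le add_Suc_right)
    have "(Suc i0 mod n + d) mod n = i0"
      using that unfolding d i0[symmetric] by (simp add: mod_simps add.assoc)
    then have "path_map n M j a y' = \<zero>\<^bsub>vsp M i0\<^esub>"
      unfolding d path_add i0 path_Suc_left[OF i0_less] ky' by (rule path_zero[OF less_n])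
    then show ?thesis using linear_form_zero[OF vs[OF i0_less] l] by simp
  qed (use ly' that in auto)
  have "l (path_map n M i (m - t) (transvection j m l y' i z)) = 0" if t: "t \<in> ?A" for t
  proof -
    have ln: "linear_form (vsp M i) (\<lambda>z. l (path_map n M i (m - t) z))"
      using transvection_functional[OF j i0 l i] t by blast
    have "l (path_map n M i (m - t) (transvection j m l y' i z)) =
        (\<Sum>s\<in>?A. l (path_map n M i (m - s) z) * l (path_map n M i (m - t) (path_map n M j s y')))"
      by (rule transvection_form[OF j y' i ln])
    also have "\<dots> = 0"
    proof (intro sum.neutral ballI)
      fix s assume s: "s \<in> ?A"
      then have "path_map n M i (m - t) (path_map n M j s y') = path_map n M j (s + (m - t)) y'"
        by (auto simp: path_add)
      moreover have "(j + (s + (m - t))) mod n = i0"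
      proof -
        have "(j + (s + (m - t))) mod n = ((j + s) mod n + (m - t)) mod n"
          by (simp add: mod_add_left_eq add.assoc)
        then show ?thesis using transvection_end_vertex[OF j i0, of t i] t s by simp
      qed
      ultimately show "l (path_map n M i (m - s) z) * l (path_map n M i (m - t) (path_map n M j s y')) = 0"
        using path_y' by simp
    qed
    finally show ?thesis .
  qed
  then show "k (transvection j m l y i (transvection j m l y' i z)) = k \<zero>\<^bsub>vsp M i\<^esub>"
    unfolding transvection_form[OF j y i k] linear_form_zero[OF vs[OF i] k]
    by (intro sum.neutral ballI) simp
qed (use transvection_closed[OF j y i] vs_closed(1)[OF vs[OF i]] in auto)

end

subsection \<open>The lines of a stratum\<close>

lemma complete_soc_flag_D:
  assumes "complete_soc_flag n M W" "i < n"
  shows "W i (vdim (vsp M i) (soc n M i)) = soc n M i" "W i 0 = {\<zero>\<^bsub>vsp M i\<^esub>}"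
    "l \<le> vdim (vsp M i) (soc n M i) \<Longrightarrow> VectorSpace.subspace class_ring (W i l) (vsp M i)"
    "l \<le> vdim (vsp M i) (soc n M i) \<Longrightarrow> vdim (vsp M i) (W i l) = l"
    "k \<le> l \<Longrightarrow> l \<le> vdim (vsp M i) (soc n M i) \<Longrightarrow> W i k \<subseteq> W i l"
proof -
  let ?s = "vdim (vsp M i) (soc n M i)"
  show "W i ?s = soc n M i" "W i 0 = {\<zero>\<^bsub>vsp M i\<^esub>}"
    "l \<le> ?s \<Longrightarrow> VectorSpace.subspace class_ring (W i l) (vsp M i)"
    "l \<le> ?s \<Longrightarrow> vdim (vsp M i) (W i l) = l"
    using assms by (auto simp: complete_soc_flag_def Let_def)
  have step: "W i l \<subseteq> W i (Suc l)" if "l < ?s" for l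
    using assms that by (auto simp: complete_soc_flag_def Let_def)
  show "W i k \<subseteq> W i l" if "k \<le> l" "l \<le> ?s"
    using that
  proof (induction rule: dec_induct)
    case (step l)
    then show ?case using \<open>\<And>l. l < ?s \<Longrightarrow> W i l \<subseteq> W i (Suc l)\<close>[of l] by auto
  qed simp
qed

context nilpotent_cyc begin

text \<open>A line in relative position \<open>w\<close> is spanned by \<open>u + v\<close>, where \<open>v\<close> lies in the largest member of the flag that
  does not contain \<open>u\<close>.  As the flag refines the radical layers of the socle, that member consists of ends of
  paths that are at least as long as the longest path ending in \<open>u\<close>; hence each of its basis vectors is the
  image of \<open>u\<close> under an endomorphism of \<open>M\<close>.  The lifts \<open>y\<close> of the basis vectors along those paths can be chosen
  such that all products of two of these endomorphisms vanish.  The forms \<open>c k\<close> read off the coordinates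
  of \<open>v\<close> from \<open>u + v\<close>.\<close>

proposition stratum_endomorphisms:
  assumes W: "complete_soc_flag n M W" and ref: "refines_soc_rad n M W" and i0: "i0 < n"
    and U0: "U0 \<in> submodules n M" "\<And>i. i < n \<Longrightarrow> vdim (vsp M i) (U0 i) = (if i = i0 then 1 else 0)"
    and pos: "has_rel_pos n M W w U0"
  obtains l u q c \<psi> where "linear_form (vsp M i0) l" "u \<in> U0 i0" "l u = 1"
    "\<And>k. k < q \<Longrightarrow> linear_form (vsp M i0) (c k)"
    "\<And>k. k < (q::nat) \<Longrightarrow> endo (\<psi> k)"
    "\<And>k k' i z. k < q \<Longrightarrow> k' < q \<Longrightarrow> i < n \<Longrightarrow> z \<in> carrier (vsp M i) \<Longrightarrow> \<psi> k i (\<psi> k' i z) = \<zero>\<^bsub>vsp M i\<^esub>"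
    "\<And>L. L \<in> submodules n M \<Longrightarrow> (\<And>i. i < n \<Longrightarrow> vdim (vsp M i) (L i) = (if i = i0 then 1 else 0)) \<Longrightarrow>
      has_rel_pos n M W w L \<Longrightarrow> \<exists>x\<in>L i0. l x = 1 \<and>
        (\<forall>m. linear_form (vsp M i0) m \<longrightarrow> m x = m u + (\<Sum>k<q. c k x * m (\<psi> k i0 u)))"
proof -
  note V = fd[OF i0] and vsV = vs[OF i0]
  let ?V = "vsp M i0" and ?s = "vdim (vsp M i0) (soc n M i0)"
  note WD = complete_soc_flag_D[OF W i0]
  have dim0: "vdim ?V (U0 i0) = 1" using U0(2)[OF i0] by simp
  note U0S = submodule_D(1)[OF U0(1) i0]
  have "U0 i0 \<noteq> {\<zero>\<^bsub>?V\<^esub>}" using dim0 vdim_0[OF V U0S] by auto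
  then obtain u where u: "u \<in> U0 i0" "u \<noteq> \<zero>\<^bsub>?V\<^esub>" using subspace_D(3)[OF U0S] by blast
  have u_soc: "u \<in> soc n M i0" using line_in_soc[OF U0(1) i0 U0(2)] u(1) by blast
  have uV: "u \<in> carrier ?V" and ku: "arr M i0 u = \<zero>\<^bsub>vsp M (Suc i0 mod n)\<^esub>"
    using soc_killed[OF i0 u_soc] .
  define l0 where "l0 = (LEAST l. u \<in> W i0 l)"
  have "u \<in> W i0 ?s" using u_soc WD(1) by simp
  then have l0: "u \<in> W i0 l0" "l0 \<le> ?s" unfolding l0_def by (rule LeastI, rule Least_le)
  have l0_least: "l0 \<le> l" if "u \<in> W i0 l" for l unfolding l0_def using that by (rule Least_le)
  have "l0 \<noteq> 0"
  proof
    assume "l0 = 0"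
    then have "u \<in> W i0 0" using l0(1) by simp
    then show False unfolding WD(2) using u(2) by simp
  qed
  then obtain q where q: "l0 = Suc q" by (cases l0) auto
  have q_s: "q \<le> ?s" using l0(2) q by simp
  let ?P = "W i0 q" and ?L = "W i0 l0"
  note PS = WD(3)[OF q_s] and LS = WD(3)[OF l0(2)]
  have u_P: "u \<notin> ?P" using l0_least[of q] q by auto
  have PL: "?P \<subseteq> ?L" using WD(5)[of q l0] l0(2) q by simp
  have L_soc: "?L \<subseteq> soc n M i0" using WD(5)[OF l0(2)] WD(1) by simp
  \<comment> \<open>The radical layer of \<open>u\<close>.\<close>
  obtain N where N: "radpow n M N i0 = {\<zero>\<^bsub>?V\<^esub>}" using radpow_eventually_zero i0 by metis
  define m where "m = (LEAST m. u \<notin> radpow n M (Suc m) i0)"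
  have "u \<notin> radpow n M (Suc N) i0"
    using radpow_Suc[of N] shift_le[OF radpow_submodule i0, of N] N u(2) by auto
  then have um: "u \<notin> radpow n M (Suc m) i0" unfolding m_def by (rule LeastI)
  have um': "u \<in> radpow n M m i0"
  proof (cases m)
    case 0
    then show ?thesis using uV i0 by (simp add: whole_sub_def)
  next
    case (Suc m')
    then show ?thesis using not_less_Least[of m' "\<lambda>m. u \<notin> radpow n M (Suc m) i0"] by (simp add: m_def)
  qed
  have L_rad: "?L \<subseteq> radpow n M m i0"
  proof -
    obtain l' where l': "l' \<le> ?s" "soc n M i0 \<inter> radpow n M m i0 = W i0 l'"
      using ref i0 unfolding refines_soc_rad_def by blast
    then have "u \<in> W i0 l'" using u_soc um' by blast
    then have "?L \<subseteq> W i0 l'" using WD(5)[OF l0_least] l'(1) by blast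
    then show ?thesis using l'(2) by blast
  qed
  have rad_P: "soc n M i0 \<inter> radpow n M (Suc m) i0 \<subseteq> ?P"
  proof -
    obtain l' where l': "l' \<le> ?s" "soc n M i0 \<inter> radpow n M (Suc m) i0 = W i0 l'"
      using ref i0 unfolding refines_soc_rad_def by blast
    then have "u \<notin> W i0 l'" using um by blast
    then have "\<not> l0 \<le> l'" using WD(5)[of l0 l'] l'(1) l0(1) by blast
    then show ?thesis using l'(2) WD(5)[of l' q] q q_s by simp
  qed
  \<comment> \<open>A functional equal to 1 on \<open>u\<close> that kills both the smaller member of the flag and the next
    radical layer: the two together do not contain \<open>u\<close>, because the flag refines the radical layers.\<close>
  let ?R = "radpow n M (Suc m) i0"
  note RS = submodule_D(1)[OF radpow_submodule i0, of "Suc m"]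
  define Z where "Z = {a \<oplus>\<^bsub>?V\<^esub> b | a b. a \<in> ?P \<and> b \<in> ?R}"
  have ZS: "VectorSpace.subspace class_ring Z ?V" unfolding Z_def by (rule subspace_sum[OF PS RS])
  have ZI: "a \<oplus>\<^bsub>?V\<^esub> b \<in> Z" if "a \<in> ?P" "b \<in> ?R" for a b unfolding Z_def using that by blast
  have u_Z: "u \<notin> Z"
  proof
    assume "u \<in> Z"
    then obtain a b where ab: "a \<in> ?P" "b \<in> ?R" "u = a \<oplus>\<^bsub>?V\<^esub> b" unfolding Z_def by blast
    have aV: "a \<in> carrier ?V" and bV: "b \<in> carrier ?V"
      using ab(1,2) subspace_D(2)[OF PS] subspace_D(2)[OF RS] by blast+
    interpret V: vectorspace class_ring ?V by (rule vsV)
    have "b = u \<ominus>\<^bsub>?V\<^esub> a" using aV bV by (simp add: ab(3) a_minus_def V.a_comm V.r_neg1 V.a_assoc V.l_neg V.r_neg)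
    then have "b \<in> ?L" using subspace_minus[OF LS l0(1)] ab(1) PL by blast
    then have "b \<in> ?P" using ab(2) rad_P L_soc by blast
    then show False using u_P subspace_D(4)[OF PS ab(1)] ab(3) by blast
  qed
  obtain l where l: "linear_form ?V l" "\<And>z. z \<in> Z \<Longrightarrow> l z = 0" "l u = 1"
    by (rule separating_form[OF V ZS uV u_Z]) (rule that, blast+)
  have lP: "l v = 0" if "v \<in> ?P" for v
  proof -
    interpret V: vectorspace class_ring ?V by (rule vsV)
    have "v = v \<oplus>\<^bsub>?V\<^esub> \<zero>\<^bsub>?V\<^esub>" using that subspace_D(2)[OF PS] by auto
    then show ?thesis using l(2)[OF ZI[OF that subspace_D(3)[OF RS]]] by simp
  qed
  have lR: "l v = 0" if "v \<in> ?R" for v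
  proof -
    interpret V: vectorspace class_ring ?V by (rule vsV)
    have "v = \<zero>\<^bsub>?V\<^esub> \<oplus>\<^bsub>?V\<^esub> v" using that subspace_D(2)[OF RS] by auto
    then show ?thesis using l(2)[OF ZI[OF subspace_D(3)[OF PS] that]] by simp
  qed
  define j where "j = (i0 + m * (n - 1)) mod n"
  have j: "j < n" "(j + m) mod n = i0" unfolding j_def using less_n index_back[OF i0] by blast+
  obtain x where x: "x \<in> carrier (vsp M j)" "path_map n M j m x = u"
    using um' radpow_path[OF j(1), of m] j(2) by auto
  \<comment> \<open>Both \<open>u\<close> and the smaller member of the flag consist of ends of paths of length \<open>m\<close> from \<open>j\<close>.\<close>
  have lift: "\<exists>y\<in>carrier (vsp M j). path_map n M j m y = v \<and>
      (\<forall>a. a \<le> m \<and> (j + a) mod n = i0 \<longrightarrow> l (path_map n M j a y) = 0)" if v: "v \<in> ?P" for v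
  proof -
    obtain y where y: "y \<in> carrier (vsp M j)" "path_map n M j m y = v"
      using v PL L_rad radpow_path[OF j(1), of m] j(2) by auto
    have 1: "l (path_map n M j m x) = 1" "arr M i0 (path_map n M j m x) = \<zero>\<^bsub>vsp M (Suc i0 mod n)\<^esub>"
      "l (path_map n M j m y) = 0" using x(2) l(3) ku y(2) lP[OF v] by auto
    obtain y' where "y' \<in> carrier (vsp M j)" "path_map n M j m y' = path_map n M j m y"
      "\<And>a. a \<le> m \<Longrightarrow> (j + a) mod n = i0 \<Longrightarrow> l (path_map n M j a y') = 0"
      using adapted_lift[OF j l(1) x(1) 1(1,2) y(1) 1(3)] by metis
    then show ?thesis using y(2) by (intro bexI[of _ y']) auto
  qed
  obtain bs es where bs: "frame ?V ?P bs es" by (rule frame_exists[OF V PS])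
  then have bd: "dual_lists ?V bs es" and bP: "set bs \<subseteq> ?P"
    by (auto simp: frame_def)
  have lbs: "length bs = q" using frame_basis(3)[OF V PS bs] WD(4)[OF q_s] by simp
  have bk: "bs ! k \<in> ?P" if "k < q" for k using bP that lbs nth_mem by blast
  have "\<forall>k. \<exists>y. k < q \<longrightarrow> y \<in> carrier (vsp M j) \<and> path_map n M j m y = bs ! k \<and>
      (\<forall>a. a \<le> m \<and> (j + a) mod n = i0 \<longrightarrow> l (path_map n M j a y) = 0)"
    using lift[OF bk] by blast
  then obtain y where y: "\<And>k. k < q \<Longrightarrow> y k \<in> carrier (vsp M j)"
    "\<And>k. k < q \<Longrightarrow> path_map n M j m (y k) = bs ! k"
    "\<And>k a. k < q \<Longrightarrow> a \<le> m \<Longrightarrow> (j + a) mod n = i0 \<Longrightarrow> l (path_map n M j a (y k)) = 0" by metis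
  have kb: "arr M i0 (path_map n M j m (y k)) = \<zero>\<^bsub>vsp M (Suc i0 mod n)\<^esub>" if "k < q" for k
    using soc_killed(2)[OF i0, of "bs ! k"] bk[OF that] PL L_soc y(2)[OF that] by auto
  \<comment> \<open>Coordinates on the smaller member of the flag, corrected so as to vanish on \<open>u\<close>.\<close>
  define c where "c = (\<lambda>k z. (es ! k) z - (es ! k) u * l z)"
  define \<psi> where "\<psi> = (\<lambda>k. transvection j m l (y k))"
  have c: "linear_form ?V (c k)" if "k < q" for k
    unfolding c_def using that lbs dual_lists_form[OF bd] l(1)
    by (intro linear_form_diff linear_form_scale) auto
  have lz: "l (path_map n M i (Suc m) z) = 0"
    if "i < n" "(i + Suc m) mod n = i0" "z \<in> carrier (vsp M i)" for i z
    using radpow_path[OF that(1), of "Suc m"] that(2,3) lR by blast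
  have \<psi>u: "\<psi> k i0 u = bs ! k" if "k < q" for k
    unfolding \<psi>_def using transvection_end[OF j l(1) uV l(3) ku y(1)[OF that]] y(2)[OF that] by simp
  have frL: "frame ?V ?L (bs @ [u]) (map c [0..<q] @ [l])"
  proof (rule dual_lists_frame[OF V LS])
    show "set (bs @ [u]) \<subseteq> ?L" using bP PL l0(1) by auto
    show "length (bs @ [u]) = vdim ?V ?L" using WD(4)[OF l0(2)] lbs q by simp
    show "dual_lists ?V (bs @ [u]) (map c [0..<q] @ [l])"
      unfolding dual_lists_def
    proof (intro conjI allI impI)
      show "length (map c [0..<q] @ [l]) = length (bs @ [u])" using lbs by simp
      show "set (bs @ [u]) \<subseteq> carrier ?V" using bd uV by (auto simp: dual_lists_def)
      show "\<forall>l\<in>set (map c [0..<q] @ [l]). linear_form ?V l" using c l(1) by auto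
      fix a b assume "a < length (bs @ [u])" "b < length (bs @ [u])"
      then show "((map c [0..<q] @ [l]) ! a) ((bs @ [u]) ! b) = (if a = b then 1 else 0)"
        using lbs dual_lists_eq[OF bd, of a b] lP[OF bk] l(3)
        by (auto simp: nth_append less_Suc_eq c_def)
    qed
  qed
  show ?thesis
  proof (rule that[of l u q c \<psi>])
    show "endo (\<psi> k)" if "k < q" for k
      unfolding \<psi>_def using transvection_endo[OF j l(1) lz y(1)[OF that] kb[OF that]] by blast
    show "\<psi> k i (\<psi> k' i z) = \<zero>\<^bsub>vsp M i\<^esub>"
      if "k < q" "k' < q" "i < n" "z \<in> carrier (vsp M i)" for k k' i z
      unfolding \<psi>_def
      using transvection_square_zero[OF j l(1) y(1)[OF that(1)] y(1)[OF that(2)] kb[OF that(2)]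
          y(3)[OF that(2)] that(3,4)] by blast
    fix L assume L: "L \<in> submodules n M"
      and dimL: "\<And>i. i < n \<Longrightarrow> vdim (vsp M i) (L i) = (if i = i0 then 1 else 0)"
      and posL: "has_rel_pos n M W w L"
    note LiS = submodule_D(1)[OF L i0]
    have same: "vdim ?V (L i0 \<inter> W i0 k) = vdim ?V (U0 i0 \<inter> W i0 k)" if "k \<le> ?s" for k
      using pos posL i0 that by (simp add: has_rel_pos_def)
    have U0_scal: "\<exists>a. z = a \<odot>\<^bsub>?V\<^esub> u" if "z \<in> U0 i0" for z
      using line_scalar[OF V U0S dim0 u that] by metis
    have "U0 i0 \<inter> ?L = U0 i0" using U0_scal subspace_D(5)[OF LS l0(1)] by blast
    then have "vdim ?V (L i0 \<inter> ?L) = 1" using same[OF l0(2)] dim0 by simp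
    then have "L i0 \<inter> ?L \<noteq> {\<zero>\<^bsub>?V\<^esub>}" using vdim_0[OF V subspace_inter[OF LiS LS]] by auto
    then obtain x0 where x0: "x0 \<in> L i0" "x0 \<in> ?L" "x0 \<noteq> \<zero>\<^bsub>?V\<^esub>"
      using subspace_D(3)[OF LiS] subspace_D(3)[OF LS] by blast
    have "U0 i0 \<inter> ?P = {\<zero>\<^bsub>?V\<^esub>}"
    proof -
      have "z = \<zero>\<^bsub>?V\<^esub>" if z: "z \<in> U0 i0" "z \<in> ?P" for z
      proof -
        interpret V: vectorspace class_ring ?V by (rule vsV)
        obtain a where a: "z = a \<odot>\<^bsub>?V\<^esub> u" using U0_scal[OF z(1)] by blast
        have "l z = a" using linear_form_smult[OF l(1) uV] l(3) a by simp
        then have "a = 0" using lP[OF z(2)] by simp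
        then show ?thesis using a V.smult_l_null[OF uV] by simp
      qed
      then show ?thesis using subspace_D(3)[OF U0S] subspace_D(3)[OF PS] by blast
    qed
    then have "vdim ?V (L i0 \<inter> ?P) = 0"
      using same[OF q_s] vdim_0[OF V subspace_inter[OF U0S PS]] by simp
    then have LP: "L i0 \<inter> ?P = {\<zero>\<^bsub>?V\<^esub>}" using vdim_0[OF V subspace_inter[OF LiS PS]] by simp
    have expand: "m z = (\<Sum>k<q. c k z * m (bs ! k)) + l z * m u"
      if "z \<in> ?L" "linear_form ?V m" for z m
    proof -
      have "m z = (\<Sum>a<length (bs @ [u]). ((map c [0..<q] @ [l]) ! a) z * m ((bs @ [u]) ! a))"
        using frL that by (simp add: frame_def)
      also have "\<dots> = (\<Sum>k<q. c k z * m (bs ! k)) + l z * m u"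
        by (simp add: lbs nth_append)
      finally show ?thesis .
    qed
    have lx0: "l x0 \<noteq> 0"
    proof
      assume 0: "l x0 = 0"
      obtain v where v: "v \<in> ?P" "\<And>m. linear_form ?V m \<Longrightarrow> m v = (\<Sum>a<length bs. c a x0 * m (bs ! a))"
        using comb_exists[OF PS bP, of "\<lambda>a. c a x0"] by blast
      have "x0 = v"
      proof (rule form_eqI[OF V])
        show "m x0 = m v" if "linear_form ?V m" for m
          using expand[OF x0(2) that] v(2)[OF that] 0 lbs by simp
      qed (use x0(1) v(1) subspace_D(2)[OF LiS] subspace_D(2)[OF PS] in auto)
      then show False using v(1) x0(1,3) LP by blast
    qed
    let ?x = "inverse (l x0) \<odot>\<^bsub>?V\<^esub> x0"
    have xL: "?x \<in> L i0" "?x \<in> ?L" using subspace_D(5)[OF LiS x0(1)] subspace_D(5)[OF LS x0(2)] by auto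
    have x0V: "x0 \<in> carrier ?V" using x0(1) subspace_D(2)[OF LiS] by blast
    have lx: "l ?x = 1" using linear_form_smult[OF l(1) x0V] lx0 by simp
    have "m ?x = m u + (\<Sum>k<q. c k ?x * m (\<psi> k i0 u))" if "linear_form ?V m" for m
    proof -
      have "(\<Sum>k<q. c k ?x * m (\<psi> k i0 u)) = (\<Sum>k<q. c k ?x * m (bs ! k))"
        using \<psi>u by (intro sum.cong) auto
      then show ?thesis using expand[OF xL(2) that] lx by simp
    qed
    then show "\<exists>x\<in>L i0. l x = 1 \<and>
        (\<forall>m. linear_form ?V m \<longrightarrow> m x = m u + (\<Sum>k<q. c k x * m (\<psi> k i0 u)))"
      using xL(1) lx by blast
  qed (use l u c in auto)
qed

end

lemma coset_self:
  fixes V :: "('k::field, 'v) module"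
  assumes S: "VectorSpace.subspace class_ring S V" and x: "x \<in> carrier V"
  shows "x \<in> S +>\<^bsub>V\<^esub> x"
  unfolding quot_coset(1)[OF S x]
proof
  interpret V: vectorspace class_ring V using subspace_D(1)[OF S] .
  have "x \<ominus>\<^bsub>V\<^esub> x = \<zero>\<^bsub>V\<^esub>" using x V.r_neg by (simp add: a_minus_def)
  then show "x \<ominus>\<^bsub>V\<^esub> x \<in> S" using subspace_D(3)[OF S] by metis
qed (rule x)

section \<open>Quotient representations\<close>

definition rep_epi :: "nat \<Rightarrow> ('k::field, 'v) cyc_rep \<Rightarrow> ('k, 'w) cyc_rep \<Rightarrow> (nat \<Rightarrow> 'v \<Rightarrow> 'w) \<Rightarrow> bool" where
  "rep_epi n M N h \<longleftrightarrow> (\<forall>i<n. linear_map class_ring (vsp M i) (vsp N i) (h i) \<and>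
     h i ` carrier (vsp M i) = carrier (vsp N i) \<and>
     (\<forall>x\<in>carrier (vsp M i). h (Suc i mod n) (arr M i x) = arr N i (h i x)))"

lemma rep_epi_D:
  assumes "rep_epi n M N h" "i < n"
  shows "linear_map class_ring (vsp M i) (vsp N i) (h i)"
    "h i ` carrier (vsp M i) = carrier (vsp N i)"
    "x \<in> carrier (vsp M i) \<Longrightarrow> h (Suc i mod n) (arr M i x) = arr N i (h i x)"
  using assms by (auto simp: rep_epi_def)

lemma is_rep_D:
  assumes "is_rep n M" "i < n"
  shows "vectorspace class_ring (vsp M i)"
    "linear_map class_ring (vsp M i) (vsp M (Suc i mod n)) (arr M i)"
  using assms by (auto simp: is_rep_def)

lemma submodules_D:
  assumes "U \<in> submodules n M" "i < n"
  shows "VectorSpace.subspace class_ring (U i) (vsp M i)"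
    "x \<in> U i \<Longrightarrow> arr M i x \<in> U (Suc i mod n)"
  using assms unfolding submodules_def by blast+

lemma quot_rep_vsp: "vsp (quot_rep n M U) i = quot_space (vsp M i) (U i)"
  by (simp add: quot_rep_def)

lemma quot_rep_arr:
  assumes M: "is_rep n M" and U: "U \<in> submodules n M" and i: "i < n" and x: "x \<in> carrier (vsp M i)"
  shows "arr (quot_rep n M U) i (U i +>\<^bsub>vsp M i\<^esub> x) = U (Suc i mod n) +>\<^bsub>vsp M (Suc i mod n)\<^esub> arr M i x"
proof -
  have i': "Suc i mod n < n" using i by simp
  note A = linear_map_D[OF is_rep_D(2)[OF M i]]
  note US = submodules_D(1)[OF U i] and US' = submodules_D(1)[OF U i']
  have "U (Suc i mod n) +>\<^bsub>vsp M (Suc i mod n)\<^esub> arr M i z = U (Suc i mod n) +>\<^bsub>vsp M (Suc i mod n)\<^esub> arr M i x"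
    if "z \<in> U i +>\<^bsub>vsp M i\<^esub> x" for z
  proof -
    have z: "z \<in> carrier (vsp M i)" "z \<ominus>\<^bsub>vsp M i\<^esub> x \<in> U i" using quot_coset(1)[OF US x] that by auto
    then have "arr M i z \<ominus>\<^bsub>vsp M (Suc i mod n)\<^esub> arr M i x \<in> U (Suc i mod n)"
      using submodules_D(2)[OF U i z(2)] A(7)[OF z(1) x] by simp
    then show ?thesis using quot_coset(2)[OF US' A(3)[OF z(1)] A(3)[OF x]] by simp
  qed
  moreover have "x \<in> U i +>\<^bsub>vsp M i\<^esub> x" by (rule coset_self[OF US x])
  ultimately have "(\<Union>z\<in>U i +>\<^bsub>vsp M i\<^esub> x. U (Suc i mod n) +>\<^bsub>vsp M (Suc i mod n)\<^esub> arr M i z) =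
      U (Suc i mod n) +>\<^bsub>vsp M (Suc i mod n)\<^esub> arr M i x" by blast
  then show ?thesis by (simp only: quot_rep_def cyc_rep.select_convs)
qed

lemma is_rep_quot:
  assumes M: "is_rep n M" and U: "U \<in> submodules n M"
  shows "is_rep n (quot_rep n M U)"
  unfolding is_rep_def
proof (intro conjI allI impI)
  fix i assume i: "i < n"
  then have i': "Suc i mod n < n" by simp
  note US = submodules_D(1)[OF U i] and US' = submodules_D(1)[OF U i']
  note A = linear_map_D[OF is_rep_D(2)[OF M i]]
  note P = linear_map_D[OF quot_proj(1)[OF US]] and P' = linear_map_D[OF quot_proj(1)[OF US']]
  show vsi: "vectorspace class_ring (vsp (quot_rep n M U) i)"
    unfolding quot_rep_vsp by (rule quot_space_vs[OF US])
  have rep: "\<exists>x\<in>carrier (vsp M i). X = U i +>\<^bsub>vsp M i\<^esub> x" if "X \<in> carrier (quot_space (vsp M i) (U i))" for X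
    using that quot_proj(2)[OF US] by blast
  note arr = quot_rep_arr[OF M U i]
  show "linear_map class_ring (vsp (quot_rep n M U) i) (vsp (quot_rep n M U) (Suc i mod n)) (arr (quot_rep n M U) i)"
    unfolding linear_map_iff quot_rep_vsp
  proof (intro conjI ballI allI)
    fix X Y c assume X: "X \<in> carrier (quot_space (vsp M i) (U i))"
    then obtain x where x: "x \<in> carrier (vsp M i)" "X = U i +>\<^bsub>vsp M i\<^esub> x" using rep by blast
    show "arr (quot_rep n M U) i X \<in> carrier (quot_space (vsp M (Suc i mod n)) (U (Suc i mod n)))"
      using x arr P'(3)[OF A(3)] by simp
    show "arr (quot_rep n M U) i (c \<odot>\<^bsub>quot_space (vsp M i) (U i)\<^esub> X) =
        c \<odot>\<^bsub>quot_space (vsp M (Suc i mod n)) (U (Suc i mod n))\<^esub> arr (quot_rep n M U) i X"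
      unfolding x(2) P(5)[OF x(1), symmetric] arr[OF x(1)] arr[OF vs_closed(3)[OF A(1) x(1)]]
        A(5)[OF x(1)] by (rule P'(5)[OF A(3)[OF x(1)]])
    assume "Y \<in> carrier (quot_space (vsp M i) (U i))"
    then obtain y where y: "y \<in> carrier (vsp M i)" "Y = U i +>\<^bsub>vsp M i\<^esub> y" using rep by blast
    show "arr (quot_rep n M U) i (X \<oplus>\<^bsub>quot_space (vsp M i) (U i)\<^esub> Y) =
        arr (quot_rep n M U) i X \<oplus>\<^bsub>quot_space (vsp M (Suc i mod n)) (U (Suc i mod n))\<^esub> arr (quot_rep n M U) i Y"
      unfolding x(2) y(2) P(4)[OF x(1) y(1), symmetric] arr[OF x(1)] arr[OF y(1)]
        arr[OF vs_closed(2)[OF A(1) x(1) y(1)]] A(4)[OF x(1) y(1)]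
      by (rule P'(4)[OF A(3)[OF x(1)] A(3)[OF y(1)]])
  qed (use quot_space_vs[OF US] quot_space_vs[OF US'] in auto)
qed

lemma quot_rep_epi:
  assumes M: "is_rep n M" and U: "U \<in> submodules n M"
  shows "rep_epi n M (quot_rep n M U) (\<lambda>i x. U i +>\<^bsub>vsp M i\<^esub> x)"
  unfolding rep_epi_def quot_rep_vsp
  using quot_proj(1,2)[OF submodules_D(1)[OF U]] quot_rep_arr[OF M U] by auto

text \<open>The third isomorphism theorem, for a surjection in place of a quotient map.\<close>

lemma rep_iso_quotients:
  assumes M: "is_rep n M" and N: "is_rep n N" and h: "rep_epi n M N h"
    and U: "U \<in> submodules n M" and V: "V \<in> submodules n N"
    and eq: "\<And>i. i < n \<Longrightarrow> U i = {x \<in> carrier (vsp M i). h i x \<in> V i}"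
  shows "rep_iso n (quot_rep n M U) (quot_rep n N V)"
proof -
  define k where "k = (\<lambda>i X. V i +>\<^bsub>vsp N i\<^esub> h i (SOME x. x \<in> X))"
  have k: "k i (U i +>\<^bsub>vsp M i\<^esub> x) = V i +>\<^bsub>vsp N i\<^esub> h i x" if i: "i < n" and x: "x \<in> carrier (vsp M i)" for i x
  proof -
    note US = submodules_D(1)[OF U i] and VS = submodules_D(1)[OF V i]
    note H = linear_map_D[OF rep_epi_D(1)[OF h i]]
    have "x \<in> U i +>\<^bsub>vsp M i\<^esub> x" by (rule coset_self[OF US x])
    then have "(SOME z. z \<in> U i +>\<^bsub>vsp M i\<^esub> x) \<in> U i +>\<^bsub>vsp M i\<^esub> x" by (rule someI)
    then obtain z where z: "z = (SOME z. z \<in> U i +>\<^bsub>vsp M i\<^esub> x)" "z \<in> carrier (vsp M i)" "z \<ominus>\<^bsub>vsp M i\<^esub> x \<in> U i"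
      using quot_coset(1)[OF US x] by blast
    have "h i z \<ominus>\<^bsub>vsp N i\<^esub> h i x \<in> V i" using z(3) eq[OF i] H(7)[OF z(2) x] by auto
    then show ?thesis
      unfolding k_def z(1)[symmetric] using quot_coset(2)[OF VS H(3)[OF z(2)] H(3)[OF x]] by simp
  qed
  show ?thesis
    unfolding rep_iso_def quot_rep_vsp
  proof (intro exI[of _ k] conjI allI impI ballI)
    fix i assume i: "i < n"
    note US = submodules_D(1)[OF U i] and VS = submodules_D(1)[OF V i]
    note H = linear_map_D[OF rep_epi_D(1)[OF h i]]
    note P = linear_map_D[OF quot_proj(1)[OF US]] and P' = linear_map_D[OF quot_proj(1)[OF VS]]
    have rep: "\<exists>x\<in>carrier (vsp M i). X = U i +>\<^bsub>vsp M i\<^esub> x" if "X \<in> carrier (quot_space (vsp M i) (U i))" for X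
      using that quot_proj(2)[OF US] by blast
    note ki = k[OF i]
    show "linear_map class_ring (quot_space (vsp M i) (U i)) (quot_space (vsp N i) (V i)) (k i)"
      unfolding linear_map_iff
    proof (intro conjI ballI allI)
      fix X Y c assume X: "X \<in> carrier (quot_space (vsp M i) (U i))"
      then obtain x where x: "x \<in> carrier (vsp M i)" "X = U i +>\<^bsub>vsp M i\<^esub> x" using rep by blast
      show "k i X \<in> carrier (quot_space (vsp N i) (V i))"
        using x ki P'(3)[OF H(3)] by simp
      show "k i (c \<odot>\<^bsub>quot_space (vsp M i) (U i)\<^esub> X) = c \<odot>\<^bsub>quot_space (vsp N i) (V i)\<^esub> k i X"
        unfolding x(2) P(5)[OF x(1), symmetric] ki[OF x(1)] ki[OF vs_closed(3)[OF H(1) x(1)]]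
          H(5)[OF x(1)] by (rule P'(5)[OF H(3)[OF x(1)]])
      assume "Y \<in> carrier (quot_space (vsp M i) (U i))"
      then obtain y where y: "y \<in> carrier (vsp M i)" "Y = U i +>\<^bsub>vsp M i\<^esub> y" using rep by blast
      show "k i (X \<oplus>\<^bsub>quot_space (vsp M i) (U i)\<^esub> Y) = k i X \<oplus>\<^bsub>quot_space (vsp N i) (V i)\<^esub> k i Y"
        unfolding x(2) y(2) P(4)[OF x(1) y(1), symmetric] ki[OF x(1)] ki[OF y(1)]
          ki[OF vs_closed(2)[OF H(1) x(1) y(1)]] H(4)[OF x(1) y(1)]
        by (rule P'(4)[OF H(3)[OF x(1)] H(3)[OF y(1)]])
    qed (use quot_space_vs[OF US] quot_space_vs[OF VS] in auto)
    show "bij_betw (k i) (carrier (quot_space (vsp M i) (U i))) (carrier (quot_space (vsp N i) (V i)))"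
      unfolding bij_betw_def
    proof
      show "inj_on (k i) (carrier (quot_space (vsp M i) (U i)))"
      proof (rule inj_onI)
        fix X Y assume "X \<in> carrier (quot_space (vsp M i) (U i))" "Y \<in> carrier (quot_space (vsp M i) (U i))"
          and kk: "k i X = k i Y"
        then obtain x y where x: "x \<in> carrier (vsp M i)" "X = U i +>\<^bsub>vsp M i\<^esub> x"
          and y: "y \<in> carrier (vsp M i)" "Y = U i +>\<^bsub>vsp M i\<^esub> y" using rep by blast
        have "h i (x \<ominus>\<^bsub>vsp M i\<^esub> y) \<in> V i"
          using kk quot_coset(2)[OF VS H(3)[OF x(1)] H(3)[OF y(1)]] H(7)[OF x(1) y(1)]
          unfolding x(2) y(2) ki[OF x(1)] ki[OF y(1)] by simp
        then have "x \<ominus>\<^bsub>vsp M i\<^esub> y \<in> U i" using eq[OF i] vs_closed(4)[OF H(1) x(1) y(1)] by simp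
        then show "X = Y" unfolding x(2) y(2) using quot_coset(2)[OF US x(1) y(1)] by simp
      qed
      have "k i ` carrier (quot_space (vsp M i) (U i)) =
          (\<lambda>x. V i +>\<^bsub>vsp N i\<^esub> h i x) ` carrier (vsp M i)"
        unfolding quot_space_sel(1) image_image using ki by (rule image_cong[OF refl])
      also have "\<dots> = carrier (quot_space (vsp N i) (V i))"
        unfolding quot_space_sel(1) rep_epi_D(2)[OF h i, symmetric] image_image ..
      finally show "k i ` carrier (quot_space (vsp M i) (U i)) = carrier (quot_space (vsp N i) (V i))" .
    qed
    have i': "Suc i mod n < n" using i by simp
    fix X assume "X \<in> carrier (quot_space (vsp M i) (U i))"
    then obtain x where x: "x \<in> carrier (vsp M i)" "X = U i +>\<^bsub>vsp M i\<^esub> x" using rep by blast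
    show "k (Suc i mod n) (arr (quot_rep n M U) i X) = arr (quot_rep n N V) i (k i X)"
      unfolding x(2) ki[OF x(1)] quot_rep_arr[OF M U i x(1)] quot_rep_arr[OF N V i H(3)[OF x(1)]]
        rep_epi_D(3)[OF h i x(1), symmetric]
      by (rule k[OF i' linear_map_D(3)[OF is_rep_D(2)[OF M i] x(1)]])
  qed
qed

section \<open>The trivialization over a stratum\<close>

lemma Gr_pts: "U \<in> pts (Gr n M e) \<longleftrightarrow> U \<in> submodules n M \<and> (\<forall>i<n. int (vdim (vsp M i) (U i)) = e i)"
  by (simp add: Gr_def)

lemma Gr_stratum_pts:
  "U \<in> pts (Gr_stratum n M e W w) \<longleftrightarrow> U \<in> pts (Gr n M e) \<and> has_rel_pos n M W w U"
  by (simp add: Gr_stratum_def restrict_variety_def)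

lemma Fl_pts: "U \<in> pts (Fl n M r dd) \<longleftrightarrow> U \<in> extensional {..r} \<and>
    (\<forall>k\<le>r. U k \<in> pts (Gr n M (dd k))) \<and> U 0 = zero_sub n M \<and> U r = whole_sub n M \<and>
    (\<forall>k<r. sub_le n (U k) (U (Suc k)))"
  by (simp add: Fl_def)

lemma Fl_mono:
  assumes U: "U \<in> pts (Fl n M r dd)" and kl: "k \<le> l" "l \<le> r" and i: "i < n"
  shows "U k i \<subseteq> U l i"
  using kl
proof (induction rule: dec_induct)
  case (step m)
  then have "sub_le n (U m) (U (Suc m))" using U by (simp add: Fl_pts)
  then show ?case using step i by (auto simp: sub_le_def)
qed simp

text \<open>The data that \<open>stratum_endomorphisms\<close> provides for the stratum of \<open>U0\<close>.\<close>

locale stratum_data = nilpotent_cyc n M for n and M :: "('k::field, 'v) cyc_rep" +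
  fixes r :: nat and dd :: "nat \<Rightarrow> nat \<Rightarrow> int" and W :: "nat \<Rightarrow> nat \<Rightarrow> 'v set" and w :: "nat \<Rightarrow> nat \<Rightarrow> nat"
    and U0 :: "nat \<Rightarrow> 'v set" and i0 :: nat and l :: "'v \<Rightarrow> 'k" and u :: 'v and q :: nat
    and c :: "nat \<Rightarrow> 'v \<Rightarrow> 'k" and \<psi> :: "nat \<Rightarrow> nat \<Rightarrow> 'v \<Rightarrow> 'v"
  assumes r: "r \<ge> 1" and i0: "i0 < n"
    and dd0: "\<And>i. i < n \<Longrightarrow> dd 0 i = 0" and dd1: "\<And>i. i < n \<Longrightarrow> dd 1 i = (if i = i0 then 1 else 0)"
    and dim_M: "\<And>i. i < n \<Longrightarrow> int (vdim (vsp M i) (carrier (vsp M i))) = dd r i"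
    and U0: "U0 \<in> pts (Gr_stratum n M (dd 1) W w)"
    and l: "linear_form (vsp M i0) l" and u: "u \<in> U0 i0" "l u = 1"
    and c: "\<And>k. k < q \<Longrightarrow> linear_form (vsp M i0) (c k)"
    and \<psi>: "\<And>k. k < q \<Longrightarrow> endo (\<psi> k)"
    and \<psi>\<psi>: "\<And>k k' i z. k < q \<Longrightarrow> k' < q \<Longrightarrow> i < n \<Longrightarrow> z \<in> carrier (vsp M i) \<Longrightarrow>
      \<psi> k i (\<psi> k' i z) = \<zero>\<^bsub>vsp M i\<^esub>"
    and param: "\<And>L. L \<in> pts (Gr_stratum n M (dd 1) W w) \<Longrightarrow> \<exists>x\<in>L i0. l x = 1 \<and>
        (\<forall>m. linear_form (vsp M i0) m \<longrightarrow> m x = m u + (\<Sum>k<q. c k x * m (\<psi> k i0 u)))"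
begin

abbreviation "S \<equiv> Gr_stratum n M (dd 1) W w"
abbreviation "N \<equiv> quot_rep n M U0"
abbreviation "e \<equiv> \<lambda>t i. dd (Suc t) i - dd 1 i"
abbreviation "X \<equiv> restrict_variety (Fl n M r dd) ((\<lambda>U. U 1) -` pts S)"

lemma is_rep_M: "is_rep n M"
  using nil by (simp add: nilpotent_rep_def)

lemma S_D:
  assumes "L \<in> pts S"
  shows "L \<in> submodules n M" "i < n \<Longrightarrow> vdim (vsp M i) (L i) = (if i = i0 then 1 else 0)"
  using assms dd1[of i] by (auto simp: Gr_stratum_pts Gr_pts split: if_splits)

lemmas U0m = S_D(1)[OF U0]

lemma uV: "u \<in> carrier (vsp M i0)"
  using u(1) submodule_D(3)[OF U0m i0] by blast

subsection \<open>Automorphisms moving the lines of the stratum to one another\<close>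

text \<open>The family \<open>id + \<Sum> g k \<psi> k\<close> of automorphisms of \<open>M\<close>, with parameters \<open>g\<close>.\<close>

definition twist :: "(nat \<Rightarrow> 'k) \<Rightarrow> nat \<Rightarrow> 'v \<Rightarrow> 'v" where
  "twist g i z = z \<oplus>\<^bsub>vsp M i\<^esub> finsum (vsp M i) (\<lambda>k. g k \<odot>\<^bsub>vsp M i\<^esub> \<psi> k i z) {..<q}"

lemma \<psi>_linear: "k < q \<Longrightarrow> i < n \<Longrightarrow> linear_map class_ring (vsp M i) (vsp M i) (\<psi> k i)"
  and \<psi>_arr: "k < q \<Longrightarrow> i < n \<Longrightarrow> z \<in> carrier (vsp M i) \<Longrightarrow> \<psi> k (Suc i mod n) (arr M i z) = arr M i (\<psi> k i z)"
  using \<psi> by (auto simp: endo_def)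

lemma twist_sum_closed:
  assumes "i < n" "z \<in> carrier (vsp M i)"
  shows "finsum (vsp M i) (\<lambda>k. g k \<odot>\<^bsub>vsp M i\<^esub> \<psi> k i z) {..<q} \<in> carrier (vsp M i)"
  using assms vs_closed(3)[OF vs] linear_map_D(3)[OF \<psi>_linear]
  by (intro subspace_finsum[OF carrier_subspace[OF vs]]) auto

lemma twist_closed: "i < n \<Longrightarrow> z \<in> carrier (vsp M i) \<Longrightarrow> twist g i z \<in> carrier (vsp M i)"
  unfolding twist_def using vs_closed(2)[OF vs] twist_sum_closed by blast

lemma twist_form:
  assumes i: "i < n" and z: "z \<in> carrier (vsp M i)" and m: "linear_form (vsp M i) m"
  shows "m (twist g i z) = m z + (\<Sum>k<q. g k * m (\<psi> k i z))"
proof -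
  have "m (twist g i z) = m z + m (finsum (vsp M i) (\<lambda>k. g k \<odot>\<^bsub>vsp M i\<^esub> \<psi> k i z) {..<q})"
    unfolding twist_def by (rule linear_form_add[OF m z twist_sum_closed[OF i z]])
  also have "m (finsum (vsp M i) (\<lambda>k. g k \<odot>\<^bsub>vsp M i\<^esub> \<psi> k i z) {..<q}) = (\<Sum>k<q. m (g k \<odot>\<^bsub>vsp M i\<^esub> \<psi> k i z))"
    using z vs_closed(3)[OF vs[OF i]] linear_map_D(3)[OF \<psi>_linear[OF _ i]]
    by (intro linear_form_finsum[OF vs[OF i] m]) auto
  also have "\<dots> = (\<Sum>k<q. g k * m (\<psi> k i z))"
    using z linear_map_D(3)[OF \<psi>_linear[OF _ i]] by (intro sum.cong refl linear_form_smult[OF m]) auto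
  finally show ?thesis .
qed

lemma twist_linear:
  assumes i: "i < n"
  shows "linear_map class_ring (vsp M i) (vsp M i) (twist g i)"
  unfolding linear_map_iff
proof (intro conjI ballI allI)
  note vsi = vs[OF i]
  fix a b d assume a: "a \<in> carrier (vsp M i)"
  show "twist g i a \<in> carrier (vsp M i)" by (rule twist_closed[OF i a])
  show "twist g i (d \<odot>\<^bsub>vsp M i\<^esub> a) = d \<odot>\<^bsub>vsp M i\<^esub> twist g i a"
  proof (rule form_eqI[OF fd[OF i]])
    fix m assume m: "linear_form (vsp M i) m"
    have "m (\<psi> k i (d \<odot>\<^bsub>vsp M i\<^esub> a)) = d * m (\<psi> k i a)" if "k < q" for k
      using linear_form_smult[OF linear_form_pullback[OF \<psi>_linear[OF that i] m] a] by simp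
    then have "(\<Sum>k<q. g k * m (\<psi> k i (d \<odot>\<^bsub>vsp M i\<^esub> a))) = d * (\<Sum>k<q. g k * m (\<psi> k i a))"
      unfolding sum_distrib_left by (intro sum.cong) auto
    then show "m (twist g i (d \<odot>\<^bsub>vsp M i\<^esub> a)) = m (d \<odot>\<^bsub>vsp M i\<^esub> twist g i a)"
      unfolding twist_form[OF i vs_closed(3)[OF vsi a] m] linear_form_smult[OF m twist_closed[OF i a]]
        twist_form[OF i a m] linear_form_smult[OF m a] by (simp add: distrib_left)
  qed (use a vs_closed(3)[OF vsi] twist_closed[OF i] in auto)
  assume b: "b \<in> carrier (vsp M i)"
  show "twist g i (a \<oplus>\<^bsub>vsp M i\<^esub> b) = twist g i a \<oplus>\<^bsub>vsp M i\<^esub> twist g i b"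
  proof (rule form_eqI[OF fd[OF i]])
    fix m assume m: "linear_form (vsp M i) m"
    have "m (\<psi> k i (a \<oplus>\<^bsub>vsp M i\<^esub> b)) = m (\<psi> k i a) + m (\<psi> k i b)" if "k < q" for k
      using linear_form_add[OF linear_form_pullback[OF \<psi>_linear[OF that i] m] a b] by simp
    then have "(\<Sum>k<q. g k * m (\<psi> k i (a \<oplus>\<^bsub>vsp M i\<^esub> b))) =
        (\<Sum>k<q. g k * m (\<psi> k i a)) + (\<Sum>k<q. g k * m (\<psi> k i b))"
      unfolding sum.distrib[symmetric] by (intro sum.cong) (auto simp: distrib_left)
    then show "m (twist g i (a \<oplus>\<^bsub>vsp M i\<^esub> b)) = m (twist g i a \<oplus>\<^bsub>vsp M i\<^esub> twist g i b)"
      unfolding twist_form[OF i vs_closed(2)[OF vsi a b] m]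
        linear_form_add[OF m twist_closed[OF i a] twist_closed[OF i b]]
        twist_form[OF i a m] twist_form[OF i b m] linear_form_add[OF m a b] by simp
  qed (use a b vs_closed(2)[OF vsi] twist_closed[OF i] in auto)
qed (use vs[OF i] in auto)

lemma twist_arr:
  assumes i: "i < n" and z: "z \<in> carrier (vsp M i)"
  shows "twist g (Suc i mod n) (arr M i z) = arr M i (twist g i z)"
proof (rule form_eqI[OF fd[OF less_n]])
  note A = linear_map_D[OF arr_linear[OF i]]
  fix m assume m: "linear_form (vsp M (Suc i mod n)) m"
  have "m (arr M i (twist g i z)) = m (arr M i z) + (\<Sum>k<q. g k * m (arr M i (\<psi> k i z)))"
    using twist_form[OF i z linear_form_pullback[OF arr_linear[OF i] m]] by simp
  also have "\<dots> = m (twist g (Suc i mod n) (arr M i z))"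
    unfolding twist_form[OF less_n A(3)[OF z] m] using \<psi>_arr[OF _ i z] by simp
  finally show "m (twist g (Suc i mod n) (arr M i z)) = m (arr M i (twist g i z))" by simp
next
  note A = linear_map_D[OF arr_linear[OF i]]
  show "twist g (Suc i mod n) (arr M i z) \<in> carrier (vsp M (Suc i mod n))"
    by (rule twist_closed[OF less_n A(3)[OF z]])
  show "arr M i (twist g i z) \<in> carrier (vsp M (Suc i mod n))" by (rule A(3)[OF twist_closed[OF i z]])
qed

text \<open>As all products of two of the \<open>\<psi> k\<close> vanish, \<open>twist\<close> turns addition of parameters into composition; in
  particular the inverses belong to the same family and depend polynomially on the parameters as well.\<close>

lemma \<psi>_twist:
  assumes "k < q" and i: "i < n" and z: "z \<in> carrier (vsp M i)"
  shows "\<psi> k i (twist g i z) = \<psi> k i z"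
proof (rule form_eqI[OF fd[OF i]])
  note P = linear_map_D[OF \<psi>_linear[OF assms(1) i]]
  fix m assume m: "linear_form (vsp M i) m"
  have "m (\<psi> k i (twist g i z)) = m (\<psi> k i z) + (\<Sum>k'<q. g k' * m (\<psi> k i (\<psi> k' i z)))"
    using twist_form[OF i z linear_form_pullback[OF \<psi>_linear[OF assms(1) i] m]] by simp
  also have "(\<Sum>k'<q. g k' * m (\<psi> k i (\<psi> k' i z))) = 0"
    using \<psi>\<psi>[OF assms(1) _ i z] linear_form_zero[OF vs[OF i] m] by (intro sum.neutral) simp
  finally show "m (\<psi> k i (twist g i z)) = m (\<psi> k i z)" by simp
qed (use linear_map_D(3)[OF \<psi>_linear[OF assms(1) i]] z twist_closed[OF i] in auto)

lemma twist_inverse: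
  assumes i: "i < n" and z: "z \<in> carrier (vsp M i)" and g: "\<And>k. g k + g' k = 0"
  shows "twist g i (twist g' i z) = z"
proof (rule form_eqI[OF fd[OF i]])
  fix m assume m: "linear_form (vsp M i) m"
  have "m (twist g i (twist g' i z)) = m (twist g' i z) + (\<Sum>k<q. g k * m (\<psi> k i z))"
    unfolding twist_form[OF i twist_closed[OF i z] m] using \<psi>_twist[OF _ i z] by simp
  also have "\<dots> = m z + (\<Sum>k<q. (g k + g' k) * m (\<psi> k i z))"
    unfolding twist_form[OF i z m] by (simp add: sum.distrib distrib_right)
  finally show "m (twist g i (twist g' i z)) = m z" using g by simp
qed (use z twist_closed[OF i] in auto)

text \<open>The generator of a line \<open>L\<close> of the stratum that is normalized by \<open>l\<close>, and the parameters of the automorphism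
  that carries \<open>u\<close> to it.\<close>

definition gen :: "(nat \<Rightarrow> 'v set) \<Rightarrow> 'v" where
  "gen L = (SOME x. x \<in> L i0 \<and> l x = 1 \<and>
     (\<forall>m. linear_form (vsp M i0) m \<longrightarrow> m x = m u + (\<Sum>k<q. c k x * m (\<psi> k i0 u))))"

definition \<gamma> :: "(nat \<Rightarrow> 'v set) \<Rightarrow> nat \<Rightarrow> 'k" where
  "\<gamma> L k = c k (gen L)"

lemma gen:
  assumes "L \<in> pts S"
  shows "gen L \<in> L i0" "l (gen L) = 1" "gen L = twist (\<gamma> L) i0 u" "gen L \<in> carrier (vsp M i0)"
proof -
  have *: "gen L \<in> L i0 \<and> l (gen L) = 1 \<and>
     (\<forall>m. linear_form (vsp M i0) m \<longrightarrow> m (gen L) = m u + (\<Sum>k<q. c k (gen L) * m (\<psi> k i0 u)))"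
    unfolding gen_def by (rule someI_ex) (use param[OF assms] in blast)
  then show "gen L \<in> L i0" "l (gen L) = 1" by auto
  then show gV: "gen L \<in> carrier (vsp M i0)" using submodule_D(3)[OF S_D(1)[OF assms] i0] by blast
  show "gen L = twist (\<gamma> L) i0 u"
  proof (rule form_eqI[OF fd[OF i0] gV twist_closed[OF i0 uV]])
    fix m assume m: "linear_form (vsp M i0) m"
    then show "m (gen L) = m (twist (\<gamma> L) i0 u)"
      unfolding twist_form[OF i0 uV m] \<gamma>_def using * by blast
  qed
qed

text \<open>\<open>straight L\<close> carries \<open>L\<close> to \<open>U0\<close>, so that \<open>h L\<close> is a surjection onto \<open>N = M / U0\<close> with kernel \<open>L\<close>.  All surjections
  have the same target, and this is what trivializes the fibration.\<close>

definition straight :: "(nat \<Rightarrow> 'v set) \<Rightarrow> nat \<Rightarrow> 'v \<Rightarrow> 'v" where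
  "straight L = twist (\<lambda>k. - \<gamma> L k)"

definition unstraight :: "(nat \<Rightarrow> 'v set) \<Rightarrow> nat \<Rightarrow> 'v \<Rightarrow> 'v" where
  "unstraight L = twist (\<gamma> L)"

definition h :: "(nat \<Rightarrow> 'v set) \<Rightarrow> nat \<Rightarrow> 'v \<Rightarrow> 'v set" where
  "h L i = (\<lambda>x. U0 i +>\<^bsub>vsp M i\<^esub> straight L i x)"

lemma straight_inverse:
  assumes "i < n" "z \<in> carrier (vsp M i)"
  shows "straight L i (unstraight L i z) = z" "unstraight L i (straight L i z) = z"
    "straight L i z \<in> carrier (vsp M i)" "unstraight L i z \<in> carrier (vsp M i)"
  unfolding straight_def unstraight_def using twist_inverse[OF assms] twist_closed[OF assms] by auto

lemma straight_surj: "i < n \<Longrightarrow> straight L i ` carrier (vsp M i) = carrier (vsp M i)"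
proof (intro equalityI subsetI)
  fix x assume i: "i < n" and x: "x \<in> carrier (vsp M i)"
  show "x \<in> straight L i ` carrier (vsp M i)"
    using straight_inverse(1,4)[OF i x] by (metis imageI)
qed (use straight_inverse(3) in auto)

lemma straight_linear: "i < n \<Longrightarrow> linear_map class_ring (vsp M i) (vsp M i) (straight L i)"
  unfolding straight_def by (rule twist_linear)

lemma N_epi: "rep_epi n M N (\<lambda>i x. U0 i +>\<^bsub>vsp M i\<^esub> x)"
  by (rule quot_rep_epi[OF is_rep_M U0m])

lemma is_rep_N: "is_rep n N"
  by (rule is_rep_quot[OF is_rep_M U0m])

lemma h_epi: "rep_epi n M N (h L)"
  unfolding rep_epi_def
proof (intro conjI allI impI ballI)
  fix i assume i: "i < n"
  note E = rep_epi_D[OF N_epi i]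
  show "linear_map class_ring (vsp M i) (vsp N i) (h L i)"
    using linear_map_comp[OF straight_linear[OF i] E(1)] by (simp add: h_def comp_def)
  have "h L i ` carrier (vsp M i) = (\<lambda>x. U0 i +>\<^bsub>vsp M i\<^esub> x) ` (straight L i ` carrier (vsp M i))"
    by (simp add: h_def image_image)
  then show "h L i ` carrier (vsp M i) = carrier (vsp N i)" unfolding straight_surj[OF i] E(2) .
  fix x assume x: "x \<in> carrier (vsp M i)"
  show "h L (Suc i mod n) (arr M i x) = arr N i (h L i x)"
    unfolding h_def E(3)[OF straight_inverse(3)[OF i x], symmetric]
    using twist_arr[OF i x] by (simp add: straight_def)
qed

lemmas h_D = rep_epi_D[OF h_epi]

lemma L_zero: "L \<in> pts S \<Longrightarrow> i < n \<Longrightarrow> i \<noteq> i0 \<Longrightarrow> L i = {\<zero>\<^bsub>vsp M i\<^esub>}"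
  using S_D(2)[of L i] vdim_0[OF fd submodule_D(1)[OF S_D(1)]] by simp

lemma fd_N: "i < n \<Longrightarrow> fdspace (vsp N i)"
  using fdspace_image[OF fd rep_epi_D(1,2)[OF N_epi]] .

lemma h_kernel:
  assumes L: "L \<in> pts S" and i: "i < n"
  shows "{x \<in> carrier (vsp M i). h L i x = \<zero>\<^bsub>vsp N i\<^esub>} = L i"
proof -
  have ker: "h L i x = \<zero>\<^bsub>vsp N i\<^esub> \<longleftrightarrow> straight L i x \<in> U0 i" if "x \<in> carrier (vsp M i)" for x
    unfolding h_def quot_rep_vsp
    using quot_proj(3)[OF submodule_D(1)[OF U0m i] straight_inverse(3)[OF i that]] .
  note LS = submodule_D(1)[OF S_D(1)[OF L] i] and US = submodule_D(1)[OF U0m i]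
  note T = linear_map_D[OF straight_linear[OF i, of L]]
  note T' = linear_map_D[OF twist_linear[OF i, of "\<gamma> L"], folded unstraight_def]
  have "x \<in> L i" if x: "x \<in> carrier (vsp M i)" "straight L i x \<in> U0 i" for x
  proof (cases "i = i0")
    case False
    then have "straight L i x = \<zero>\<^bsub>vsp M i\<^esub>" using L_zero[OF U0 i] x(2) by simp
    then have "x = \<zero>\<^bsub>vsp M i\<^esub>" using straight_inverse(2)[OF i x(1), of L] T'(6) by simp
    then show ?thesis using subspace_D(3)[OF LS] by simp
  next
    case True
    have "u \<noteq> \<zero>\<^bsub>vsp M i0\<^esub>" using u(2) linear_form_zero[OF vs[OF i0] l] by auto
    then obtain a where a: "straight L i x = a \<odot>\<^bsub>vsp M i\<^esub> u"
      using line_scalar[OF fd[OF i0] submodule_D(1)[OF U0m i0] _ u(1)] S_D(2)[OF U0 i0] x(2) True by auto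
    then have "x = a \<odot>\<^bsub>vsp M i\<^esub> gen L"
      using straight_inverse(2)[OF i x(1), of L] T'(5) uV gen(3)[OF L] True by (simp add: unstraight_def)
    then show ?thesis using subspace_D(5)[OF LS] gen(1)[OF L] True by simp
  qed
  moreover have "straight L i x \<in> U0 i" if x: "x \<in> L i" for x
  proof (cases "i = i0")
    case False
    then show ?thesis using L_zero[OF L i] x T(6) subspace_D(3)[OF US] by simp
  next
    case True
    have "gen L \<noteq> \<zero>\<^bsub>vsp M i0\<^esub>" using gen(2)[OF L] linear_form_zero[OF vs[OF i0] l] by auto
    then obtain a where a: "x = a \<odot>\<^bsub>vsp M i\<^esub> gen L"
      using line_scalar[OF fd[OF i0] submodule_D(1)[OF S_D(1)[OF L] i0] _ gen(1)[OF L]] S_D(2)[OF L i0] x True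
      by auto
    have "straight L i0 (gen L) = u"
      using straight_inverse(1)[OF i0 uV, of L] gen(3)[OF L] by (simp add: unstraight_def)
    then show ?thesis using a T(5) gen(4)[OF L] subspace_D(5)[OF US] u(1) True by simp
  qed
  ultimately show ?thesis using ker subspace_D(2)[OF LS] by blast
qed

subsection \<open>The bijection\<close>

text \<open>The submodules between \<open>L = U 1\<close> and \<open>M\<close> correspond to the submodules of \<open>N\<close> under \<open>h L\<close>.\<close>

definition split_flag :: "(nat \<Rightarrow> nat \<Rightarrow> 'v set) \<Rightarrow> (nat \<Rightarrow> 'v set) \<times> (nat \<Rightarrow> nat \<Rightarrow> 'v set set)" where
  "split_flag U = (U 1, \<lambda>k\<in>{..r - 1}. \<lambda>i\<in>{..<n}. h (U 1) i ` U (Suc k) i)"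

definition glue_flag :: "(nat \<Rightarrow> 'v set) \<times> (nat \<Rightarrow> nat \<Rightarrow> 'v set set) \<Rightarrow> nat \<Rightarrow> nat \<Rightarrow> 'v set" where
  "glue_flag = (\<lambda>(L, V). \<lambda>k\<in>{..r}. case k of 0 \<Rightarrow> zero_sub n M
     | Suc k' \<Rightarrow> \<lambda>i\<in>{..<n}. {x \<in> carrier (vsp M i). h L i x \<in> V k' i})"

lemma X_pts: "U \<in> pts X \<longleftrightarrow> U \<in> pts (Fl n M r dd) \<and> U 1 \<in> pts S"
  by (simp add: restrict_variety_def)

lemma prod_pts: "(L, V) \<in> pts (prod_variety S (Fl n N (r - 1) e)) \<longleftrightarrow> L \<in> pts S \<and> V \<in> pts (Fl n N (r - 1) e)"
  by (simp add: prod_variety_def)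

lemma Fl_D:
  assumes U: "U \<in> pts (Fl n M r dd)" and k: "k \<le> r"
  shows "U k \<in> submodules n M" "i < n \<Longrightarrow> int (vdim (vsp M i) (U k i)) = dd k i"
  using assms by (auto simp: Fl_pts Gr_pts)

lemma vdim_h:
  assumes L: "L \<in> pts S" and U: "VectorSpace.subspace class_ring U (vsp M i)" "L i \<subseteq> U" and i: "i < n"
  shows "vdim (vsp M i) U = (if i = i0 then 1 else 0) + vdim (vsp N i) (h L i ` U)"
  using vdim_image[OF fd[OF i] h_D(1,2)[OF i] U(1), of L] U(2) h_kernel[OF L i] S_D(2)[OF L i] by simp

lemma split_flag_pts:
  assumes U: "U \<in> pts X"
  shows "split_flag U \<in> pts (prod_variety S (Fl n N (r - 1) e))"
proof -
  have FU: "U \<in> pts (Fl n M r dd)" and L: "U 1 \<in> pts S" using U X_pts by auto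
  define V where "V = snd (split_flag U)"
  have V: "V k i = h (U 1) i ` U (Suc k) i" if "k \<le> r - 1" "i < n" for k i
    using that by (simp add: V_def split_flag_def)
  have Vext: "V \<in> extensional {..r - 1}" and Vext': "\<And>k. k \<le> r - 1 \<Longrightarrow> V k \<in> extensional {..<n}"
    by (auto simp: V_def split_flag_def)
  have Vsub: "V k \<in> submodules n N" if k: "k \<le> r - 1" for k
    unfolding submodules_def
  proof (intro CollectI conjI allI impI)
    show "V k \<in> extensional {..<n}" by (rule Vext'[OF k])
    have Um: "U (Suc k) \<in> submodules n M" using Fl_D(1)[OF FU] k r by simp
    fix i assume i: "i < n"
    show "VectorSpace.subspace class_ring (V k i) (vsp N i)"
      unfolding V[OF k i] by (rule image_subspace[OF h_D(1)[OF i] submodule_D(1)[OF Um i]])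
    have "arr N i (h (U 1) i x) = h (U 1) (Suc i mod n) (arr M i x)" if "x \<in> U (Suc k) i" for x
      using h_D(3)[OF i, of x] submodule_D(3)[OF Um i] that by auto
    then show "arr N i ` V k i \<subseteq> V k (Suc i mod n)"
      unfolding V[OF k i] V[OF k less_n] using submodule_D(2)[OF Um i] by auto
  qed
  have "V \<in> pts (Fl n N (r - 1) e)"
    unfolding Fl_pts Gr_pts
  proof (intro conjI allI impI)
    show "V \<in> extensional {..r - 1}" by (rule Vext)
    fix k assume k: "k \<le> r - 1"
    show "V k \<in> submodules n N" by (rule Vsub[OF k])
    fix i assume i: "i < n"
    have "U 1 i \<subseteq> U (Suc k) i" using Fl_mono[OF FU _ _ i, of 1 "Suc k"] k r by simp
    from vdim_h[OF L submodule_D(1)[OF Fl_D(1)[OF FU] i] this i]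
    have "vdim (vsp M i) (U (Suc k) i) = (if i = i0 then 1 else 0) + vdim (vsp N i) (V k i)"
      using k r V[OF k i] by simp
    moreover have "int (vdim (vsp M i) (U (Suc k) i)) = dd (Suc k) i" using Fl_D(2)[OF FU _ i] k r by simp
    ultimately show "int (vdim (vsp N i) (V k i)) = dd (Suc k) i - dd 1 i" using dd1[OF i] by auto
  next
    show "V 0 = zero_sub n N"
    proof (rule extensionalityI[OF Vext' ])
      show "zero_sub n N \<in> extensional {..<n}" by (simp add: zero_sub_def)
      fix i assume "i \<in> {..<n}"
      then have i: "i < n" by simp
      have "V 0 i = h (U 1) i ` U 1 i" using V[of 0 i] i by simp
      also have "\<dots> = {\<zero>\<^bsub>vsp N i\<^esub>}"
        using h_kernel[OF L i] subspace_D(3)[OF submodule_D(1)[OF S_D(1)[OF L] i]] by auto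
      finally show "V 0 i = zero_sub n N i" using i by (simp add: zero_sub_def)
    qed simp
    show "V (r - 1) = whole_sub n N"
    proof (rule extensionalityI[OF Vext'])
      show "whole_sub n N \<in> extensional {..<n}" by (simp add: whole_sub_def)
      fix i assume "i \<in> {..<n}"
      then have i: "i < n" by simp
      have "U r = whole_sub n M" using FU by (simp add: Fl_pts)
      then show "V (r - 1) i = whole_sub n N i"
        using V[of "r - 1" i] h_D(2)[OF i] i r by (simp add: whole_sub_def)
    qed simp
    fix k assume k: "k < r - 1"
    show "sub_le n (V k) (V (Suc k))"
      unfolding sub_le_def
    proof (intro allI impI)
      fix i assume i: "i < n"
      have "U (Suc k) i \<subseteq> U (Suc (Suc k)) i" using Fl_mono[OF FU _ _ i, of "Suc k" "Suc (Suc k)"] k by simp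
      then show "V k i \<subseteq> V (Suc k) i" using V[of k i] V[of "Suc k" i] k i by auto
    qed
  qed
  then have "(U 1, V) \<in> pts (prod_variety S (Fl n N (r - 1) e))" using L prod_pts by blast
  then show ?thesis by (simp add: V_def split_flag_def)
qed

lemma glue_flag_eqs:
  shows "glue_flag (L, V) 0 = zero_sub n M"
    "k < r \<Longrightarrow> i < n \<Longrightarrow> glue_flag (L, V) (Suc k) i = {x \<in> carrier (vsp M i). h L i x \<in> V k i}"
  by (auto simp: glue_flag_def)

lemma h_image_preimage:
  assumes "i < n" "T \<subseteq> carrier (vsp N i)"
  shows "h L i ` {x \<in> carrier (vsp M i). h L i x \<in> T} = T"
proof (intro equalityI subsetI)
  fix y assume y: "y \<in> T"
  then have "y \<in> h L i ` carrier (vsp M i)" using assms(2) h_D(2)[OF assms(1), of L] by auto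
  then show "y \<in> h L i ` {x \<in> carrier (vsp M i). h L i x \<in> T}" using y by auto
qed auto

lemma glue_flag_pts:
  assumes LV: "(L, V) \<in> pts (prod_variety S (Fl n N (r - 1) e))"
  shows "glue_flag (L, V) \<in> pts X" "glue_flag (L, V) 1 = L"
proof -
  have L: "L \<in> pts S" and V: "V \<in> pts (Fl n N (r - 1) e)" using LV prod_pts by auto
  define U where "U = glue_flag (L, V)"
  have U0': "U 0 = zero_sub n M" and US: "\<And>k i. k < r \<Longrightarrow> i < n \<Longrightarrow> U (Suc k) i = {x \<in> carrier (vsp M i). h L i x \<in> V k i}"
    using glue_flag_eqs unfolding U_def by auto
  have Uext: "U \<in> extensional {..r}" and Uext': "\<And>k. k < r \<Longrightarrow> U (Suc k) \<in> extensional {..<n}"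
    by (auto simp: U_def glue_flag_def)
  have Vk: "V k \<in> submodules n N" "\<And>i. i < n \<Longrightarrow> int (vdim (vsp N i) (V k i)) = dd (Suc k) i - dd 1 i"
    if "k < r" for k
    using V that by (auto simp: Fl_pts Gr_pts)
  have Usub: "U (Suc k) \<in> submodules n M" if k: "k < r" for k
    unfolding submodules_def
  proof (intro CollectI conjI allI impI)
    show "U (Suc k) \<in> extensional {..<n}" by (rule Uext'[OF k])
    fix i assume i: "i < n"
    show "VectorSpace.subspace class_ring (U (Suc k) i) (vsp M i)"
      unfolding US[OF k i] by (rule preimage_subspace[OF h_D(1)[OF i] submodules_D(1)[OF Vk(1)[OF k] i]])
    show "arr M i ` U (Suc k) i \<subseteq> U (Suc k) (Suc i mod n)"
      unfolding US[OF k i] US[OF k less_n]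
      using h_D(3)[OF i] submodules_D(2)[OF Vk(1)[OF k] i] linear_map_D(3)[OF arr_linear[OF i]] by auto
  qed
  have V0: "V 0 i = {\<zero>\<^bsub>vsp N i\<^esub>}" if "i < n" for i using V that by (simp add: Fl_pts zero_sub_def)
  have zeroV: "\<zero>\<^bsub>vsp N i\<^esub> \<in> V k i" if "k < r" "i < n" for k i
    using subspace_D(3)[OF submodules_D(1)[OF Vk(1)[OF that(1)] that(2)]] .
  have LU: "L i \<subseteq> U (Suc k) i" if "k < r" "i < n" for k i
  proof
    fix x assume "x \<in> L i"
    then have "x \<in> carrier (vsp M i)" "h L i x = \<zero>\<^bsub>vsp N i\<^esub>" using h_kernel[OF L that(2)] by blast+
    then show "x \<in> U (Suc k) i" unfolding US[OF that] using zeroV[OF that] by simp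
  qed
  have U1: "U 1 = L"
  proof (rule submodule_eqI[OF _ S_D(1)[OF L]])
    show "U 1 \<in> submodules n M" using Usub[of 0] r by simp
    show "U 1 i = L i" if "i < n" for i
      using US[of 0 i] r that V0[OF that] h_kernel[OF L that] by simp
  qed
  have "U \<in> pts (Fl n M r dd)"
    unfolding Fl_pts Gr_pts
  proof (intro conjI allI impI)
    show "U \<in> extensional {..r}" by (rule Uext)
    show "U 0 = zero_sub n M" by (rule U0')
    fix k assume k: "k \<le> r"
    show "U k \<in> submodules n M" using Usub U0' zero_submodule k by (cases k) auto
    fix i assume i: "i < n"
    show "int (vdim (vsp M i) (U k i)) = dd k i"
    proof (cases k)
      case 0
      then show ?thesis
        using U0' vdim_0[OF fd[OF i] zero_subspace[OF vs[OF i]]] dd0[OF i] i by (simp add: zero_sub_def)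
    next
      case (Suc k')
      then have k': "k' < r" using k by simp
      have "V k' i \<subseteq> carrier (vsp N i)" using subspace_D(2)[OF submodules_D(1)[OF Vk(1)[OF k'] i]] .
      then have "h L i ` U (Suc k') i = V k' i" unfolding US[OF k' i] by (rule h_image_preimage[OF i])
      then have "vdim (vsp M i) (U (Suc k') i) = (if i = i0 then 1 else 0) + vdim (vsp N i) (V k' i)"
        using vdim_h[OF L submodule_D(1)[OF Usub[OF k'] i] LU[OF k' i] i] by simp
      then show ?thesis using Vk(2)[OF k' i] dd1[OF i] Suc by auto
    qed
  next
    show "U r = whole_sub n M"
    proof -
      obtain r' where r': "r = Suc r'" using r by (cases r) auto
      have "V (r - 1) = whole_sub n N" using V by (simp add: Fl_pts)
      then have "U r i = whole_sub n M i" if "i < n" for i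
        using US[of r' i] linear_map_D(3)[OF h_D(1)[OF that, of L]] that r' by (auto simp: whole_sub_def)
      then show ?thesis using Usub[of r'] whole_submodule r' by (intro submodule_eqI) auto
    qed
    fix k assume k: "k < r"
    show "sub_le n (U k) (U (Suc k))"
      unfolding sub_le_def
    proof (intro allI impI)
      fix i assume i: "i < n"
      show "U k i \<subseteq> U (Suc k) i"
      proof (cases k)
        case 0
        then show ?thesis
          using U0' i subspace_D(3)[OF submodule_D(1)[OF Usub[OF k] i]] by (simp add: zero_sub_def)
      next
        case (Suc k')
        then have "V k' i \<subseteq> V k i" using Fl_mono[OF V _ _ i, of k' k] k by simp
        then show ?thesis using US[of k' i] US[OF k i] Suc k i by auto
      qed
    qed
  qed
  then show "glue_flag (L, V) \<in> pts X" "glue_flag (L, V) 1 = L"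
    using U1 L X_pts unfolding U_def by auto
qed

lemma glue_split:
  assumes U: "U \<in> pts X"
  shows "glue_flag (split_flag U) = U"
proof -
  have FU: "U \<in> pts (Fl n M r dd)" and L: "U 1 \<in> pts S" using U X_pts by auto
  show ?thesis
  proof (rule extensionalityI)
    show "glue_flag (split_flag U) \<in> extensional {..r}" by (simp add: glue_flag_def split_flag_def)
    show "U \<in> extensional {..r}" using FU by (simp add: Fl_pts)
    fix k assume "k \<in> {..r}"
    then have k: "k \<le> r" by simp
    show "glue_flag (split_flag U) k = U k"
    proof (cases k)
      case 0
      then show ?thesis using FU by (simp add: split_flag_def glue_flag_eqs Fl_pts)
    next
      case (Suc k')
      have kr: "Suc k' \<le> r" "k' \<le> r - 1" using k Suc by auto
      have Um: "U k \<in> submodules n M" by (rule Fl_D(1)[OF FU k])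
      have "glue_flag (split_flag U) (Suc k') \<in> extensional {..<n}"
        using kr by (simp add: glue_flag_def split_flag_def)
      moreover have "U k \<in> extensional {..<n}" using Um by (simp add: submodules_def)
      moreover have "glue_flag (split_flag U) (Suc k') i = U k i" if i: "i < n" for i
      proof -
        have UkV: "U k i \<subseteq> carrier (vsp M i)" by (rule submodule_D(3)[OF Um i])
        have sub: "U 1 i \<subseteq> U k i" using Fl_mono[OF FU _ k i, of 1] Suc by simp
        have "x \<in> U k i" if x: "x \<in> carrier (vsp M i)" "y \<in> U k i" "h (U 1) i x = h (U 1) i y" for x y
        proof -
          note H = linear_map_D[OF h_D(1)[OF i, of "U 1"]]
          interpret Q: vectorspace class_ring "vsp N i" by (rule H(2))
          have yV: "y \<in> carrier (vsp M i)" using x(2) UkV by blast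
          have "h (U 1) i (x \<ominus>\<^bsub>vsp M i\<^esub> y) = \<zero>\<^bsub>vsp N i\<^esub>"
            unfolding H(7)[OF x(1) yV] x(3) using H(3)[OF yV] Q.r_neg by (simp add: a_minus_def)
          then have "x \<ominus>\<^bsub>vsp M i\<^esub> y \<in> U k i"
            using h_kernel[OF L i] sub vs_closed(4)[OF vs[OF i] x(1) yV] by blast
          then have "(x \<ominus>\<^bsub>vsp M i\<^esub> y) \<oplus>\<^bsub>vsp M i\<^esub> y \<in> U k i"
            using subspace_D(4)[OF submodule_D(1)[OF Um i]] x(2) by blast
          then show ?thesis using diff_add_cancel_carrier[OF vs[OF i] x(1) yV] by simp
        qed
        moreover have "glue_flag (split_flag U) (Suc k') i = {x \<in> carrier (vsp M i). h (U 1) i x \<in> h (U 1) i ` U k i}"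
          using glue_flag_eqs(2)[of k' i "U 1"] kr i Suc unfolding split_flag_def by simp
        ultimately show ?thesis using UkV by blast
      qed
      ultimately show ?thesis using Suc by (intro extensionalityI[of _ "{..<n}"]) auto
    qed
  qed
qed

lemma split_glue:
  assumes LV: "(L, V) \<in> pts (prod_variety S (Fl n N (r - 1) e))"
  shows "split_flag (glue_flag (L, V)) = (L, V)"
proof -
  have V: "V \<in> pts (Fl n N (r - 1) e)" using LV prod_pts by auto
  note 1 = glue_flag_pts(2)[OF LV]
  have "snd (split_flag (glue_flag (L, V))) = V"
  proof (rule extensionalityI)
    show "snd (split_flag (glue_flag (L, V))) \<in> extensional {..r - 1}" by (simp add: split_flag_def)
    show "V \<in> extensional {..r - 1}" using V by (simp add: Fl_pts)
    fix k assume "k \<in> {..r - 1}"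
    then have k: "k \<le> r - 1" "k < r" using r by auto
    have Vk: "V k \<in> submodules n N" using V k by (simp add: Fl_pts Gr_pts)
    show "snd (split_flag (glue_flag (L, V))) k = V k"
    proof (rule extensionalityI)
      show "snd (split_flag (glue_flag (L, V))) k \<in> extensional {..<n}" using k by (simp add: split_flag_def)
      show "V k \<in> extensional {..<n}" using Vk by (simp add: submodules_def)
      fix i assume "i \<in> {..<n}"
      then have i: "i < n" by simp
      have "V k i \<subseteq> carrier (vsp N i)" using subspace_D(2)[OF submodules_D(1)[OF Vk i]] .
      then show "snd (split_flag (glue_flag (L, V))) k i = V k i"
        using h_image_preimage[OF i, of "V k i" L] glue_flag_eqs(2)[OF k(2) i, of L V] 1 k i
        unfolding split_flag_def by simp
    qed
  qed
  moreover have "fst (split_flag (glue_flag (L, V))) = L" using 1 by (simp add: split_flag_def)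
  ultimately show ?thesis by (metis prod.collapse)
qed

end

section \<open>Regularity\<close>

lemma mhpoly_power: "mhpoly D P \<Longrightarrow> mhpoly (\<lambda>j. k * D j) (\<lambda>z. P z ^ k)"
proof (induction k)
  case 0
  show ?case using mhpoly.const[of 1] by simp
next
  case (Suc k)
  from mhpoly.mult[OF Suc.prems Suc.IH[OF Suc.prems]] show ?case by simp
qed

text \<open>Row expansion: if every form in a list is replaced by a combination of fixed transforms of it
  whose coefficients are quotients of polynomials, the coordinates remain polynomial after clearing
  denominators.\<close>

lemma multilinear_expansion:
  fixes D :: "'x \<Rightarrow> ('v \<Rightarrow> 'k::field) list \<Rightarrow> 'k" and hc :: "'x \<Rightarrow> 'j \<Rightarrow> 'c \<Rightarrow> 'k"
  assumes lin: "\<And>x xs ys g (I :: nat set) lk. x \<in> P \<Longrightarrow> finite I \<Longrightarrow> (\<And>k. k \<in> I \<Longrightarrow> linear_form V (lk k)) \<Longrightarrow>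
      D x (xs @ (\<lambda>z. \<Sum>k\<in>I. g k * lk k z) # ys) = (\<Sum>k\<in>I. g k * D x (xs @ lk k # ys))"
    and base: "\<And>ls. length ls = d \<Longrightarrow> \<forall>m\<in>set ls. linear_form V m \<Longrightarrow>
      \<exists>G. mhpoly F G \<and> (\<forall>x\<in>P. D x ls = \<sigma> x * G (hc x))"
    and A: "\<And>k. k \<le> q \<Longrightarrow> mhpoly E (A k)" and Q: "mhpoly E Q" "\<And>x. x \<in> P \<Longrightarrow> Q (hc x) \<noteq> 0"
    and T: "\<And>k m. k \<le> (q::nat) \<Longrightarrow> linear_form V m \<Longrightarrow> linear_form V (T k m)"
    and len: "length xs + length ys = d" and forms: "\<forall>m\<in>set xs \<union> set ys. linear_form V m"
  shows "\<exists>G. mhpoly (\<lambda>i. length ys * E i + F i) G \<and> (\<forall>x\<in>P.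
    D x (xs @ map (\<lambda>m z. \<Sum>k\<le>q. A k (hc x) / Q (hc x) * T k m z) ys) = \<sigma> x / Q (hc x) ^ length ys * G (hc x))"
  using len forms
proof (induction ys arbitrary: xs)
  case Nil
  then show ?case using base[of xs] by simp
next
  case (Cons m ys)
  let ?t = "\<lambda>x m z. \<Sum>k\<le>q. A k (hc x) / Q (hc x) * T k m z"
  define ok where "ok = (\<lambda>k G. mhpoly (\<lambda>i. length ys * E i + F i) G \<and> (\<forall>x\<in>P.
      D x ((xs @ [T k m]) @ map (?t x) ys) = \<sigma> x / Q (hc x) ^ length ys * G (hc x)))"
  have "\<exists>G. ok k G" if "k \<le> q" for k
    unfolding ok_def using Cons.prems T[OF that] by (intro Cons.IH) auto
  then have "\<forall>k\<in>{..q}. \<exists>G. ok k G" by blast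
  then obtain G where G_ok: "\<forall>k\<in>{..q}. ok k (G k)" by (rule bchoice[THEN exE])
  have G: "mhpoly (\<lambda>i. length ys * E i + F i) (G k)"
    "x \<in> P \<Longrightarrow> D x ((xs @ [T k m]) @ map (?t x) ys) = \<sigma> x / Q (hc x) ^ length ys * G k (hc x)"
    if "k \<le> q" for k x
    using G_ok that unfolding ok_def by blast+
  have AG: "mhpoly (\<lambda>i. length (m # ys) * E i + F i) (\<lambda>z. A k z * G k z)" if "k \<le> q" for k
    by (rule mhpoly_cong[OF mhpoly.mult[OF A[OF that] G(1)[OF that]]]) (simp_all add: algebra_simps)
  have "mhpoly (\<lambda>i. length (m # ys) * E i + F i) (\<lambda>z. \<Sum>k\<le>q. A k z * G k z)"
    using AG by (intro mhpoly_sum[where R = "\<lambda>z. A 0 z * G 0 z"]) auto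
  moreover have "D x (xs @ map (?t x) (m # ys)) =
      \<sigma> x / Q (hc x) ^ length (m # ys) * (\<Sum>k\<le>q. A k (hc x) * G k (hc x))" if x: "x \<in> P" for x
  proof -
    have "D x (xs @ map (?t x) (m # ys)) = (\<Sum>k\<le>q. A k (hc x) / Q (hc x) * D x (xs @ T k m # map (?t x) ys))"
      using lin[OF x, of "{..q}" "\<lambda>k. T k m" xs "\<lambda>k. A k (hc x) / Q (hc x)" "map (?t x) ys"] T Cons.prems
      by simp
    also have "\<dots> = (\<Sum>k\<le>q. A k (hc x) / Q (hc x) * (\<sigma> x / Q (hc x) ^ length ys * G k (hc x)))"
      using G(2)[OF _ x] by (intro sum.cong) auto
    also have "\<dots> = \<sigma> x / Q (hc x) ^ length (m # ys) * (\<Sum>k\<le>q. A k (hc x) * G k (hc x))"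
      unfolding sum_distrib_left by (intro sum.cong) (simp_all add: field_simps)
    finally show ?thesis .
  qed
  ultimately show ?case by blast
qed

context stratum_data begin

text \<open>The transforms of a form \<open>m\<close> whose combination with coefficients \<open>1, g 0, g 1, \<dots>\<close> is \<open>m \<circ> twist g\<close>.\<close>

definition tw_form :: "nat \<Rightarrow> nat \<Rightarrow> ('v \<Rightarrow> 'k) \<Rightarrow> 'v \<Rightarrow> 'k" where
  "tw_form i k m = (case k of 0 \<Rightarrow> m | Suc k' \<Rightarrow> m \<circ> \<psi> k' i)"

lemma tw_form_linear:
  assumes "i < n" "k \<le> q" "linear_form (vsp M i) m"
  shows "linear_form (vsp M i) (tw_form i k m)"
  using assms linear_form_pullback[OF \<psi>_linear] by (auto simp: tw_form_def split: nat.split)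

lemma twist_tw_form:
  assumes i: "i < n" and z: "z \<in> carrier (vsp M i)" and m: "linear_form (vsp M i) m"
  shows "m (twist g i z) = (\<Sum>k\<le>q. (case k of 0 \<Rightarrow> 1 | Suc k' \<Rightarrow> g k') * tw_form i k m z)"
  unfolding twist_form[OF i z m] lessThan_Suc_atMost[symmetric] sum.lessThan_Suc_shift
  by (simp add: tw_form_def)

text \<open>The coordinates of a line are the values of forms at a generator, so the parameters \<open>\<gamma>\<close> of the
  automorphism attached to a line are quotients of two of its coordinates.\<close>

lemma \<gamma>_ratio:
  assumes L: "L \<in> pts S"
  shows "plucker (vsp M i0) (L i0) [l] \<noteq> 0"
    and "k < q \<Longrightarrow> \<gamma> L k = plucker (vsp M i0) (L i0) [c k] / plucker (vsp M i0) (L i0) [l]"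
proof -
  note LS = submodule_D(1)[OF S_D(1)[OF L] i0]
  have f: "frame (vsp M i0) (L i0) [gen L] [l]"
    using line_frame[OF fd[OF i0] LS _ l gen(1,2)[OF L]] S_D(2)[OF L i0] by simp
  obtain a where a: "a \<noteq> 0" "\<And>fs. plucker (vsp M i0) (L i0) fs =
      (if length fs = length [gen L] \<and> (\<forall>m\<in>set fs. linear_form (vsp M i0) m) then a * gram fs [gen L] else 0)"
    by (rule plucker_frame[OF fd[OF i0] LS f]) (rule that, blast+)
  have g1: "gram [m] [gen L] = m (gen L)" for m :: "'v \<Rightarrow> 'k"
    unfolding gram_def by (subst det_single) auto
  have pl: "plucker (vsp M i0) (L i0) [m] = a * m (gen L)" if "linear_form (vsp M i0) m" for m
    unfolding a(2) using that g1 by simp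
  show "plucker (vsp M i0) (L i0) [l] \<noteq> 0" using pl[OF l] a(1) gen(2)[OF L] by simp
  show "\<gamma> L k = plucker (vsp M i0) (L i0) [c k] / plucker (vsp M i0) (L i0) [l]" if "k < q"
    using pl[OF l] pl[OF c[OF that]] a(1) gen(2)[OF L] by (simp add: \<gamma>_def)
qed

lemma hcoord_X: "hcoord X U (k, i) = (if k \<le> r \<and> i < n then plucker (vsp M i) (U k i) else (\<lambda>_. 0))"
  by (simp add: restrict_variety_def Fl_def)

lemma hcoord_prod:
  "hcoord (prod_variety S (Fl n N (r - 1) e)) (L, V) (Inl i) (Inl ls) =
    (if i < n then plucker (vsp M i) (L i) ls else 0)"
  "hcoord (prod_variety S (Fl n N (r - 1) e)) (L, V) (Inl i) (Inr fs) = 0"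
  "hcoord (prod_variety S (Fl n N (r - 1) e)) (L, V) (Inr (k, i)) (Inl ls) = 0"
  "hcoord (prod_variety S (Fl n N (r - 1) e)) (L, V) (Inr (k, i)) (Inr fs) =
    (if k \<le> r - 1 \<and> i < n then plucker (vsp N i) (V k i) fs else 0)"
  by (simp_all add: prod_variety_def Gr_stratum_def restrict_variety_def Gr_def Fl_def)

lemma h_kernel_frame:
  assumes L: "L \<in> pts S" and i: "i < n"
  shows "frame (vsp M i) {x \<in> carrier (vsp M i). h L i x = \<zero>\<^bsub>vsp N i\<^esub>}
    (if i = i0 then [gen L] else []) (if i = i0 then [l] else [])"
proof (cases "i = i0")
  case True
  then show ?thesis
    unfolding h_kernel[OF L i]
    using line_frame[OF fd[OF i0] submodule_D(1)[OF S_D(1)[OF L] i0] _ l gen(1,2)[OF L]] S_D(2)[OF L i0]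
    by simp
next
  case False
  then show ?thesis
    unfolding h_kernel[OF L i] L_zero[OF L i False]
    using linear_form_zero[OF vs[OF i]] by (simp add: frame_def dual_lists_Nil)
qed

text \<open>The coordinates of \<open>h L (U)\<close> are those of \<open>U\<close> at the forms pulled back along \<open>h L\<close>, completed by \<open>l\<close> at the vertex
  of the line.  Pulling back along \<open>h L\<close> means pulling back along the fixed projection to \<open>N\<close> and then along
  \<open>twist\<close>, whose parameters are quotients of coordinates of \<open>L\<close>; so multilinear expansion applies.\<close>

lemma split_flag_coordinates:
  assumes i: "i < n" and k: "k < r"
  shows "\<exists>E s. (\<forall>U\<in>pts X. s U \<noteq> 0) \<and> (\<forall>fs. \<exists>G. mhpoly E G \<and>
    (\<forall>U\<in>pts X. plucker (vsp N i) (h (U 1) i ` U (Suc k) i) fs = s U * G (hcoord X U)))"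
proof -
  let ?ms = "if i = i0 then [l] else []"
  define d where "d = nat (e k i)"
  have XD: "U 1 \<in> pts S" "U (Suc k) \<in> submodules n M" "U 1 i \<subseteq> U (Suc k) i" "U 1 \<in> submodules n M"
    "vdim (vsp N i) (h (U 1) i ` U (Suc k) i) = d" if U: "U \<in> pts X" for U
  proof -
    have FU: "U \<in> pts (Fl n M r dd)" and L: "U 1 \<in> pts S" using U X_pts by auto
    have Um: "U (Suc k) \<in> submodules n M" using Fl_D(1)[OF FU] k by simp
    have sub: "U 1 i \<subseteq> U (Suc k) i" using Fl_mono[OF FU _ _ i, of 1 "Suc k"] k by simp
    have "vdim (vsp M i) (U (Suc k) i) = (if i = i0 then 1 else 0) + vdim (vsp N i) (h (U 1) i ` U (Suc k) i)"
      by (rule vdim_h[OF L submodule_D(1)[OF Um i] sub i])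
    moreover have "int (vdim (vsp M i) (U (Suc k) i)) = dd (Suc k) i" using Fl_D(2)[OF FU _ i] k by simp
    ultimately have "vdim (vsp N i) (h (U 1) i ` U (Suc k) i) = d" unfolding d_def using dd1[OF i] by auto
    then show "U 1 \<in> pts S" "U (Suc k) \<in> submodules n M" "U 1 i \<subseteq> U (Suc k) i" "U 1 \<in> submodules n M"
      "vdim (vsp N i) (h (U 1) i ` U (Suc k) i) = d" using L Um sub S_D(1)[OF L] by auto
  qed
  define ok where "ok = (\<lambda>U a. a \<noteq> 0 \<and> (\<forall>fs. (\<forall>m\<in>set fs. linear_form (vsp N i) m) \<longrightarrow>
      plucker (vsp N i) (h (U 1) i ` U (Suc k) i) fs =
      a * plucker (vsp M i) (U (Suc k) i) (?ms @ map (\<lambda>m. m \<circ> h (U 1) i) fs)))"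
  have "\<exists>a. ok U a" if U: "U \<in> pts X" for U
  proof -
    note D = XD[OF U]
    have K: "{x \<in> carrier (vsp M i). h (U 1) i x = \<zero>\<^bsub>vsp N i\<^esub>} \<subseteq> U (Suc k) i"
      unfolding h_kernel[OF D(1) i] by (rule D(3))
    show ?thesis
    proof (rule plucker_image[OF fd[OF i] h_D(1,2)[OF i] submodule_D(1)[OF D(2) i] K h_kernel_frame[OF D(1) i]])
      fix a assume "a \<noteq> 0" "\<And>fs. (\<forall>m\<in>set fs. linear_form (vsp N i) m) \<Longrightarrow>
        plucker (vsp N i) (h (U 1) i ` U (Suc k) i) fs =
        a * plucker (vsp M i) (U (Suc k) i) (?ms @ map (\<lambda>m. m \<circ> h (U 1) i) fs)"
      then have "ok U a" unfolding ok_def by blast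
      then show "\<exists>a. ok U a" ..
    qed simp
  qed
  then have "\<forall>U\<in>pts X. \<exists>a. ok U a" by blast
  then obtain a where a_ok: "\<forall>U\<in>pts X. ok U (a U)" by (rule bchoice[THEN exE])
  have a: "a U \<noteq> 0" "\<forall>m\<in>set fs. linear_form (vsp N i) m \<Longrightarrow>
      plucker (vsp N i) (h (U 1) i ` U (Suc k) i) fs =
      a U * plucker (vsp M i) (U (Suc k) i) (?ms @ map (\<lambda>m. m \<circ> h (U 1) i) fs)" if "U \<in> pts X" for U fs
    using a_ok that unfolding ok_def by blast+
  \<comment> \<open>\<open>A j / Q\<close> are the coefficients of \<open>straight (U 1)\<close> in terms of the coordinates of \<open>U\<close>.\<close>
  define F where "F = ((\<lambda>_. 0)((Suc k, i) := 1) :: nat \<times> nat \<Rightarrow> nat)"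
  define E where "E = ((\<lambda>_. 0)((1, i0) := 1) :: nat \<times> nat \<Rightarrow> nat)"
  define Q where "Q = (\<lambda>z :: nat \<times> nat \<Rightarrow> ('v \<Rightarrow> 'k) list \<Rightarrow> 'k. z (1, i0) [l])"
  define A where "A = (\<lambda>j. \<lambda>z :: nat \<times> nat \<Rightarrow> ('v \<Rightarrow> 'k) list \<Rightarrow> 'k.
    case j of 0 \<Rightarrow> z (1, i0) [l] | Suc j' \<Rightarrow> - 1 * z (1, i0) [c j'])"
  have hF: "mhpoly F (\<lambda>z :: nat \<times> nat \<Rightarrow> ('v \<Rightarrow> 'k) list \<Rightarrow> 'k. z (Suc k, i) ls)" for ls
    unfolding F_def by (rule mhpoly.coord)
  have hE: "mhpoly E (\<lambda>z :: nat \<times> nat \<Rightarrow> ('v \<Rightarrow> 'k) list \<Rightarrow> 'k. z (1, i0) ls)" for ls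
    unfolding E_def by (rule mhpoly.coord)
  have hQ: "mhpoly E Q" unfolding Q_def by (rule hE)
  have hA: "mhpoly E (A j)" for j
    unfolding A_def using hE mhpoly_scale[OF hE, of "- 1"] by (cases j) auto
  have Q0: "Q (hcoord X U) = plucker (vsp M i0) (U 1 i0) [l]" "Q (hcoord X U) \<noteq> 0" if "U \<in> pts X" for U
    using \<gamma>_ratio(1)[OF XD(1)[OF that]] r i0 by (auto simp: Q_def hcoord_X simp del: One_nat_def)
  have ratio: "A j (hcoord X U) / Q (hcoord X U) = (case j of 0 \<Rightarrow> 1 | Suc j' \<Rightarrow> - \<gamma> (U 1) j')"
    if "U \<in> pts X" "j \<le> q" for U j
    using that Q0[OF that(1)] \<gamma>_ratio(2)[OF XD(1)[OF that(1)]] r i0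
    by (auto simp: A_def Q_def hcoord_X simp del: One_nat_def split: nat.split)
  define H where "H = (\<lambda>j. d * E j + F j)"
  have zero: "mhpoly H (\<lambda>z :: nat \<times> nat \<Rightarrow> ('v \<Rightarrow> 'k) list \<Rightarrow> 'k. 0 :: 'k)"
    unfolding H_def by (rule mhpoly_zero[OF mhpoly.mult[OF mhpoly_power[OF hQ] hF]])
  have good: "\<exists>G. mhpoly H G \<and> (\<forall>U\<in>pts X.
      plucker (vsp N i) (h (U 1) i ` U (Suc k) i) fs = a U / Q (hcoord X U) ^ d * G (hcoord X U))"
    if fs: "length fs = d" "\<forall>m\<in>set fs. linear_form (vsp N i) m" for fs
  proof -
    define ys where "ys = map (\<lambda>m. m \<circ> (\<lambda>x. U0 i +>\<^bsub>vsp M i\<^esub> x)) fs"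
    have ys: "\<forall>m\<in>set ys. linear_form (vsp M i) m"
      unfolding ys_def using fs(2) linear_form_pullback[OF rep_epi_D(1)[OF N_epi i]] by auto
    have lys: "length ys = d" using fs by (simp add: ys_def)
    have "\<exists>G. mhpoly (\<lambda>j. length ys * E j + F j) G \<and> (\<forall>U\<in>pts X.
      plucker (vsp M i) (U (Suc k) i)
        (?ms @ map (\<lambda>m z. \<Sum>j\<le>q. A j (hcoord X U) / Q (hcoord X U) * tw_form i j m z) ys) =
      1 / Q (hcoord X U) ^ length ys * G (hcoord X U))"
    proof (rule multilinear_expansion[where d = "length ?ms + length ys" and V = "vsp M i"])
      show "\<exists>G. mhpoly F G \<and> (\<forall>U\<in>pts X. plucker (vsp M i) (U (Suc k) i) ls = 1 * G (hcoord X U))" for ls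
        using hF[of ls] k i by (intro exI[of _ "\<lambda>z. z (Suc k, i) ls"]) (simp add: hcoord_X del: One_nat_def)
      show "\<forall>m\<in>set ?ms \<union> set ys. linear_form (vsp M i) m" using ys l by auto
      show "plucker (vsp M i) (U (Suc k) i) (xs @ (\<lambda>z. \<Sum>j\<in>I. g j * lk j z) # zs) =
          (\<Sum>j\<in>I. g j * plucker (vsp M i) (U (Suc k) i) (xs @ lk j # zs))"
        if "finite I" "\<And>j. j \<in> I \<Longrightarrow> linear_form (vsp M i) (lk j)" for U xs zs g I lk
        by (rule plucker_row_sum[OF that(2,1)])
    qed (use hA hQ Q0 tw_form_linear[OF i] in auto)
    then obtain G where G: "mhpoly H G" "\<And>U. U \<in> pts X \<Longrightarrow> plucker (vsp M i) (U (Suc k) i)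
        (?ms @ map (\<lambda>m z. \<Sum>j\<le>q. A j (hcoord X U) / Q (hcoord X U) * tw_form i j m z) ys) =
      1 / Q (hcoord X U) ^ d * G (hcoord X U)" unfolding lys H_def by blast
    have "plucker (vsp N i) (h (U 1) i ` U (Suc k) i) fs = a U / Q (hcoord X U) ^ d * G (hcoord X U)"
      if U: "U \<in> pts X" for U
    proof -
      have "plucker (vsp M i) (U (Suc k) i) (?ms @ map (\<lambda>m. m \<circ> h (U 1) i) fs) =
          plucker (vsp M i) (U (Suc k) i)
            (?ms @ map (\<lambda>m z. \<Sum>j\<le>q. A j (hcoord X U) / Q (hcoord X U) * tw_form i j m z) ys)"
      proof (rule plucker_cong[OF fd[OF i] submodule_D(1)[OF XD(2)[OF U] i]])
        fix b x assume b: "b < length (?ms @ map (\<lambda>m. m \<circ> h (U 1) i) fs)" and x: "x \<in> carrier (vsp M i)"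
        have eq: "(m \<circ> h (U 1) i) x = (\<Sum>j\<le>q. A j (hcoord X U) / Q (hcoord X U) *
            tw_form i j (m \<circ> (\<lambda>x. U0 i +>\<^bsub>vsp M i\<^esub> x)) x)" if m: "linear_form (vsp N i) m" for m
        proof -
          have "(m \<circ> h (U 1) i) x = (m \<circ> (\<lambda>x. U0 i +>\<^bsub>vsp M i\<^esub> x)) (twist (\<lambda>k. - \<gamma> (U 1) k) i x)"
            by (simp add: h_def straight_def)
          also have "\<dots> = (\<Sum>j\<le>q. A j (hcoord X U) / Q (hcoord X U) *
              tw_form i j (m \<circ> (\<lambda>x. U0 i +>\<^bsub>vsp M i\<^esub> x)) x)"
            unfolding twist_tw_form[OF i x linear_form_pullback[OF rep_epi_D(1)[OF N_epi i] m]]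
            using ratio[OF U] by (intro sum.cong) auto
          finally show ?thesis .
        qed
        show "((?ms @ map (\<lambda>m. m \<circ> h (U 1) i) fs) ! b) x =
          ((?ms @ map (\<lambda>m z. \<Sum>j\<le>q. A j (hcoord X U) / Q (hcoord X U) * tw_form i j m z) ys) ! b) x"
        proof (cases "b < length ?ms")
          case False
          then have b': "b - length ?ms < length fs" using b by (simp only: length_append length_map)
          then have "linear_form (vsp N i) (fs ! (b - length ?ms))" using fs(2) by simp
          from eq[OF this] show ?thesis
            using False b' by (simp only: nth_append if_False nth_map ys_def length_map)
        qed (simp add: nth_append)
      qed (simp add: ys_def)
      then show ?thesis unfolding a(2)[OF U fs(2)] G(2)[OF U, symmetric] using G(2)[OF U] by simp
    qed
    then show ?thesis using G(1) by blast
  qed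
  show ?thesis
  proof (intro exI[of _ H] exI[of _ "\<lambda>U. a U / Q (hcoord X U) ^ d"] conjI ballI allI)
    show "a U / Q (hcoord X U) ^ d \<noteq> 0" if "U \<in> pts X" for U using a(1)[OF that] Q0(2)[OF that] by simp
    fix fs :: "('v set \<Rightarrow> 'k) list"
    show "\<exists>G. mhpoly H G \<and> (\<forall>U\<in>pts X. plucker (vsp N i) (h (U 1) i ` U (Suc k) i) fs =
        a U / Q (hcoord X U) ^ d * G (hcoord X U))"
    proof (cases "length fs = d \<and> (\<forall>m\<in>set fs. linear_form (vsp N i) m)")
      \<comment> \<open>Lists of the wrong length, and lists containing other functions than forms, have coordinate 0.\<close>
      case False
      have "plucker (vsp N i) (h (U 1) i ` U (Suc k) i) fs = 0" if U: "U \<in> pts X" for U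
        using plucker_length[OF fd_N[OF i] image_subspace[OF h_D(1)[OF i] submodule_D(1)[OF XD(2)[OF U] i]]]
          XD(5)[OF U] False by metis
      then show ?thesis using zero by (intro exI[of _ "\<lambda>z. 0"]) simp
    qed (use good in blast)
  qed
qed


abbreviation "Y \<equiv> prod_variety S (Fl n N (r - 1) e)"

lemma straight_image_glue:
  assumes i: "i < n" and k: "k < r"
  shows "straight L i ` glue_flag (L, V) (Suc k) i = {z \<in> carrier (vsp M i). U0 i +>\<^bsub>vsp M i\<^esub> z \<in> V k i}"
  unfolding glue_flag_eqs(2)[OF k i]
proof (intro equalityI subsetI)
  fix y assume "y \<in> {z \<in> carrier (vsp M i). U0 i +>\<^bsub>vsp M i\<^esub> z \<in> V k i}"
  then have y: "y \<in> carrier (vsp M i)" "U0 i +>\<^bsub>vsp M i\<^esub> y \<in> V k i" by auto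
  show "y \<in> straight L i ` {x \<in> carrier (vsp M i). h L i x \<in> V k i}"
    using y straight_inverse(1,4)[OF i y(1), of L]
    by (intro image_eqI[of _ _ "unstraight L i y"]) (auto simp: h_def)
qed (auto simp: h_def straight_inverse(3)[OF i])

text \<open>For the fixed projection \<open>M \<rightarrow> N\<close> the coordinates of a preimage are linear in those of the image: by
  \<open>plucker_preimage_line\<close> at the vertex of the line \<open>U0\<close>, while at the other vertices the projection is bijective.\<close>

lemma projection_preimage_coordinates:
  assumes i: "i < n" and k: "k < r"
  shows "\<exists>F s. (\<forall>x\<in>pts Y. s x \<noteq> 0) \<and> 
    (\<exists>P :: (nat + nat \<times> nat \<Rightarrow> ('v \<Rightarrow> 'k) list + ('v set \<Rightarrow> 'k) list \<Rightarrow> 'k) \<Rightarrow> 'k. mhpoly F P) \<and>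
    (\<forall>ls. length ls = nat (dd (Suc k) i) \<longrightarrow>
    (\<forall>m\<in>set ls. linear_form (vsp M i) m) \<longrightarrow> (\<exists>G. mhpoly F G \<and> (\<forall>x\<in>pts Y.
      plucker (vsp M i) {z \<in> carrier (vsp M i). U0 i +>\<^bsub>vsp M i\<^esub> z \<in> snd x k i} ls = s x * G (hcoord Y x))))"
    (is "\<exists>F s. _ \<and> _ \<and> (\<forall>ls. _ \<longrightarrow> _ \<longrightarrow> (\<exists>G. _ \<and> (\<forall>x\<in>pts Y. plucker _ (?B x) ls = _)))")
proof -
  let ?\<pi> = "\<lambda>x. U0 i +>\<^bsub>vsp M i\<^esub> x"
  note E = rep_epi_D(1,2)[OF N_epi i]
  note US = submodule_D(1)[OF U0m i]
  have ker: "{x \<in> carrier (vsp M i). ?\<pi> x = \<zero>\<^bsub>vsp N i\<^esub>} = U0 i"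
    using quot_proj(3)[OF US] subspace_D(2)[OF US] unfolding quot_rep_vsp by auto
  have B: "VectorSpace.subspace class_ring (?B x) (vsp M i)" "U0 i \<subseteq> ?B x" "?\<pi> ` ?B x = snd x k i"
    "vdim (vsp M i) (?B x) = nat (dd (Suc k) i)" if x: "x \<in> pts Y" for x
  proof -
    obtain L V where LV: "x = (L, V)" by (cases x)
    then have V: "V \<in> pts (Fl n N (r - 1) e)" using x prod_pts by auto
    then have Vk: "V k \<in> submodules n N" "int (vdim (vsp N i) (V k i)) = dd (Suc k) i - dd 1 i"
      using k i by (auto simp: Fl_pts Gr_pts)
    note VS = submodules_D(1)[OF Vk(1) i]
    show BS: "VectorSpace.subspace class_ring (?B x) (vsp M i)"
      using preimage_subspace[OF E(1) VS] by (simp add: LV)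
    show UB: "U0 i \<subseteq> ?B x"
    proof
      fix z assume "z \<in> U0 i"
      then have z: "z \<in> carrier (vsp M i)" "?\<pi> z = \<zero>\<^bsub>vsp N i\<^esub>" using ker by blast+
      then show "z \<in> ?B x" using subspace_D(3)[OF VS] by (simp add: LV)
    qed
    show im: "?\<pi> ` ?B x = snd x k i"
    proof (intro equalityI subsetI)
      fix y assume y: "y \<in> snd x k i"
      then have "y \<in> ?\<pi> ` carrier (vsp M i)" using E(2) subspace_D(2)[OF VS] LV by auto
      then show "y \<in> ?\<pi> ` ?B x" using y by auto
    qed auto
    have "vdim (vsp M i) (?B x) = vdim (vsp M i) (U0 i) + vdim (vsp N i) (snd x k i)"
      using vdim_image[OF fd[OF i] E BS] UB unfolding ker im by blast
    then show "vdim (vsp M i) (?B x) = nat (dd (Suc k) i)"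
      using S_D(2)[OF U0 i] Vk(2) dd1[OF i] by (auto simp: LV split: if_splits)
  qed
  define F where "F = ((\<lambda>_. 0)(Inr (k, i) := 1) :: nat + nat \<times> nat \<Rightarrow> nat)"
  have hF: "mhpoly F (\<lambda>z :: nat + nat \<times> nat \<Rightarrow> ('v \<Rightarrow> 'k) list + ('v set \<Rightarrow> 'k) list \<Rightarrow> 'k. z (Inr (k, i)) c)" for c
    unfolding F_def by (rule mhpoly.coord)
  have hc: "hcoord Y x (Inr (k, i)) (Inr fs) = plucker (vsp N i) (snd x k i) fs" for x fs
    using k i by (cases x) (simp add: hcoord_prod del: One_nat_def)
  define G where "G = (\<lambda>ls. \<lambda>z :: nat + nat \<times> nat \<Rightarrow> ('v \<Rightarrow> 'k) list + ('v set \<Rightarrow> 'k) list \<Rightarrow> 'k.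
    if i = i0 then \<Sum>j<length ls. ((- 1) ^ j * (ls ! j) u) * z (Inr (k, i)) (Inr (map
        (\<lambda>m. descend (vsp M i) ?\<pi> (\<lambda>x. m x - m u * l x)) (take j ls @ drop (Suc j) ls)))
    else z (Inr (k, i)) (Inr (map (descend (vsp M i) ?\<pi>) ls)))"
  have G: "mhpoly F (G ls)" for ls
  proof (cases "i = i0")
    case True
    then show ?thesis
      unfolding G_def using mhpoly_scale[OF hF] by (simp, intro mhpoly_sum[OF _ hF]) blast
  next
    case False
    then show ?thesis unfolding G_def using hF by simp
  qed
  define ok where "ok = (\<lambda>x a. a \<noteq> 0 \<and> (\<forall>ls. length ls = nat (dd (Suc k) i) \<longrightarrow>
    (\<forall>m\<in>set ls. linear_form (vsp M i) m) \<longrightarrow> plucker (vsp M i) (?B x) ls = a * G ls (hcoord Y x)))"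
  have "\<exists>a. ok x a" if x: "x \<in> pts Y" for x
  proof (cases "i = i0")
    case True
    have fr: "frame (vsp M i) (U0 i) [u] [l]"
      using line_frame[OF fd[OF i0] submodule_D(1)[OF U0m i0] _ l u] S_D(2)[OF U0 i0] True by simp
    show ?thesis
    proof (rule plucker_preimage_line[OF fd[OF i] E B(1)[OF x], unfolded ker, OF B(2)[OF x] fr])
      fix a assume a: "a \<noteq> 0" "\<And>fs. length fs = vdim (vsp M i) (?B x) \<Longrightarrow>
        \<forall>l\<in>set fs. linear_form (vsp M i) l \<Longrightarrow>
        plucker (vsp M i) (?B x) fs = a * (\<Sum>j<length fs. (- 1) ^ j * (fs ! j) u *
          plucker (vsp N i) (?\<pi> ` ?B x) (map (\<lambda>m. descend (vsp M i) ?\<pi> (\<lambda>x. m x - m u * l x))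
            (take j fs @ drop (Suc j) fs)))"
      have "ok x a"
        unfolding ok_def
      proof (intro conjI allI impI)
        fix ls assume ls: "length ls = nat (dd (Suc k) i)" "\<forall>m\<in>set ls. linear_form (vsp M i) m"
        show "plucker (vsp M i) (?B x) ls = a * G ls (hcoord Y x)"
          using a(2)[OF _ ls(2)] ls(1) B(4)[OF x] True unfolding G_def hc B(3)[OF x] by simp
      qed (rule a(1))
      then show "\<exists>a. ok x a" ..
    qed
  next
    case False
    note U00 = L_zero[OF U0 i False]
    have fr: "frame (vsp M i) (U0 i) [] []"
      unfolding U00 using linear_form_zero[OF vs[OF i]] by (simp add: frame_def dual_lists_Nil)
    show ?thesis
    proof (rule plucker_image[OF fd[OF i] E B(1)[OF x], unfolded ker, OF B(2)[OF x] fr])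
      fix a assume a: "a \<noteq> 0" "\<And>fs. (\<forall>m\<in>set fs. linear_form (vsp N i) m) \<Longrightarrow>
        plucker (vsp N i) (?\<pi> ` ?B x) fs = a * plucker (vsp M i) (?B x) ([] @ map (\<lambda>m. m \<circ> ?\<pi>) fs)"
      have "ok x (1 / a)"
        unfolding ok_def
      proof (intro conjI allI impI)
        fix ls :: "('v \<Rightarrow> 'k) list" assume ls: "\<forall>m\<in>set ls. linear_form (vsp M i) m"
        have 0: "m z = 0" if "linear_form (vsp M i) m" "z \<in> carrier (vsp M i)" "?\<pi> z = \<zero>\<^bsub>vsp N i\<^esub>" for m z
        proof -
          have "z \<in> U0 i" using that ker by blast
          then show ?thesis using U00 linear_form_zero[OF vs[OF i] that(1)] by simp
        qed
        have desc: "linear_form (vsp N i) (descend (vsp M i) ?\<pi> m)"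
          "z \<in> carrier (vsp M i) \<Longrightarrow> descend (vsp M i) ?\<pi> m (?\<pi> z) = m z" if "m \<in> set ls" for m z
          using descend[OF E, of m] ls that 0 by blast+
        have "plucker (vsp N i) (?\<pi> ` ?B x) (map (descend (vsp M i) ?\<pi>) ls) =
            a * plucker (vsp M i) (?B x) (map (\<lambda>m. m \<circ> ?\<pi>) (map (descend (vsp M i) ?\<pi>) ls))"
          using a(2)[of "map (descend (vsp M i) ?\<pi>) ls"] desc(1) by simp
        also have "plucker (vsp M i) (?B x) (map (\<lambda>m. m \<circ> ?\<pi>) (map (descend (vsp M i) ?\<pi>) ls)) =
            plucker (vsp M i) (?B x) ls"
          using desc(2) by (intro plucker_cong[OF fd[OF i] B(1)[OF x]]) auto
        finally show "plucker (vsp M i) (?B x) ls = 1 / a * G ls (hcoord Y x)"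
          using a(1) False unfolding G_def hc B(3)[OF x] by simp
      qed (use a(1) in simp)
      then show "\<exists>a. ok x a" ..
    qed simp
  qed
  then have "\<forall>x\<in>pts Y. \<exists>a. ok x a" by blast
  then obtain s where s: "\<forall>x\<in>pts Y. ok x (s x)" by (rule bchoice[THEN exE])
  show ?thesis
  proof (intro exI[of _ F] exI[of _ s] conjI ballI allI impI)
    show "s x \<noteq> 0" if "x \<in> pts Y" for x using s that unfolding ok_def by blast
    show "\<exists>P :: (nat + nat \<times> nat \<Rightarrow> ('v \<Rightarrow> 'k) list + ('v set \<Rightarrow> 'k) list \<Rightarrow> 'k) \<Rightarrow> 'k. mhpoly F P"
      using G by blast
    fix ls :: "('v \<Rightarrow> 'k) list"
    assume "length ls = nat (dd (Suc k) i)" "\<forall>m\<in>set ls. linear_form (vsp M i) m"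
    then have "\<forall>x\<in>pts Y. plucker (vsp M i) (?B x) ls = s x * G ls (hcoord Y x)"
      using s unfolding ok_def by blast
    then show "\<exists>G. mhpoly F G \<and> (\<forall>x\<in>pts Y. plucker (vsp M i) (?B x) ls = s x * G (hcoord Y x))"
      using G by blast
  qed
qed


text \<open>The member \<open>Suc k\<close> of the glued flag is the image under \<open>unstraight L\<close> of the preimage of \<open>V k\<close> under the fixed
  projection, so its coordinates arise from those of that preimage by multilinear expansion.\<close>

lemma glue_flag_coordinates:
  assumes i: "i < n" and k: "k < r"
  shows "\<exists>E s. (\<forall>x\<in>pts Y. s x \<noteq> 0) \<and> (\<forall>ls. \<exists>G. mhpoly E G \<and>
    (\<forall>x\<in>pts Y. plucker (vsp M i) (glue_flag x (Suc k) i) ls = s x * G (hcoord Y x)))"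
proof -
  define d where "d = nat (dd (Suc k) i)"
  let ?\<pi> = "\<lambda>x. U0 i +>\<^bsub>vsp M i\<^esub> x"
  define B where "B = (\<lambda>x :: (nat \<Rightarrow> 'v set) \<times> (nat \<Rightarrow> nat \<Rightarrow> 'v set set).
    {z \<in> carrier (vsp M i). ?\<pi> z \<in> snd x k i})"
  obtain F \<sigma> and P :: "(nat + nat \<times> nat \<Rightarrow> ('v \<Rightarrow> 'k) list + ('v set \<Rightarrow> 'k) list \<Rightarrow> 'k) \<Rightarrow> 'k"
    where \<sigma>: "\<forall>x\<in>pts Y. \<sigma> x \<noteq> 0" and P: "mhpoly F P"
    and base: "\<forall>ls. length ls = d \<longrightarrow> (\<forall>m\<in>set ls. linear_form (vsp M i) m) \<longrightarrow>
      (\<exists>G. mhpoly F G \<and> (\<forall>x\<in>pts Y. plucker (vsp M i) (B x) ls = \<sigma> x * G (hcoord Y x)))"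
    using projection_preimage_coordinates[OF i k] unfolding B_def d_def by blast
  have XD: "fst x \<in> pts S" "glue_flag x (Suc k) \<in> submodules n M"
    "vdim (vsp M i) (glue_flag x (Suc k) i) = d" "straight (fst x) i ` glue_flag x (Suc k) i = B x"
    if x: "x \<in> pts Y" for x
  proof -
    obtain L V where LV: "x = (L, V)" by (cases x)
    have "glue_flag (L, V) \<in> pts (Fl n M r dd)" using glue_flag_pts(1) x LV X_pts by blast
    note FD = Fl_D[OF this, of "Suc k"]
    show "glue_flag x (Suc k) \<in> submodules n M" using FD(1) k by (simp add: LV)
    have "int (vdim (vsp M i) (glue_flag x (Suc k) i)) = dd (Suc k) i" using FD(2)[OF _ i] k by (simp add: LV)
    then show "vdim (vsp M i) (glue_flag x (Suc k) i) = d" unfolding d_def by (metis nat_int)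
    show "fst x \<in> pts S" using x LV prod_pts by auto
    show "straight (fst x) i ` glue_flag x (Suc k) i = B x"
      unfolding LV fst_conv B_def snd_conv by (rule straight_image_glue[OF i k])
  qed
  have fr: "frame (vsp M i) {\<zero>\<^bsub>vsp M i\<^esub>} [] []"
    using linear_form_zero[OF vs[OF i]] by (simp add: frame_def dual_lists_Nil)
  define ok where "ok = (\<lambda>x a. a \<noteq> 0 \<and> (\<forall>ls. (\<forall>m\<in>set ls. linear_form (vsp M i) m) \<longrightarrow>
    plucker (vsp M i) (glue_flag x (Suc k) i) ls =
    a * plucker (vsp M i) (B x) (map (\<lambda>m. m \<circ> unstraight (fst x) i) ls)))"
  have "\<exists>a. ok x a" if x: "x \<in> pts Y" for x
  proof -
    note D = XD[OF x]
    note lin = straight_linear[OF i, of "fst x"] and lin' = twist_linear[OF i, of "\<gamma> (fst x)", folded unstraight_def]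
    have ker: "{z \<in> carrier (vsp M i). straight (fst x) i z = \<zero>\<^bsub>vsp M i\<^esub>} = {\<zero>\<^bsub>vsp M i\<^esub>}"
    proof (intro equalityI subsetI)
      fix z assume "z \<in> {z \<in> carrier (vsp M i). straight (fst x) i z = \<zero>\<^bsub>vsp M i\<^esub>}"
      then have z: "z \<in> carrier (vsp M i)" "straight (fst x) i z = \<zero>\<^bsub>vsp M i\<^esub>" by auto
      then show "z \<in> {\<zero>\<^bsub>vsp M i\<^esub>}"
        using straight_inverse(2)[OF i z(1), of "fst x"] linear_map_D(6)[OF lin'] by simp
    qed (use linear_map_D(6)[OF lin] vs_closed(1)[OF vs[OF i]] in auto)
    note GS = submodule_D(1)[OF D(2) i]
    have sub: "{\<zero>\<^bsub>vsp M i\<^esub>} \<subseteq> glue_flag x (Suc k) i" using subspace_D(3)[OF GS] by simp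
    show ?thesis
    proof (rule plucker_image[OF fd[OF i] lin straight_surj[OF i] GS, unfolded ker, OF sub fr])
      fix a assume a: "a \<noteq> 0" "\<And>fs. (\<forall>m\<in>set fs. linear_form (vsp M i) m) \<Longrightarrow>
        plucker (vsp M i) (straight (fst x) i ` glue_flag x (Suc k) i) fs =
        a * plucker (vsp M i) (glue_flag x (Suc k) i) ([] @ map (\<lambda>m. m \<circ> straight (fst x) i) fs)"
      have "ok x (1 / a)"
        unfolding ok_def
      proof (intro conjI allI impI)
        fix ls :: "('v \<Rightarrow> 'k) list" assume ls: "\<forall>m\<in>set ls. linear_form (vsp M i) m"
        let ?ms = "map (\<lambda>m. m \<circ> unstraight (fst x) i) ls"
        have "plucker (vsp M i) (B x) ?ms =
            a * plucker (vsp M i) (glue_flag x (Suc k) i) (map (\<lambda>m. m \<circ> straight (fst x) i) ?ms)"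
          using a(2)[of ?ms] ls linear_form_pullback[OF lin'] unfolding D(4) by simp
        also have "plucker (vsp M i) (glue_flag x (Suc k) i) (map (\<lambda>m. m \<circ> straight (fst x) i) ?ms) =
            plucker (vsp M i) (glue_flag x (Suc k) i) ls"
          using straight_inverse(2)[OF i] by (intro plucker_cong[OF fd[OF i] GS]) auto
        finally have eq: "plucker (vsp M i) (B x) ?ms = a * plucker (vsp M i) (glue_flag x (Suc k) i) ls" .
        show "plucker (vsp M i) (glue_flag x (Suc k) i) ls = 1 / a * plucker (vsp M i) (B x) ?ms"
          unfolding eq using a(1) by simp
      qed (use a(1) in simp)
      then show "\<exists>a. ok x a" ..
    qed simp
  qed
  then have "\<forall>x\<in>pts Y. \<exists>a. ok x a" by blast
  then obtain a where a_ok: "\<forall>x\<in>pts Y. ok x (a x)" by (rule bchoice[THEN exE])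
  have a: "a x \<noteq> 0" "\<forall>m\<in>set ls. linear_form (vsp M i) m \<Longrightarrow> plucker (vsp M i) (glue_flag x (Suc k) i) ls =
      a x * plucker (vsp M i) (B x) (map (\<lambda>m. m \<circ> unstraight (fst x) i) ls)" if "x \<in> pts Y" for x ls
    using a_ok that unfolding ok_def by blast+
  define E where "E = ((\<lambda>_. 0)(Inl i0 := 1) :: nat + nat \<times> nat \<Rightarrow> nat)"
  define Q where "Q = (\<lambda>z :: nat + nat \<times> nat \<Rightarrow> ('v \<Rightarrow> 'k) list + ('v set \<Rightarrow> 'k) list \<Rightarrow> 'k. z (Inl i0) (Inl [l]))"
  define A where "A = (\<lambda>j. \<lambda>z :: nat + nat \<times> nat \<Rightarrow> ('v \<Rightarrow> 'k) list + ('v set \<Rightarrow> 'k) list \<Rightarrow> 'k.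
    case j of 0 \<Rightarrow> z (Inl i0) (Inl [l]) | Suc j' \<Rightarrow> z (Inl i0) (Inl [c j']))"
  have hE: "mhpoly E (\<lambda>z :: nat + nat \<times> nat \<Rightarrow> ('v \<Rightarrow> 'k) list + ('v set \<Rightarrow> 'k) list \<Rightarrow> 'k. z (Inl i0) f)" for f
    unfolding E_def by (rule mhpoly.coord)
  have hQ: "mhpoly E Q" unfolding Q_def by (rule hE)
  have hA: "mhpoly E (A j)" for j
    unfolding A_def using hE by (cases j) auto
  have hc: "hcoord Y x (Inl i0) (Inl fs) = plucker (vsp M i0) (fst x i0) fs" for x fs
    using i0 by (cases x) (simp add: hcoord_prod del: One_nat_def)
  have Q0: "Q (hcoord Y x) = plucker (vsp M i0) (fst x i0) [l]" "Q (hcoord Y x) \<noteq> 0" if "x \<in> pts Y" for x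
    using \<gamma>_ratio(1)[OF XD(1)[OF that]] by (auto simp only: Q_def hc)
  have ratio: "A j (hcoord Y x) / Q (hcoord Y x) = (case j of 0 \<Rightarrow> 1 | Suc j' \<Rightarrow> \<gamma> (fst x) j')"
    if "x \<in> pts Y" "j \<le> q" for x j
    using that Q0[OF that(1)] \<gamma>_ratio(2)[OF XD(1)[OF that(1)]]
    by (cases j) (simp_all only: A_def Q_def hc nat.case, auto)
  define H where "H = (\<lambda>j. d * E j + F j)"
  have zero: "mhpoly H (\<lambda>z :: nat + nat \<times> nat \<Rightarrow> ('v \<Rightarrow> 'k) list + ('v set \<Rightarrow> 'k) list \<Rightarrow> 'k. 0 :: 'k)"
    unfolding H_def by (rule mhpoly_zero[OF mhpoly.mult[OF mhpoly_power[OF hQ] P]])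
  have good: "\<exists>G. mhpoly H G \<and> (\<forall>x\<in>pts Y. plucker (vsp M i) (glue_flag x (Suc k) i) ls =
      a x * \<sigma> x / Q (hcoord Y x) ^ d * G (hcoord Y x))"
    if ls: "length ls = d" "\<forall>m\<in>set ls. linear_form (vsp M i) m" for ls
  proof -
    have "\<exists>G. mhpoly (\<lambda>j. length ls * E j + F j) G \<and> (\<forall>x\<in>pts Y.
      plucker (vsp M i) (B x)
        ([] @ map (\<lambda>m z. \<Sum>j\<le>q. A j (hcoord Y x) / Q (hcoord Y x) * tw_form i j m z) ls) =
      \<sigma> x / Q (hcoord Y x) ^ length ls * G (hcoord Y x))"
    proof (rule multilinear_expansion[where d = d and V = "vsp M i"])
      show "\<exists>G. mhpoly F G \<and> (\<forall>x\<in>pts Y. plucker (vsp M i) (B x) ls = \<sigma> x * G (hcoord Y x))"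
        if "length ls = d" "\<forall>m\<in>set ls. linear_form (vsp M i) m" for ls
        using base that by blast
      show "plucker (vsp M i) (B x) (xs @ (\<lambda>z. \<Sum>j\<in>I. g j * lk j z) # zs) =
          (\<Sum>j\<in>I. g j * plucker (vsp M i) (B x) (xs @ lk j # zs))"
        if "finite I" "\<And>j. j \<in> I \<Longrightarrow> linear_form (vsp M i) (lk j)" for x xs zs g I lk
        by (rule plucker_row_sum[OF that(2,1)])
      show "mhpoly E (A j)" for j by (rule hA)
      show "mhpoly E Q" by (rule hQ)
      show "Q (hcoord Y x) \<noteq> 0" if "x \<in> pts Y" for x by (rule Q0(2)[OF that])
      show "linear_form (vsp M i) (tw_form i j m)" if "j \<le> q" "linear_form (vsp M i) m" for j m
        by (rule tw_form_linear[OF i that])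
    qed (use ls in auto)
    then obtain G where G: "mhpoly H G" "\<And>x. x \<in> pts Y \<Longrightarrow> plucker (vsp M i) (B x)
        ([] @ map (\<lambda>m z. \<Sum>j\<le>q. A j (hcoord Y x) / Q (hcoord Y x) * tw_form i j m z) ls) =
      \<sigma> x / Q (hcoord Y x) ^ d * G (hcoord Y x)" unfolding ls(1) H_def by blast
    have "plucker (vsp M i) (glue_flag x (Suc k) i) ls = a x * \<sigma> x / Q (hcoord Y x) ^ d * G (hcoord Y x)"
      if x: "x \<in> pts Y" for x
    proof -
      have BS: "VectorSpace.subspace class_ring (B x) (vsp M i)"
        using image_subspace[OF straight_linear[OF i] submodule_D(1)[OF XD(2)[OF x] i]] XD(4)[OF x] by metis
      have "plucker (vsp M i) (B x) (map (\<lambda>m. m \<circ> unstraight (fst x) i) ls) =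
          plucker (vsp M i) (B x)
            ([] @ map (\<lambda>m z. \<Sum>j\<le>q. A j (hcoord Y x) / Q (hcoord Y x) * tw_form i j m z) ls)"
      proof (rule plucker_cong[OF fd[OF i] BS])
        fix b z assume b: "b < length (map (\<lambda>m. m \<circ> unstraight (fst x) i) ls)" and z: "z \<in> carrier (vsp M i)"
        then have m: "linear_form (vsp M i) (ls ! b)" using ls(2) by simp
        have "(ls ! b) (unstraight (fst x) i z) =
            (\<Sum>j\<le>q. A j (hcoord Y x) / Q (hcoord Y x) * tw_form i j (ls ! b) z)"
          unfolding unstraight_def twist_tw_form[OF i z m] using ratio[OF x] by (intro sum.cong) auto
        then show "(map (\<lambda>m. m \<circ> unstraight (fst x) i) ls ! b) z =
          (([] @ map (\<lambda>m z. \<Sum>j\<le>q. A j (hcoord Y x) / Q (hcoord Y x) * tw_form i j m z) ls) ! b) z"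
          using b by simp
      qed simp
      then show ?thesis unfolding a(2)[OF x ls(2)] using G(2)[OF x] by simp
    qed
    then show ?thesis using G(1) by blast
  qed
  show ?thesis
  proof (intro exI[of _ H] exI[of _ "\<lambda>x. a x * \<sigma> x / Q (hcoord Y x) ^ d"] conjI ballI allI)
    show "a x * \<sigma> x / Q (hcoord Y x) ^ d \<noteq> 0" if "x \<in> pts Y" for x
      using a(1)[OF that] Q0(2)[OF that] \<sigma> that by simp
    fix ls :: "('v \<Rightarrow> 'k) list"
    show "\<exists>G. mhpoly H G \<and> (\<forall>x\<in>pts Y. plucker (vsp M i) (glue_flag x (Suc k) i) ls =
        a x * \<sigma> x / Q (hcoord Y x) ^ d * G (hcoord Y x))"
    proof (cases "length ls = d \<and> (\<forall>m\<in>set ls. linear_form (vsp M i) m)")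
      \<comment> \<open>Lists of the wrong length, and lists containing other functions than forms, have coordinate 0.\<close>
      case False
      have "plucker (vsp M i) (glue_flag x (Suc k) i) ls = 0" if x: "x \<in> pts Y" for x
        using plucker_length[OF fd[OF i] submodule_D(1)[OF XD(2)[OF x] i]] XD(3)[OF x] False by metis
      then show ?thesis using zero by (intro exI[of _ "\<lambda>z. 0"]) simp
    qed (use good in blast)
  qed
qed

lemma block_zero:
  "(\<And>x c. x \<in> P \<Longrightarrow> f x c = 0) \<Longrightarrow>
    \<exists>E s. (\<forall>x\<in>P. s x \<noteq> (0 :: 'k)) \<and> (\<forall>c. \<exists>G. mhpoly E G \<and> (\<forall>x\<in>P. f x c = s x * G (hc x)))"
  using mhpoly.const[of 0] by (intro exI[of _ "\<lambda>_. 0"] exI[of _ "\<lambda>_. 1"]) auto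

lemma split_flag_morphism: "morphism X Y split_flag"
proof (rule morphismI)
  show "split_flag x \<in> pts Y" if "x \<in> pts X" for x by (rule split_flag_pts[OF that])
  fix j :: "nat + nat \<times> nat"
  show "\<exists>E s. (\<forall>x\<in>pts X. s x \<noteq> 0) \<and>
    (\<forall>c. \<exists>G. mhpoly E G \<and> (\<forall>x\<in>pts X. hcoord Y (split_flag x) j c = s x * G (hcoord X x)))"
  proof (cases j)
    case (Inl i)
    let ?E = "(\<lambda>_. 0)((1, i) := 1) :: nat \<times> nat \<Rightarrow> nat"
    have coord: "mhpoly ?E (\<lambda>z :: nat \<times> nat \<Rightarrow> ('v \<Rightarrow> 'k) list \<Rightarrow> 'k. z (1, i) ls)" for ls
      by (rule mhpoly.coord)
    have "\<exists>G. mhpoly ?E G \<and> (\<forall>x\<in>pts X. hcoord Y (split_flag x) j c = 1 * G (hcoord X x))" for c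
    proof (cases c)
      case (Inl ls)
      then show ?thesis
        using coord[of ls] r \<open>j = Sum_Type.Inl i\<close>
        by (intro exI[of _ "\<lambda>z. z (1, i) ls"]) (simp add: split_flag_def hcoord_prod hcoord_X del: One_nat_def)
    next
      case (Inr fs)
      then show ?thesis
        using mhpoly_zero[OF coord[of undefined]] \<open>j = Sum_Type.Inl i\<close>
        by (intro exI[of _ "\<lambda>z. 0"]) (simp add: split_flag_def hcoord_prod del: One_nat_def)
    qed
    then show ?thesis by (intro exI[of _ ?E] exI[of _ "\<lambda>_. 1"]) simp
  next
    case (Inr ki)
    obtain k i where ki: "j = Inr (k, i)" using Inr by (cases ki) auto
    show ?thesis
    proof (cases "k < r \<and> i < n")
      case True
      then obtain E s where s: "\<forall>U\<in>pts X. s U \<noteq> 0" and G: "\<forall>fs. \<exists>G. mhpoly E G \<and>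
          (\<forall>U\<in>pts X. plucker (vsp N i) (h (U 1) i ` U (Suc k) i) fs = s U * G (hcoord X U))"
        using split_flag_coordinates[of i k] by blast
      have coord: "hcoord Y (split_flag U) j (Inr fs) = plucker (vsp N i) (h (U 1) i ` U (Suc k) i) fs" for U fs
      proof -
        have "k \<le> r - 1" "i < n" using True by auto
        then show ?thesis by (simp add: ki split_flag_def hcoord_prod del: One_nat_def)
      qed
      have coord0: "hcoord Y (split_flag U) j (Inl ls) = 0" for U ls
        by (simp add: ki split_flag_def hcoord_prod del: One_nat_def)
      have "\<exists>G. mhpoly E G \<and> (\<forall>x\<in>pts X. hcoord Y (split_flag x) j c = s x * G (hcoord X x))" for c
      proof (cases c)
        case (Inl ls)
        obtain G0 :: "(nat \<times> nat \<Rightarrow> ('v \<Rightarrow> 'k) list \<Rightarrow> 'k) \<Rightarrow> 'k" where "mhpoly E G0" using G by blast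
        then show ?thesis unfolding Inl coord0 using mhpoly_zero by (intro exI[of _ "\<lambda>z. 0"]) simp
      next
        case (Inr fs)
        then show ?thesis unfolding Inr coord using G by blast
      qed
      then show ?thesis using s by blast
    next
      case False
      then have "hcoord Y (split_flag U) j c = 0" for U c
        using r by (cases c) (auto simp: ki split_flag_def hcoord_prod simp del: One_nat_def)
      then show ?thesis by (rule block_zero)
    qed
  qed
qed

lemma glue_flag_morphism: "morphism Y X glue_flag"
proof (rule morphismI)
  show "glue_flag x \<in> pts X" if "x \<in> pts Y" for x using glue_flag_pts(1) that by (cases x) blast
  fix j :: "nat \<times> nat"
  obtain k i where ki: "j = (k, i)" by (cases j)
  show "\<exists>E s. (\<forall>x\<in>pts Y. s x \<noteq> 0) \<and>
    (\<forall>c. \<exists>G. mhpoly E G \<and> (\<forall>x\<in>pts Y. hcoord X (glue_flag x) j c = s x * G (hcoord Y x)))"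
  proof (cases "k \<le> r \<and> i < n")
    case False
    then have "hcoord X (glue_flag x) j c = 0" for x c by (auto simp: ki hcoord_X simp del: One_nat_def)
    then show ?thesis by (rule block_zero)
  next
    case True
    then have i: "i < n" by simp
    have coord: "hcoord X (glue_flag x) j c = plucker (vsp M i) (glue_flag x k i) c" for x c
      using True by (simp add: ki hcoord_X del: One_nat_def)
    show ?thesis
    proof (cases k)
      case 0
      have z: "glue_flag x k i = {\<zero>\<^bsub>vsp M i\<^esub>}" for x
        using i glue_flag_eqs(1)[of "fst x" "snd x"] 0 by (simp add: zero_sub_def)
      show ?thesis
        unfolding coord z using mhpoly.const by (intro exI[of _ "\<lambda>_. 0"] exI[of _ "\<lambda>_. 1"]) auto
    next
      case (Suc k')
      then have k': "k' < r" using True by simp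
      show ?thesis unfolding coord Suc using glue_flag_coordinates[OF i k'] by blast
    qed
  qed
qed

lemma split_flag_iso: "variety_iso X Y split_flag"
  unfolding variety_iso_def
  using split_flag_morphism glue_flag_morphism glue_split split_glue by (intro conjI exI[of _ glue_flag]) auto

text \<open>\<open>straight (U 1)\<close> identifies \<open>M / U 1\<close> with \<open>M / U0\<close>, and \<open>h (U 1)\<close> pulls the member \<open>k\<close> of the quotient flag back
  to \<open>U (Suc k)\<close>.\<close>

lemma split_flag_quotients:
  assumes U: "U \<in> pts X"
  shows "rep_iso n (quot_rep n M (U 1)) N"
    and "k \<in> {1..r - 1} \<Longrightarrow> rep_iso n (quot_rep n M (U (Suc k))) (quot_rep n N (snd (split_flag U) k))"
proof -
  have FU: "U \<in> pts (Fl n M r dd)" and L: "U 1 \<in> pts S" using U X_pts by auto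
  have epi: "rep_epi n M M (straight (U 1))"
    unfolding rep_epi_def
    using straight_linear straight_surj twist_arr by (simp add: straight_def)
  show "rep_iso n (quot_rep n M (U 1)) N"
  proof (rule rep_iso_quotients[OF is_rep_M is_rep_M epi S_D(1)[OF L] U0m])
    fix i assume i: "i < n"
    have "h (U 1) i x = \<zero>\<^bsub>vsp N i\<^esub> \<longleftrightarrow> straight (U 1) i x \<in> U0 i" if "x \<in> carrier (vsp M i)" for x
      unfolding h_def quot_rep_vsp
      using quot_proj(3)[OF submodule_D(1)[OF U0m i] straight_inverse(3)[OF i that]] .
    then show "U 1 i = {x \<in> carrier (vsp M i). straight (U 1) i x \<in> U0 i}"
      using h_kernel[OF L i] by blast
  qed
  assume "k \<in> {1..r - 1}"
  then have k: "k < r" by auto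
  obtain L' V where LV: "split_flag U = (L', V)" by (cases "split_flag U")
  then have L': "L' = U 1" by (simp add: split_flag_def)
  have V: "V \<in> pts (Fl n N (r - 1) e)" using split_flag_pts[OF U] LV prod_pts by simp
  then have Vk: "V k \<in> submodules n N" using k by (simp add: Fl_pts Gr_pts)
  have "U (Suc k) i = {x \<in> carrier (vsp M i). h (U 1) i x \<in> V k i}" if "i < n" for i
    using glue_flag_eqs(2)[OF k that, of L' V] glue_split[OF U] LV L' by simp
  then show "rep_iso n (quot_rep n M (U (Suc k))) (quot_rep n N (snd (split_flag U) k))"
    using rep_iso_quotients[OF is_rep_M is_rep_N h_epi Fl_D(1)[OF FU] Vk] k LV by simp
qed

end

lemma nonneg_int_sum_eq_one:
  fixes v :: "nat \<Rightarrow> int"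
  assumes "\<And>i. i < n \<Longrightarrow> 0 \<le> v i" and "(\<Sum>i<n. v i) = 1"
  obtains i0 where "i0 < n" "\<And>i. i < n \<Longrightarrow> v i = (if i = i0 then 1 else 0)"
proof -
  have "\<exists>i0<n. v i0 \<noteq> 0"
    using assms(2) by (metis lessThan_iff sum.neutral zero_neq_one)
  then obtain i0 where i0: "i0 < n" "v i0 \<noteq> 0" by blast
  have split: "(\<Sum>i<n. v i) = v i0 + (\<Sum>i\<in>{..<n} - {i0}. v i)" using i0(1) by (intro sum.remove) auto
  have nn: "0 \<le> (\<Sum>i\<in>{..<n} - {i0}. v i)" using assms(1) by (intro sum_nonneg) auto
  have "v i0 \<ge> 1" using assms(1)[OF i0(1)] i0(2) by linarith
  then have 1: "v i0 = 1" and 0: "(\<Sum>i\<in>{..<n} - {i0}. v i) = 0" using split nn assms(2) by linarith+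
  have "\<forall>i\<in>{..<n} - {i0}. v i = 0" using 0 assms(1) by (subst (asm) sum_nonneg_eq_0_iff) auto
  then have "v i = (if i = i0 then 1 else 0)" if "i < n" for i using 1 that by auto
  then show ?thesis using that i0(1) by blast
qed

theorem theorem3p1:
  fixes n r :: nat
    and M :: "('k::alg_closed_field, 'v) cyc_rep"
    and dd :: "nat \<Rightarrow> nat \<Rightarrow> int"
    and W :: "nat \<Rightarrow> nat \<Rightarrow> 'v set"
    and w :: "nat \<Rightarrow> nat \<Rightarrow> nat"
    and U\<^sub>0 :: "nat \<Rightarrow> 'v set"
  assumes "n \<ge> 1" and "r \<ge> 1"
    and "complete_dim_filtration n r dd"
    and "nilpotent_rep n M"
    and "\<forall>i<n. int (vdim (vsp M i) (carrier (vsp M i))) = dd r i"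
    and "complete_soc_flag n M W"
    and "refines_soc_rad n M W"
    and "U\<^sub>0 \<in> pts (Gr_stratum n M (dd 1) W w)"
  shows "let N = quot_rep n M U\<^sub>0;
             e = (\<lambda>t i. dd (Suc t) i - dd 1 i);
             p = (\<lambda>U :: nat \<Rightarrow> nat \<Rightarrow> 'v set. U 1);
             S = Gr_stratum n M (dd 1) W w;
             X = restrict_variety (Fl n M r dd) (p -` pts S)
         in \<exists>f. variety_iso X (prod_variety S (Fl n N (r - 1) e)) f \<and>
                (\<forall>U\<in>pts X. fst (f U) = p U) \<and>
                (\<forall>U\<in>pts X. rep_iso n (quot_rep n M (U 1)) N \<and>
                   (\<forall>k\<in>{1..r - 1}.
                      rep_iso n (quot_rep n M (U (Suc k))) (quot_rep n N (snd (f U) k))))"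
proof -
  have dd0: "dd 0 i = 0" if "i < n" for i using assms(3) that by (simp add: complete_dim_filtration_def)
  have "0 \<le> dd 1 i" if "i < n" for i
    using assms(2,3) that unfolding complete_dim_filtration_def by blast
  moreover have "(\<Sum>i<n. dd 1 i) = 1"
  proof -
    have "(\<Sum>i<n. dd (Suc t) i) - (\<Sum>i<n. dd t i) = 1" if "t < r" for t
      using assms(3) that unfolding complete_dim_filtration_def by blast
    from this[of 0] show ?thesis using assms(2) dd0 by simp
  qed
  ultimately obtain i0 where i0: "i0 < n" and dd1: "\<And>i. i < n \<Longrightarrow> dd 1 i = (if i = i0 then 1 else 0)"
    using nonneg_int_sum_eq_one[of n "dd 1"] by metis
  interpret nilpotent_cyc n M by (rule nilpotent_cyc.intro[OF assms(1,4)])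
  have line: "L \<in> submodules n M" "has_rel_pos n M W w L"
    "i < n \<Longrightarrow> vdim (vsp M i) (L i) = (if i = i0 then 1 else 0)"
    if "L \<in> pts (Gr_stratum n M (dd 1) W w)" for L i
    using that dd1[of i] by (auto simp: Gr_stratum_pts Gr_pts split: if_splits)
  note U0 = line[OF assms(8)]
  show ?thesis
  proof (rule stratum_endomorphisms[OF assms(6,7) i0 U0(1,3,2)])
    fix l u c \<psi> and q :: nat
    assume data: "linear_form (vsp M i0) l" "u \<in> U\<^sub>0 i0" "l u = 1"
      "\<And>k. k < q \<Longrightarrow> linear_form (vsp M i0) (c k)"
      "\<And>k. k < q \<Longrightarrow> endo (\<psi> k)"
      "\<And>k k' i z. k < q \<Longrightarrow> k' < q \<Longrightarrow> i < n \<Longrightarrow> z \<in> carrier (vsp M i) \<Longrightarrow> \<psi> k i (\<psi> k' i z) = \<zero>\<^bsub>vsp M i\<^esub>"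
      "\<And>L. L \<in> submodules n M \<Longrightarrow> (\<And>i. i < n \<Longrightarrow> vdim (vsp M i) (L i) = (if i = i0 then 1 else 0)) \<Longrightarrow>
        has_rel_pos n M W w L \<Longrightarrow> \<exists>x\<in>L i0. l x = 1 \<and>
          (\<forall>m. linear_form (vsp M i0) m \<longrightarrow> m x = m u + (\<Sum>k<q. c k x * m (\<psi> k i0 u)))"
    interpret stratum_data n M r dd W w U\<^sub>0 i0 l u q c \<psi>
    proof
      show "int (vdim (vsp M i) (carrier (vsp M i))) = dd r i" if "i < n" for i using assms(5) that by blast
      show "\<exists>x\<in>L i0. l x = 1 \<and> (\<forall>m. linear_form (vsp M i0) m \<longrightarrow> m x = m u + (\<Sum>k<q. c k x * m (\<psi> k i0 u)))"
        if "L \<in> pts (Gr_stratum n M (dd 1) W w)" for L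
        using data(7)[OF line(1)[OF that] line(3)[OF that] line(2)[OF that]] .
    qed (fact assms(2) i0 dd0 dd1 assms(8) data(1-6))+
    show ?thesis
      unfolding Let_def
    proof (intro exI[of _ split_flag] conjI ballI)
      show "variety_iso X Y split_flag" by (rule split_flag_iso)
      show "fst (split_flag U) = U 1" for U by (simp add: split_flag_def)
    qed (rule split_flag_quotients, assumption+)+
  qed
qed

end
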